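(* Let $N\ge2$, let $a,b$ be integers coprime to $N$, let $n\in\mathbb Z_N$, and let $L\ge1$ satisfy $a^L\equiv b^L\equiv1\pmod N$. On a chain of $L$ $\mathbb Z_N$-qudits consider the symmetries $$\mathcal U_x=\bigotimes_{j=1}^LX_j^{a^{j-1}},\qquad \mathcal U_z=\bigotimes_{j=1}^LZ_j^{\,n b^{j-1}} .$$ Suppose $A$ is a left-canonical injective MPS tensor (physical dimension $N$) such that for all positive integers $m$ the periodic MPS $|\psi_{mL}\rangle$ is an eigenstate of $\mathcal U_x^{\otimes m}$ and of $\mathcal U_z^{\otimes m}$. Then there are bond unitaries $v_x,v_z$ such that for all $j$ $$X^{a^{j-1}}\cdot A\doteq (v_x^\dagger)^{a^{j-1}}A\,v_x^{a^j},\qquad Z^{nb^{j-1}}\cdot A\doteq (v_z^\dagger)^{b^{j-1}}A\,v_z^{b^j},$$ and $v_zv_xv_z^{-1}v_x^{-1}=e^{2\pi i k/N}\mathbb 1$ for some $k\in\mathbb Z_N$ satisfying $$k(ab-1)\equiv n\pmod N .$$ Consequently, with $c=\gcd(ab-1,N)$: if $c\nmid n$, no such injective MPS exists. If $c\mid n$, then $$k=\frac nc\Bigl(\frac{ab-1}{c}\Bigr)^{-1}_{N/c}+\tau\frac Nc\quad\text{for some }\tau\in\mathbb Z_c,$$ where $(\cdot)^{-1}_{N/c}$ is the multiplicative inverse modulo $N/c$. In particular, when $c=1$, the unique allowed $k$ is nonzero modulo $N$ precisely when $n\ne0$ in $\mathbb Z_N$.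
   Context: $X,Z$ are the $N\times N$ unitary shift and clock matrices: $X^N=Z^N=\mathbb 1$, $ZX=e^{2\pi i/N}XZ$, $Z$ diagonal with eigenvalues the $N$-th roots of unity; $X_j,Z_j$ act on site $j$. An MPS tensor is a tuple $A=(A^s)_{s=1}^d$ of complex $\chi\times\chi$ matrices. The periodic MPS on $M$ sites is $|\psi_M\rangle=\sum_{s_1,\dots,s_M}\mathrm{Tr}(A^{s_1}\cdots A^{s_M})|s_1\dots s_M\rangle$. The transfer channel is $\mathcal E(X)=\sum_s (A^s)^\dagger X A^s$. Left-canonical injective means: $\mathcal E(\mathbb 1)=\mathbb 1$; there is a positive definite $\rho$ with $\mathrm{Tr}\,\rho=1$ and $\sum_s A^s\rho (A^s)^\dagger=\rho$; and $1$ is a simple eigenvalue of $\mathcal E$ with all other eigenvalues of modulus strictly less than $1$. $(U\cdot A)^s=\sum_{s'}U_{ss'}A^{s'}$. The symbol $\doteq$ denotes equality up to a phase (modulus-one scalar, independent of the physical index). "Eigenstate of $\mathcal U$" means $\mathcal U|\psi\rangle=e^{i\theta}|\psi\rangle$ for some real $\theta$. Bond unitaries are unitary $\chi\times\chi$ matrices. *)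

theory Defs
  imports
    "HOL-Number_Theory.Modular_Inverse"
    "Jordan_Normal_Form.Gauss_Jordan_Elimination"
    "Jordan_Normal_Form.Schur_Decomposition"
begin

section \<open>Matrices\<close>

definition mat_inv :: "complex mat \<Rightarrow> complex mat" where
  "mat_inv M = the (mat_inverse M)"

text \<open>Integer powers; for a negative exponent this is meaningful only for invertible \<open>M\<close>.\<close>
definition mat_powi :: "complex mat \<Rightarrow> int \<Rightarrow> complex mat" where
  "mat_powi M k = (if 0 \<le> k then M ^\<^sub>m nat k else mat_inv M ^\<^sub>m nat (- k))"

definition mat_trace :: "complex mat \<Rightarrow> complex" where
  "mat_trace M = (\<Sum>i<dim_row M. M $$ (i, i))"

definition unitary_mat :: "nat \<Rightarrow> complex mat \<Rightarrow> bool" where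
  "unitary_mat n U \<longleftrightarrow>
     U \<in> carrier_mat n n \<and> U * mat_adjoint U = 1\<^sub>m n \<and> mat_adjoint U * U = 1\<^sub>m n"

definition pos_def_mat :: "nat \<Rightarrow> complex mat \<Rightarrow> bool" where
  "pos_def_mat n R \<longleftrightarrow>
     R \<in> carrier_mat n n \<and> mat_adjoint R = R \<and>
     (\<forall>v\<in>carrier_vec n. v \<noteq> 0\<^sub>v n \<longrightarrow> Re ((R *\<^sub>v v) \<bullet>c v) > 0)"

definition mat_sum :: "nat \<Rightarrow> ('i \<Rightarrow> complex mat) \<Rightarrow> 'i set \<Rightarrow> complex mat" where
  "mat_sum n F S = mat n n (\<lambda>ij. \<Sum>s\<in>S. F s $$ ij)"


section \<open>Shift and clock matrices\<close>

definition root_unity_pow :: "nat \<Rightarrow> int \<Rightarrow> complex" where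
  "root_unity_pow N k = cis (2 * pi * real_of_int k / real N)"

definition shift_mat :: "nat \<Rightarrow> complex mat" where
  "shift_mat N = mat N N (\<lambda>(i, j). if i = (j + 1) mod N then 1 else 0)"

definition clock_mat :: "nat \<Rightarrow> complex mat" where
  "clock_mat N = mat N N (\<lambda>(i, j). if i = j then root_unity_pow N (int i) else 0)"

lemma clock_shift_commute:
  "clock_mat N * shift_mat N = root_unity_pow N 1 \<cdot>\<^sub>m (shift_mat N * clock_mat N)"
proof (cases "N = 0")
  case True
  then show ?thesis by (intro eq_matI) (auto simp: clock_mat_def shift_mat_def)
next
  case False
  have r: "root_unity_pow N (int ((j + 1) mod N)) = root_unity_pow N 1 * root_unity_pow N (int j)"
    if "j < N" for j
  proof (cases "j + 1 = N")
    case True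
    have "2 * pi / real N + 2 * pi * real j / real N = 2 * pi * real (j + 1) / real N"
      by (simp add: add_divide_distrib algebra_simps)
    also have "\<dots> = 2 * pi"
      using True \<open>N \<noteq> 0\<close> by simp
    finally have "root_unity_pow N 1 * root_unity_pow N (int j) = cis (2 * pi)"
      by (simp add: root_unity_pow_def cis_mult)
    then show ?thesis using True by (simp add: root_unity_pow_def)
  next
    case False
    then show ?thesis using that
      by (simp add: root_unity_pow_def cis_mult add_divide_distrib algebra_simps)
  qed
  have L: "(clock_mat N * shift_mat N) $$ (i, j) =
      (if i = (j + 1) mod N then root_unity_pow N (int i) else 0)"
    if "i < N" "j < N" for i j
  proof -
    have "(clock_mat N * shift_mat N) $$ (i, j) =
        (\<Sum>l = 0..<N. (if i = l then root_unity_pow N (int i) else 0) *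
           (if l = (j + 1) mod N then 1 else 0))"
      using that by (simp add: clock_mat_def shift_mat_def scalar_prod_def)
    also have "\<dots> = (\<Sum>l = 0..<N. if i = l then
        (if i = (j + 1) mod N then root_unity_pow N (int i) else 0) else 0)"
      by (rule sum.cong) auto
    finally show ?thesis using that by simp
  qed
  have R: "(shift_mat N * clock_mat N) $$ (i, j) =
      (if i = (j + 1) mod N then root_unity_pow N (int j) else 0)"
    if "i < N" "j < N" for i j
  proof -
    have "(shift_mat N * clock_mat N) $$ (i, j) =
        (\<Sum>l = 0..<N. (if i = (l + 1) mod N then 1 else 0) *
           (if l = j then root_unity_pow N (int l) else 0))"
      using that by (simp add: clock_mat_def shift_mat_def scalar_prod_def)
    also have "\<dots> = (\<Sum>l = 0..<N. if l = j then
        (if i = (j + 1) mod N then root_unity_pow N (int j) else 0) else 0)"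
      by (rule sum.cong) auto
    finally show ?thesis using that by simp
  qed
  have d: "shift_mat N \<in> carrier_mat N N" "clock_mat N \<in> carrier_mat N N"
    by (auto simp: shift_mat_def clock_mat_def)
  show ?thesis
    by (rule eq_matI) (use d in \<open>auto simp: L R r[simplified] simp del: index_mult_mat(1)\<close>)
qed


section \<open>Chains of qudits and product operators\<close>

text \<open>
  A state on \<open>M\<close> sites is given by its amplitudes on the \<open>N ^ M\<close> configurations; values at
  other lists are irrelevant.
\<close>
type_synonym state = "nat list \<Rightarrow> complex"

definition configs :: "nat \<Rightarrow> nat \<Rightarrow> nat list set" where
  "configs N M = {s. length s = M \<and> set s \<subseteq> {..<N}}"

text \<open>
  The product operator with tensor factors \<open>Us ! 0\<close>, \<open>Us ! 1\<close>, \<dots> on \<open>length Us\<close> sites is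
  represented by the list \<open>Us\<close>; its matrix element between two configurations is the product
  of the on-site matrix elements.
\<close>
definition apply_product_op :: "nat \<Rightarrow> complex mat list \<Rightarrow> state \<Rightarrow> state" where
  "apply_product_op N Us \<psi> s =
     (\<Sum>t\<in>configs N (length Us). (\<Prod>i<length Us. (Us ! i) $$ (s ! i, t ! i)) * \<psi> t)"

text \<open>The \<open>m\<close>-fold tensor power of a product operator.\<close>
definition product_op_power :: "nat \<Rightarrow> complex mat list \<Rightarrow> complex mat list" where
  "product_op_power m Us = concat (replicate m Us)"

definition is_eigenstate :: "nat \<Rightarrow> complex mat list \<Rightarrow> state \<Rightarrow> bool" where
  "is_eigenstate N Us \<psi> \<longleftrightarrow>
     (\<exists>\<theta>::real. \<forall>s\<in>configs N (length Us). apply_product_op N Us \<psi> s = cis \<theta> * \<psi> s)"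

definition U_x :: "nat \<Rightarrow> int \<Rightarrow> nat \<Rightarrow> complex mat list" where
  "U_x N a L = map (\<lambda>j. mat_powi (shift_mat N) (a ^ (j - 1))) [1..<L + 1]"

definition U_z :: "nat \<Rightarrow> int \<Rightarrow> int \<Rightarrow> nat \<Rightarrow> complex mat list" where
  "U_z N n b L = map (\<lambda>j. mat_powi (clock_mat N) (n * b ^ (j - 1))) [1..<L + 1]"


section \<open>Matrix product states\<close>

text \<open>
  An MPS tensor with physical dimension \<open>N\<close> and bond dimension \<open>\<chi>\<close>; physical indices are
  \<open>0, \<dots>, N - 1\<close>.
\<close>
definition mps_tensor :: "nat \<Rightarrow> nat \<Rightarrow> (nat \<Rightarrow> complex mat) \<Rightarrow> bool" where
  "mps_tensor N \<chi> A \<longleftrightarrow> (\<forall>s<N. A s \<in> carrier_mat \<chi> \<chi>)"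

definition periodic_mps :: "nat \<Rightarrow> (nat \<Rightarrow> complex mat) \<Rightarrow> state" where
  "periodic_mps \<chi> A s = mat_trace (foldr (\<lambda>i P. A i * P) s (1\<^sub>m \<chi>))"

definition transfer_channel ::
    "nat \<Rightarrow> nat \<Rightarrow> (nat \<Rightarrow> complex mat) \<Rightarrow> complex mat \<Rightarrow> complex mat" where
  "transfer_channel N \<chi> A Y = mat_sum \<chi> (\<lambda>s. mat_adjoint (A s) * Y * A s) {..<N}"

text \<open>Eigenvalues of a linear map \<open>E\<close> on \<open>\<chi> \<times> \<chi>\<close> matrices.\<close>
definition map_eigenvalue :: "nat \<Rightarrow> (complex mat \<Rightarrow> complex mat) \<Rightarrow> complex \<Rightarrow> bool" where
  "map_eigenvalue \<chi> E l \<longleftrightarrow>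
     (\<exists>Y\<in>carrier_mat \<chi> \<chi>. Y \<noteq> 0\<^sub>m \<chi> \<chi> \<and> E Y = l \<cdot>\<^sub>m Y)"

definition gen_eigenspace ::
    "nat \<Rightarrow> (complex mat \<Rightarrow> complex mat) \<Rightarrow> complex \<Rightarrow> complex mat set" where
  "gen_eigenspace \<chi> E l =
     {Y \<in> carrier_mat \<chi> \<chi>. \<exists>r. ((\<lambda>W. E W - l \<cdot>\<^sub>m W) ^^ r) Y = 0\<^sub>m \<chi> \<chi>}"

text \<open>Algebraic multiplicity one: the generalized eigenspace is one-dimensional.\<close>
definition simple_map_eigenvalue ::
    "nat \<Rightarrow> (complex mat \<Rightarrow> complex mat) \<Rightarrow> complex \<Rightarrow> bool" where
  "simple_map_eigenvalue \<chi> E l \<longleftrightarrow>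
     (\<exists>Y\<in>carrier_mat \<chi> \<chi>. Y \<noteq> 0\<^sub>m \<chi> \<chi> \<and> gen_eigenspace \<chi> E l = range (\<lambda>c. c \<cdot>\<^sub>m Y))"

definition left_canonical_injective :: "nat \<Rightarrow> nat \<Rightarrow> (nat \<Rightarrow> complex mat) \<Rightarrow> bool" where
  "left_canonical_injective N \<chi> A \<longleftrightarrow>
     mps_tensor N \<chi> A \<and>
     transfer_channel N \<chi> A (1\<^sub>m \<chi>) = 1\<^sub>m \<chi> \<and>
     (\<exists>\<rho>. pos_def_mat \<chi> \<rho> \<and> mat_trace \<rho> = 1 \<and>
          mat_sum \<chi> (\<lambda>s. A s * \<rho> * mat_adjoint (A s)) {..<N} = \<rho>) \<and>
     simple_map_eigenvalue \<chi> (transfer_channel N \<chi> A) 1 \<and>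
     (\<forall>l. map_eigenvalue \<chi> (transfer_channel N \<chi> A) l \<and> l \<noteq> 1 \<longrightarrow> cmod l < 1)"

text \<open>The on-site action \<open>U \<cdot> A\<close>.\<close>
definition phys_act ::
    "nat \<Rightarrow> nat \<Rightarrow> complex mat \<Rightarrow> (nat \<Rightarrow> complex mat) \<Rightarrow> nat \<Rightarrow> complex mat" where
  "phys_act N \<chi> U A s = mat_sum \<chi> (\<lambda>t. U $$ (s, t) \<cdot>\<^sub>m A t) {..<N}"

definition eq_up_to_phase :: "nat \<Rightarrow> (nat \<Rightarrow> complex mat) \<Rightarrow> (nat \<Rightarrow> complex mat) \<Rightarrow> bool" where
  "eq_up_to_phase N A B \<longleftrightarrow> (\<exists>c. cmod c = 1 \<and> (\<forall>s<N. A s = c \<cdot>\<^sub>m B s))"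

text \<open>
  An injective MPS whose chains of \<open>m L\<close> sites, for every \<open>m > 0\<close>, are symmetric under both
  modulated symmetries.
\<close>
definition symmetric_injective_mps ::
    "nat \<Rightarrow> int \<Rightarrow> int \<Rightarrow> int \<Rightarrow> nat \<Rightarrow> nat \<Rightarrow> (nat \<Rightarrow> complex mat) \<Rightarrow> bool" where
  "symmetric_injective_mps N a b n L \<chi> A \<longleftrightarrow>
     left_canonical_injective N \<chi> A \<and>
     (\<forall>m>0. is_eigenstate N (product_op_power m (U_x N a L)) (periodic_mps \<chi> A) \<and>
            is_eigenstate N (product_op_power m (U_z N n b L)) (periodic_mps \<chi> A))"

end

theory Submission
  imports Defs
begin

text \<open>
  The overlap of the periodic MPS with its image under a product symmetry is the trace of a power of
  the mixed transfer channel of one period.  Since its modulus does not tend to \<open>0\<close>, that channel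
  has an eigenvalue of modulus at least \<open>1\<close>.  The channel is a contraction in the norm weighted by
  the fixed point \<open>\<rho>\<close>, and equality forces the eigenvector to intertwine the two tensors; this yields
  bond unitaries \<open>v\<^sub>j\<close> with \<open>U\<^sub>j \<cdot> A = v\<^sub>j\<^sup>\<dagger> A v\<^sub>j\<^sub>+\<^sub>1\<close>, periodic up to a phase.

  Two such chains for the same symmetry differ by a chain \<open>g\<^sub>j\<close> with \<open>E g\<^sub>j \<doteq> g\<^sub>j\<^sub>+\<^sub>1\<close>, and going once around
  the period shows that \<open>g\<^sub>j\<close> is a scalar.  Applied to \<open>v\<^sub>j\<^sup>a v\<^sub>j\<^sub>+\<^sub>1\<^sup>\<dagger>\<close> this gives \<open>v\<^sub>j\<^sub>+\<^sub>1 \<doteq> v\<^sub>j\<^sup>a\<close>; applied to the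
  commutators of the powers of \<open>v\<^sub>x\<close> and \<open>v\<^sub>z\<close> it gives a scalar \<open>\<kappa>\<close>, and comparing two adjacent bonds
  gives \<open>\<kappa>\<^sup>a\<^sup>b = \<omega>\<^sup>n \<kappa>\<close>; applied to \<open>v\<^sub>x\<^sup>N\<close> it shows that \<open>\<kappa>\<close> is an \<open>N\<close>-th root of unity.
\<close>

section \<open>Matrix algebra\<close>

text \<open>The on-site operator changes from site to site, so the uniqueness theorem for one
  translation-invariant tensor does not apply directly. Blocking a period would give only a gauge at
  its ends. The bond equation at every site is obtained by keeping all intermediate images of the
  eigenvector: one period returns at least the initial norm, so none of its \<open>L\<close>
  contraction steps can lose any. From the overlap only an eigenvalue of modulus at least 1 is
  extracted; that the modulus equals 1 follows from the contraction.

  Bond chains close only up to a phase, so quotients of chains are eigenvectors of a power of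
  \<open>E\<close> with unimodular eigenvalue rather than fixed points. The absence of other
  peripheral eigenvalues is what still makes them scalars. Commutators are used because the unknown
  phases of the bond equations cancel in them.

  The relation between \<open>\<kappa>\<close> and \<open>\<omega>\<close> alone does not make
  \<open>\<kappa>\<close> an \<open>N\<close>-th root of unity (for \<open>a * b = 1\<close> it
  leaves \<open>\<kappa>\<close> free), hence the separate argument through the \<open>N\<close>-th
  power of the shift bond unitary.\<close>

lemma mat_adjoint_carrier [simp]: "A \<in> carrier_mat n m \<Longrightarrow> mat_adjoint A \<in> carrier_mat m n"
  by (auto simp: mat_adjoint_def)

lemma mat_adjoint_dim [simp]: "dim_row (mat_adjoint A) = dim_col A" "dim_col (mat_adjoint A) = dim_row A"
  by (auto simp: mat_adjoint_def)

lemma mat_adjoint_index [simp]: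
  "i < dim_col A \<Longrightarrow> j < dim_row A \<Longrightarrow> mat_adjoint A $$ (i, j) = cnj (A $$ (j, i))"
  for A :: "complex mat"
  by (simp add: mat_adjoint_def mat_of_rows_def)

lemma mult_mat_index_sum:
  fixes A B :: "complex mat"
  assumes "A \<in> carrier_mat n m" "B \<in> carrier_mat m l" "i < n" "j < l"
  shows "(A * B) $$ (i, j) = (\<Sum>k<m. A $$ (i, k) * B $$ (k, j))"
  using assms by (simp add: scalar_prod_def atLeast0LessThan)

lemma mat_adjoint_mult:
  fixes A B :: "complex mat"
  assumes "A \<in> carrier_mat n m" "B \<in> carrier_mat m l"
  shows "mat_adjoint (A * B) = mat_adjoint B * mat_adjoint A"
proof (rule eq_matI)
  fix i j assume "i < dim_row (mat_adjoint B * mat_adjoint A)" "j < dim_col (mat_adjoint B * mat_adjoint A)"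
  then have ij: "i < l" "j < n" using assms by auto
  have "mat_adjoint (A * B) $$ (i, j) = cnj ((A * B) $$ (j, i))"
    using ij assms by (intro mat_adjoint_index) auto
  also have "\<dots> = (\<Sum>k<m. cnj (A $$ (j, k)) * cnj (B $$ (k, i)))"
    by (subst mult_mat_index_sum[OF assms ij(2,1)]) simp
  also have "\<dots> = (mat_adjoint B * mat_adjoint A) $$ (i, j)"
    using assms ij by (subst mult_mat_index_sum[of _ l m _ n]) (auto intro!: sum.cong)
  finally show "mat_adjoint (A * B) $$ (i, j) = (mat_adjoint B * mat_adjoint A) $$ (i, j)" .
qed (use assms in auto)

lemma mat_adjoint_adjoint [simp]: "mat_adjoint (mat_adjoint A) = A" for A :: "complex mat"
  by (rule eq_matI) auto

lemma mat_adjoint_smult [simp]: "mat_adjoint (c \<cdot>\<^sub>m A) = cnj c \<cdot>\<^sub>m mat_adjoint A" for A :: "complex mat"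
  by (rule eq_matI) auto

lemma mat_adjoint_one [simp]: "mat_adjoint (1\<^sub>m n) = (1\<^sub>m n :: complex mat)"
  by (rule eq_matI) auto

lemma mat_adjoint_minus:
  fixes A B :: "complex mat"
  assumes "A \<in> carrier_mat n m" "B \<in> carrier_mat n m"
  shows "mat_adjoint (A - B) = mat_adjoint A - mat_adjoint B"
  using assms by (intro eq_matI) auto

lemma mat_trace_mult_commute:
  assumes "A \<in> carrier_mat n m" "B \<in> carrier_mat m n"
  shows "mat_trace (A * B) = mat_trace (B * A)"
proof -
  have "mat_trace (A * B) = (\<Sum>i<n. \<Sum>k<m. A $$ (i, k) * B $$ (k, i))"
    unfolding mat_trace_def using assms
    by (intro sum.cong) (auto simp: mult_mat_index_sum[OF assms] simp del: index_mult_mat(1))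
  also have "\<dots> = (\<Sum>k<m. \<Sum>i<n. B $$ (k, i) * A $$ (i, k))"
    by (subst sum.swap) (simp add: mult.commute)
  also have "\<dots> = mat_trace (B * A)"
    unfolding mat_trace_def using assms
    by (intro sum.cong) (auto simp: mult_mat_index_sum[OF assms(2,1)] simp del: index_mult_mat(1))
  finally show ?thesis .
qed

lemma mat_trace_minus:
  "A \<in> carrier_mat n n \<Longrightarrow> B \<in> carrier_mat n n \<Longrightarrow> mat_trace (A - B) = mat_trace A - mat_trace B"
  by (simp add: mat_trace_def sum_subtractf)

lemma mat_trace_smult: "A \<in> carrier_mat n n \<Longrightarrow> mat_trace (c \<cdot>\<^sub>m A) = c * mat_trace A"
  by (simp add: mat_trace_def sum_distrib_left)

lemma mat_sum_carrier [simp]: "mat_sum n F S \<in> carrier_mat n n"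
  by (simp add: mat_sum_def)

lemma mat_sum_dim [simp]: "dim_row (mat_sum n F S) = n" "dim_col (mat_sum n F S) = n"
  by (simp_all add: mat_sum_def)

lemma mat_sum_index [simp]: "i < n \<Longrightarrow> j < n \<Longrightarrow> mat_sum n F S $$ (i, j) = (\<Sum>s\<in>S. F s $$ (i, j))"
  by (simp add: mat_sum_def)

text \<open>A congruence rule lets simp assume the index range inside the sum. The tensor matrices
  have a known dimension only for \<open>s < N\<close>, and every associativity or distributivity
  step needs those dimensions.\<close>

lemma mat_sum_cong [cong]: "S = T \<Longrightarrow> (\<And>s. s \<in> T =simp=> F s = G s) \<Longrightarrow> mat_sum n F S = mat_sum n G T"
  by (simp add: mat_sum_def simp_implies_def cong: sum.cong)

lemma square_mult_carrier [simp]: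
  "A \<in> carrier_mat n n \<Longrightarrow> B \<in> carrier_mat n n \<Longrightarrow> A * B \<in> carrier_mat n n"
  by (rule mult_carrier_mat)

lemma mult_mat_sum:
  assumes C: "C \<in> carrier_mat n n" and F: "\<forall>s\<in>S. F s \<in> carrier_mat n n"
  shows "C * mat_sum n F S = mat_sum n (\<lambda>s. C * F s) S"
proof (rule eq_matI)
  fix i j assume "i < dim_row (mat_sum n (\<lambda>s. C * F s) S)" "j < dim_col (mat_sum n (\<lambda>s. C * F s) S)"
  then have ij: "i < n" "j < n" by auto
  have "(C * mat_sum n F S) $$ (i, j) = (\<Sum>k<n. \<Sum>s\<in>S. C $$ (i, k) * F s $$ (k, j))"
    using ij by (subst mult_mat_index_sum[OF C mat_sum_carrier]) (auto simp: sum_distrib_left)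
  also have "\<dots> = (\<Sum>s\<in>S. (C * F s) $$ (i, j))"
    using ij by (subst sum.swap) (auto intro!: sum.cong simp: mult_mat_index_sum[OF C F[rule_format]] simp del: index_mult_mat(1))
  finally show "(C * mat_sum n F S) $$ (i, j) = mat_sum n (\<lambda>s. C * F s) S $$ (i, j)" using ij by simp
qed (use C in auto)

lemma mat_sum_mult:
  assumes C: "C \<in> carrier_mat n n" and F: "\<forall>s\<in>S. F s \<in> carrier_mat n n"
  shows "mat_sum n F S * C = mat_sum n (\<lambda>s. F s * C) S"
proof (rule eq_matI)
  fix i j assume "i < dim_row (mat_sum n (\<lambda>s. F s * C) S)" "j < dim_col (mat_sum n (\<lambda>s. F s * C) S)"
  then have ij: "i < n" "j < n" by auto
  have "(mat_sum n F S * C) $$ (i, j) = (\<Sum>k<n. \<Sum>s\<in>S. F s $$ (i, k) * C $$ (k, j))"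
    using ij by (subst mult_mat_index_sum[OF mat_sum_carrier C]) (auto simp: sum_distrib_right)
  also have "\<dots> = (\<Sum>s\<in>S. (F s * C) $$ (i, j))"
    using ij by (subst sum.swap) (auto intro!: sum.cong simp: mult_mat_index_sum[OF F[rule_format] C] simp del: index_mult_mat(1))
  finally show "(mat_sum n F S * C) $$ (i, j) = mat_sum n (\<lambda>s. F s * C) S $$ (i, j)" using ij by simp
qed (use C in auto)

lemma smult_mat_sum:
  assumes "\<forall>s\<in>S. F s \<in> carrier_mat n n"
  shows "c \<cdot>\<^sub>m mat_sum n F S = mat_sum n (\<lambda>s. c \<cdot>\<^sub>m F s) S"
proof (rule eq_matI)
  fix i j assume "i < dim_row (mat_sum n (\<lambda>s. c \<cdot>\<^sub>m F s) S)" "j < dim_col (mat_sum n (\<lambda>s. c \<cdot>\<^sub>m F s) S)"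
  then have ij: "i < n" "j < n" by auto
  have "(c \<cdot>\<^sub>m F s) $$ (i, j) = c * F s $$ (i, j)" if "s \<in> S" for s
    using assms that ij by auto
  then show "(c \<cdot>\<^sub>m mat_sum n F S) $$ (i, j) = mat_sum n (\<lambda>s. c \<cdot>\<^sub>m F s) S $$ (i, j)"
    using ij by (simp add: sum_distrib_left)
qed auto

lemma mat_sum_minus:
  assumes "\<forall>s\<in>S. F s \<in> carrier_mat n n" "\<forall>s\<in>S. G s \<in> carrier_mat n n"
  shows "mat_sum n (\<lambda>s. F s - G s) S = mat_sum n F S - mat_sum n G S"
proof (rule eq_matI)
  fix i j assume "i < dim_row (mat_sum n F S - mat_sum n G S)" "j < dim_col (mat_sum n F S - mat_sum n G S)"
  then have ij: "i < n" "j < n" by auto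
  have "(F s - G s) $$ (i, j) = F s $$ (i, j) - G s $$ (i, j)" if "s \<in> S" for s
    using assms that ij by auto
  then show "mat_sum n (\<lambda>s. F s - G s) S $$ (i, j) = (mat_sum n F S - mat_sum n G S) $$ (i, j)"
    using ij by (simp add: sum_subtractf)
qed auto

lemma mat_adjoint_mat_sum:
  assumes "\<forall>s\<in>S. F s \<in> carrier_mat n n"
  shows "mat_adjoint (mat_sum n F S) = mat_sum n (\<lambda>s. mat_adjoint (F s)) S"
proof (rule eq_matI)
  fix i j assume "i < dim_row (mat_sum n (\<lambda>s. mat_adjoint (F s)) S)" "j < dim_col (mat_sum n (\<lambda>s. mat_adjoint (F s)) S)"
  then have ij: "i < n" "j < n" by auto
  have "mat_adjoint (F s) $$ (i, j) = cnj (F s $$ (j, i))" if "s \<in> S" for s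
    using assms[rule_format, OF that] ij by (intro mat_adjoint_index) auto
  then show "mat_adjoint (mat_sum n F S) $$ (i, j) = mat_sum n (\<lambda>s. mat_adjoint (F s)) S $$ (i, j)"
    using ij by simp
qed auto

lemma mat_trace_mat_sum:
  assumes "\<forall>s\<in>S. F s \<in> carrier_mat n n"
  shows "mat_trace (mat_sum n F S) = (\<Sum>s\<in>S. mat_trace (F s))"
proof -
  have "mat_trace (F s) = (\<Sum>i<n. F s $$ (i, i))" if "s \<in> S" for s
    using assms[rule_format, OF that] by (simp add: mat_trace_def)
  then have "(\<Sum>s\<in>S. mat_trace (F s)) = (\<Sum>s\<in>S. \<Sum>i<n. F s $$ (i, i))"
    by (rule sum.cong[OF refl])
  then show ?thesis by (subst (asm) sum.swap) (simp add: mat_trace_def)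
qed

lemma mat_sum_swap:
  "mat_sum n (\<lambda>s. mat_sum n (\<lambda>t. F s t) T) S = mat_sum n (\<lambda>t. mat_sum n (\<lambda>s. F s t) S) T"
  by (rule eq_matI) (auto intro: sum.swap)

lemma smult_smult_mat: "c \<cdot>\<^sub>m (d \<cdot>\<^sub>m A) = (c * d) \<cdot>\<^sub>m A" for A :: "complex mat"
  by (rule eq_matI) auto

lemma smult_one_mat [simp]: "1 \<cdot>\<^sub>m A = A" for A :: "complex mat"
  by (rule eq_matI) auto

lemma smult_mat_cancel:
  fixes A :: "complex mat"
  assumes A: "A \<in> carrier_mat n m" "A \<noteq> 0\<^sub>m n m" and eq: "c \<cdot>\<^sub>m A = d \<cdot>\<^sub>m A"
  shows "c = d"
proof (rule ccontr)
  assume "c \<noteq> d"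
  have "A $$ (i, j) = 0" if "i < n" "j < m" for i j
    using arg_cong[OF eq, of "\<lambda>M. M $$ (i, j)"] that A \<open>c \<noteq> d\<close> by auto
  then have "A = 0\<^sub>m n m" using A by (intro eq_matI) auto
  then show False using A by simp
qed

section \<open>Traces of powers\<close>

lemma upper_triangular_pow:
  fixes T :: "complex mat"
  assumes T: "T \<in> carrier_mat n n" "upper_triangular T"
  shows "upper_triangular (T ^\<^sub>m k) \<and> (\<forall>i<n. (T ^\<^sub>m k) $$ (i, i) = (T $$ (i, i)) ^ k)"
proof (induction k)
  case 0
  show ?case using T by auto
next
  case (Suc k)
  have ck: "T ^\<^sub>m k \<in> carrier_mat n n" using T by simp
  have e: "(T ^\<^sub>m Suc k) $$ (i, j) = (\<Sum>l<n. (T ^\<^sub>m k) $$ (i, l) * T $$ (l, j))" if "i < n" "j < n" for i j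
    using mult_mat_index_sum[OF ck T(1) that] by simp
  have z: "(T ^\<^sub>m k) $$ (i, l) * T $$ (l, j) = 0" if "i < n" "l < n" "j < n" "l < i \<or> j < l" for i l j
    using Suc T that ck unfolding upper_triangular_def by (metis carrier_matD(1) mult_eq_0_iff)
  have "(T ^\<^sub>m Suc k) $$ (i, j) = 0" if "i < n" "j < i" for i j
    using that by (subst e) (auto intro!: sum.neutral z)
  moreover have "(T ^\<^sub>m Suc k) $$ (i, i) = (T $$ (i, i)) ^ Suc k" if "i < n" for i
  proof -
    have "(T ^\<^sub>m Suc k) $$ (i, i) = (\<Sum>l<n. if l = i then (T ^\<^sub>m k) $$ (i, i) * T $$ (i, i) else 0)"
      unfolding e[OF that that]
    proof (rule sum.cong[OF refl])
      fix l assume "l \<in> {..<n}"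
      then show "(T ^\<^sub>m k) $$ (i, l) * T $$ (l, i) = (if l = i then (T ^\<^sub>m k) $$ (i, i) * T $$ (i, i) else 0)"
        using z[of i l i] that by (cases "l = i"; cases "l < i") auto
    qed
    then show ?thesis using Suc that by simp
  qed
  ultimately show ?case using T unfolding upper_triangular_def by (metis carrier_matD(1) pow_carrier_mat)
qed

text \<open>The \<open>es\<close> are the roots of the characteristic polynomial with multiplicity.
  Schur triangularisation suffices, which matters because mixed channels need not be diagonalisable.
  Limits of traces of powers thereby give information on the spectral radius.\<close>

lemma mat_trace_pow:
  fixes M :: "complex mat"
  assumes M: "M \<in> carrier_mat n n"
  obtains es where "\<And>k. mat_trace (M ^\<^sub>m k) = (\<Sum>i<n. es i ^ k)" "\<And>e. eigenvalue M e \<longleftrightarrow> e \<in> es ` {..<n}"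
proof -
  obtain as where as: "char_poly M = (\<Prod>a\<leftarrow>as. [:- a, 1:])" "length as = n"
    using char_poly_factorized[OF M] by auto
  obtain T P Q where TPQ: "schur_decomposition M as = (T, P, Q)" by (metis prod_cases3)
  have s: "similar_mat_wit M T P Q" "upper_triangular T" "diag_mat T = as"
    using schur_decomposition[OF M as(1) TPQ] by auto
  note d = similar_mat_witD2[OF M s(1)]
  have "mat_trace (M ^\<^sub>m k) = (\<Sum>i<n. (as ! i) ^ k)" for k
  proof -
    have Tk: "T ^\<^sub>m k \<in> carrier_mat n n" using d by simp
    have "mat_trace (M ^\<^sub>m k) = mat_trace (P * T ^\<^sub>m k * Q)"
      using similar_mat_wit_pow_id[OF s(1)] by simp
    also have "\<dots> = mat_trace (Q * (P * T ^\<^sub>m k))"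
      using d Tk by (intro mat_trace_mult_commute) auto
    also have "Q * (P * T ^\<^sub>m k) = T ^\<^sub>m k"
      using d Tk by (simp add: assoc_mult_mat[of Q n n P n "T ^\<^sub>m k" n, symmetric])
    also have "mat_trace \<dots> = (\<Sum>i<n. (T $$ (i, i)) ^ k)"
      using upper_triangular_pow[OF d(5) s(2), of k] Tk by (auto simp: mat_trace_def)
    also have "\<dots> = (\<Sum>i<n. (as ! i) ^ k)"
      using s(3) d(5) by (auto simp: diag_mat_def intro!: sum.cong)
    finally show ?thesis .
  qed
  moreover have "eigenvalue M e \<longleftrightarrow> e \<in> (!) as ` {..<n}" for e
  proof -
    have "eigenvalue M e \<longleftrightarrow> e \<in> set as"
      unfolding eigenvalue_root_char_poly[OF M] as(1) by (induction as) auto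
    also have "set as = (!) as ` {..<n}" using as(2) by (auto simp: set_conv_nth)
    finally show ?thesis .
  qed
  ultimately show ?thesis by (rule that)
qed

section \<open>Roots of unity\<close>

lemma root_unity_pow_add: "root_unity_pow N (k + l) = root_unity_pow N k * root_unity_pow N l"
  by (simp add: root_unity_pow_def cis_mult add_divide_distrib algebra_simps)

lemma root_unity_pow_power: "root_unity_pow N k ^ m = root_unity_pow N (k * int m)"
  by (simp add: root_unity_pow_def DeMoivre algebra_simps)

lemma root_unity_pow_powi: "root_unity_pow N k powi m = root_unity_pow N (k * m)"
proof (cases "0 \<le> m")
  case True
  then show ?thesis using root_unity_pow_power[of N k "nat m"] by (simp add: power_int_def)
next
  case False
  have "inverse (root_unity_pow N k) = root_unity_pow N (- k)"
    by (simp add: root_unity_pow_def)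
  then show ?thesis using False root_unity_pow_power[of N "- k" "nat (- m)"]
    by (simp add: power_int_def)
qed

lemma norm_root_unity_pow [simp]: "cmod (root_unity_pow N k) = 1"
  by (simp add: root_unity_pow_def)

lemma root_unity_pow_eq_1_iff:
  assumes "N > 0"
  shows "root_unity_pow N k = 1 \<longleftrightarrow> int N dvd k"
proof
  assume "root_unity_pow N k = 1"
  then have "cos (2 * pi * real_of_int k / real N) = 1"
    by (metis root_unity_pow_def cis.sel(1) one_complex.sel(1))
  then obtain m :: int where m: "2 * pi * real_of_int k / real N = real_of_int m * 2 * pi"
    by (auto simp: cos_one_2pi_int)
  then have "real_of_int k = real_of_int (m * int N)"
    using assms by (simp add: field_simps)
  then have "k = m * int N" by linarith
  then show "int N dvd k" by simp
next
  assume "int N dvd k"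
  then obtain m where "k = int N * m" by blast
  then have "root_unity_pow N k = cis (2 * pi * real_of_int m)"
    using assms by (simp add: root_unity_pow_def mult.assoc)
  then show "root_unity_pow N k = 1" by (metis Ints_of_int cis_multiple_2pi)
qed

lemma root_unity_pow_eq_iff:
  assumes "N > 0"
  shows "root_unity_pow N k = root_unity_pow N l \<longleftrightarrow> [k = l] (mod int N)"
proof -
  have "root_unity_pow N k = root_unity_pow N (k - l) * root_unity_pow N l"
    by (simp add: root_unity_pow_add[symmetric])
  moreover have "root_unity_pow N l \<noteq> 0" by (simp add: root_unity_pow_def)
  ultimately have "root_unity_pow N k = root_unity_pow N l \<longleftrightarrow> root_unity_pow N (k - l) = 1" by simp
  then show ?thesis by (simp add: root_unity_pow_eq_1_iff[OF assms] cong_iff_dvd_diff)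
qed

lemma root_of_unity_is_root_unity_pow:
  assumes N: "N > 0" and z: "z ^ N = 1"
  obtains k where "k \<in> {0..<int N}" "z = root_unity_pow N k"
proof -
  have "z \<in> (\<lambda>k. cis (2 * pi * real k / real N)) ` {..<N}"
    using bij_betw_roots_unity[OF N] z by (auto simp: bij_betw_def)
  then obtain k where k: "k < N" "z = cis (2 * pi * real k / real N)" by auto
  show ?thesis by (rule that[of "int k"]) (use k in \<open>auto simp: root_unity_pow_def\<close>)
qed

section \<open>Unitary matrices\<close>

text \<open>Serves to import the laws of integer powers from group theory: \<open>mat_powi\<close>
  splits on the sign of the exponent and uses \<open>mat_inv\<close>, and
  \<open>mat_powi_unitary\<close> identifies it with the group power once and for all.\<close>

definition unitary_group :: "nat \<Rightarrow> complex mat monoid" where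
  "unitary_group n = \<lparr>carrier = {U. unitary_mat n U}, mult = (*), one = 1\<^sub>m n\<rparr>"

lemma unitary_matD:
  assumes "unitary_mat n U"
  shows "U \<in> carrier_mat n n" "mat_adjoint U \<in> carrier_mat n n"
    "U * mat_adjoint U = 1\<^sub>m n" "mat_adjoint U * U = 1\<^sub>m n"
  using assms by (auto simp: unitary_mat_def)

lemma unitary_mat_adjoint: "unitary_mat n U \<Longrightarrow> unitary_mat n (mat_adjoint U)"
  by (auto simp: unitary_mat_def)

lemma unitary_mat_one: "unitary_mat n (1\<^sub>m n)"
  by (auto simp: unitary_mat_def)

lemma mult_adjoint_cancel:
  fixes U A :: "complex mat"
  assumes "unitary_mat n U" "A \<in> carrier_mat n n"
  shows "U * (mat_adjoint U * A) = A" "mat_adjoint U * (U * A) = A"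
    "A * U * mat_adjoint U = A" "A * mat_adjoint U * U = A"
  using unitary_matD[OF assms(1)] assms(2)
    assoc_mult_mat[of U n n "mat_adjoint U" n A n] assoc_mult_mat[of "mat_adjoint U" n n U n A n]
    assoc_mult_mat[of A n n U n "mat_adjoint U" n] assoc_mult_mat[of A n n "mat_adjoint U" n U n]
  by auto

lemma unitary_mat_mult:
  assumes U: "unitary_mat n U" and V: "unitary_mat n V"
  shows "unitary_mat n (U * V)"
proof -
  note u = unitary_matD[OF U] and v = unitary_matD[OF V]
  have uv: "U * V \<in> carrier_mat n n" using u v by simp
  have a: "mat_adjoint (U * V) = mat_adjoint V * mat_adjoint U"
    by (rule mat_adjoint_mult[OF u(1) v(1)])
  have "U * V * (mat_adjoint V * mat_adjoint U) = U * (V * (mat_adjoint V * mat_adjoint U))"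
    by (rule assoc_mult_mat) (use u v in auto)
  also have "\<dots> = 1\<^sub>m n" using u v by (simp add: mult_adjoint_cancel[OF V])
  finally have 1: "U * V * (mat_adjoint V * mat_adjoint U) = 1\<^sub>m n" .
  have "mat_adjoint V * mat_adjoint U * (U * V) = mat_adjoint V * (mat_adjoint U * (U * V))"
    by (rule assoc_mult_mat) (use u v in auto)
  also have "\<dots> = 1\<^sub>m n" using u v by (simp add: mult_adjoint_cancel[OF U])
  finally show ?thesis using 1 uv a by (simp add: unitary_mat_def)
qed

lemma unitary_mat_smult:
  assumes U: "unitary_mat n U" and c: "cmod c = 1"
  shows "unitary_mat n (c \<cdot>\<^sub>m U)"
proof -
  note u = unitary_matD[OF U]
  have "c * cnj c = 1" using c by (simp add: complex_norm_square[symmetric])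
  then show ?thesis
    using u mult_smult_assoc_mat[of U n n "cnj c \<cdot>\<^sub>m mat_adjoint U" n c]
      mult_smult_assoc_mat[of "mat_adjoint U" n n "c \<cdot>\<^sub>m U" n "cnj c"]
      mult_smult_distrib[of U n n "mat_adjoint U" n "cnj c"]
      mult_smult_distrib[of "mat_adjoint U" n n U n c]
    by (simp add: unitary_mat_def smult_smult_mat mult.commute)
qed

lemma unitary_group_simps [simp]:
  "carrier (unitary_group n) = {U. unitary_mat n U}"
  "mult (unitary_group n) = (*)"
  "one (unitary_group n) = 1\<^sub>m n"
  by (simp_all add: unitary_group_def)

lemma group_unitary_group: "group (unitary_group n)"
proof (rule groupI)
  fix U assume "U \<in> carrier (unitary_group n)"
  then show "\<exists>V\<in>carrier (unitary_group n). V \<otimes>\<^bsub>unitary_group n\<^esub> U = \<one>\<^bsub>unitary_group n\<^esub>"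
    by (auto intro!: exI[of _ "mat_adjoint U"] simp: unitary_mat_adjoint unitary_matD)
next
  fix U V W assume "U \<in> carrier (unitary_group n)" "V \<in> carrier (unitary_group n)" "W \<in> carrier (unitary_group n)"
  then show "U \<otimes>\<^bsub>unitary_group n\<^esub> V \<otimes>\<^bsub>unitary_group n\<^esub> W = U \<otimes>\<^bsub>unitary_group n\<^esub> (V \<otimes>\<^bsub>unitary_group n\<^esub> W)"
    using assoc_mult_mat[of U n n V n W n] by (simp add: unitary_mat_def)
qed (auto simp: unitary_mat_mult unitary_mat_one dest: unitary_matD(1))

lemma unitary_group_inv:
  assumes "unitary_mat n U"
  shows "inv\<^bsub>unitary_group n\<^esub> U = mat_adjoint U"
  using group.inv_equality[OF group_unitary_group, of n "mat_adjoint U" U] assms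
  by (simp add: unitary_mat_adjoint unitary_matD)

lemma mat_inv_unitary:
  assumes "unitary_mat n U"
  shows "mat_inv U = mat_adjoint U"
proof -
  note u = unitary_matD[OF assms]
  have "mat_inverse U \<noteq> None"
  proof
    assume "mat_inverse U = None"
    then have "U \<notin> Units (ring_mat TYPE(complex) n ())" by (rule mat_inverse(1)[OF u(1)])
    then show False using u unfolding Units_def by (auto simp: ring_mat_def)
  qed
  then obtain B where B: "mat_inverse U = Some B" by auto
  note b = mat_inverse(2)[OF u(1) B]
  have "B = mat_adjoint U * (U * B)"
    using b by (intro mult_adjoint_cancel(2)[OF assms, symmetric]) auto
  then show ?thesis using b u B by (simp add: mat_inv_def)
qed

lemma mat_powi_unitary:
  assumes "unitary_mat n U"
  shows "mat_powi U k = U [^]\<^bsub>unitary_group n\<^esub> k"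
proof -
  interpret group "unitary_group n" by (rule group_unitary_group)
  have nat: "V ^\<^sub>m m = V [^]\<^bsub>unitary_group n\<^esub> m" if "unitary_mat n V" for V m
    using that by (induction m) (auto simp: unitary_mat_def)
  have "U [^]\<^bsub>unitary_group n\<^esub> k = mat_adjoint U [^]\<^bsub>unitary_group n\<^esub> nat (- k)" if "k < 0"
    using that assms nat_pow_inv[of U "nat (- k)"] unitary_group_inv[OF assms] by (simp add: int_pow_def2 del: pow_nat)
  moreover have "U [^]\<^bsub>unitary_group n\<^esub> k = U [^]\<^bsub>unitary_group n\<^esub> nat k" if "0 \<le> k"
    using that by (simp add: int_pow_def2 del: pow_nat)
  ultimately show ?thesis
    unfolding mat_powi_def
    using nat[OF assms] nat[OF unitary_mat_adjoint[OF assms]] mat_inv_unitary[OF assms] by auto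
qed

lemma unitary_mat_powi: "unitary_mat n U \<Longrightarrow> unitary_mat n (mat_powi U k)"
  using group.int_pow_closed[OF group_unitary_group, of U n k] by (simp add: mat_powi_unitary)

lemma mat_powi_0 [simp]: "unitary_mat n U \<Longrightarrow> mat_powi U 0 = 1\<^sub>m n"
  by (simp add: mat_powi_unitary)

lemma mat_powi_1 [simp]: "unitary_mat n U \<Longrightarrow> mat_powi U 1 = U"
  using group.int_pow_1[OF group_unitary_group, of U n] by (simp add: mat_powi_unitary)

lemma mat_powi_add: "unitary_mat n U \<Longrightarrow> mat_powi U (k + l) = mat_powi U k * mat_powi U l"
  using group.int_pow_mult[OF group_unitary_group, of U n k l] by (simp add: mat_powi_unitary)

lemma mat_powi_mult: "unitary_mat n U \<Longrightarrow> mat_powi U (k * l) = mat_powi (mat_powi U k) l"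
  using group.int_pow_pow[OF group_unitary_group, of U n k l] unitary_mat_powi[of n U k]
  by (simp add: mat_powi_unitary)

lemma mat_powi_minus: "unitary_mat n U \<Longrightarrow> mat_powi U (- k) = mat_adjoint (mat_powi U k)"
  using group.int_pow_neg[OF group_unitary_group, of U n k] unitary_mat_powi[of n U k]
  by (simp add: mat_powi_unitary unitary_group_inv)

lemma mat_powi_adjoint: "unitary_mat n U \<Longrightarrow> mat_powi (mat_adjoint U) k = mat_adjoint (mat_powi U k)"
  using mat_powi_mult[of n U "- 1" k] mat_powi_minus[of n U 1] mat_powi_minus[of n U k] by simp

lemma smult_mult_smult:
  fixes A B :: "complex mat"
  assumes "A \<in> carrier_mat n m" "B \<in> carrier_mat m l"
  shows "(c \<cdot>\<^sub>m A) * (d \<cdot>\<^sub>m B) = (c * d) \<cdot>\<^sub>m (A * B)"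
  using assms mult_smult_assoc_mat[of A n m "d \<cdot>\<^sub>m B" l c] mult_smult_distrib[of A n m B l d]
  by (simp add: smult_smult_mat)

lemma mat_powi_smult:
  assumes U: "unitary_mat n U" and c: "cmod c = 1"
  shows "mat_powi (c \<cdot>\<^sub>m U) k = (c powi k) \<cdot>\<^sub>m mat_powi U k"
proof -
  have c0: "c \<noteq> 0" using c by auto
  have ci: "cnj c = inverse c"
    using c by (intro inverse_unique[symmetric]) (simp add: complex_norm_square[symmetric])
  have cU: "unitary_mat n (c \<cdot>\<^sub>m U)" by (rule unitary_mat_smult[OF U c])
  have un: "mat_powi U k \<in> carrier_mat n n" for k
    using unitary_mat_powi[OF U] by (simp add: unitary_mat_def)
  note u = unitary_matD[OF U]
  show ?thesis
  proof (induction k rule: int_induct[of _ 0])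
    case base
    show ?case using U cU by simp
  next
    case (step1 i)
    have "mat_powi (c \<cdot>\<^sub>m U) (i + 1) = ((c powi i) \<cdot>\<^sub>m mat_powi U i) * (c \<cdot>\<^sub>m U)"
      using mat_powi_add[OF cU, of i 1] step1 cU by simp
    also have "\<dots> = (c powi (i + 1)) \<cdot>\<^sub>m (mat_powi U i * U)"
      using c0 by (subst smult_mult_smult[OF un u(1)]) (simp add: power_int_add)
    finally show ?case using mat_powi_add[OF U, of i 1] U by simp
  next
    case (step2 i)
    have "mat_powi (c \<cdot>\<^sub>m U) (i - 1) = ((c powi i) \<cdot>\<^sub>m mat_powi U i) * (inverse c \<cdot>\<^sub>m mat_adjoint U)"
      using mat_powi_add[OF cU, of i "- 1"] step2 cU mat_powi_minus[OF cU, of 1] ci by simp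
    also have "\<dots> = (c powi (i - 1)) \<cdot>\<^sub>m (mat_powi U i * mat_adjoint U)"
      using c0 by (subst smult_mult_smult[OF un u(2)]) (simp add: power_int_diff divide_inverse)
    finally show ?case using mat_powi_add[OF U, of i "- 1"] mat_powi_minus[OF U, of 1] U by simp
  qed
qed

section \<open>The on-site action\<close>

lemma phys_act_carrier [simp]: "phys_act N n U A s \<in> carrier_mat n n"
  by (simp add: phys_act_def)

lemma phys_act_cong:
  "(\<And>t. t < N \<Longrightarrow> A t = B t) \<Longrightarrow> phys_act N n U A s = phys_act N n U B s"
  by (simp add: phys_act_def)

lemma phys_act_index:
  assumes "\<And>t. t < N \<Longrightarrow> A t \<in> carrier_mat n n" "i < n" "j < n"
  shows "phys_act N n U A s $$ (i, j) = (\<Sum>t<N. U $$ (s, t) * A t $$ (i, j))"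
proof -
  have "(U $$ (s, t) \<cdot>\<^sub>m A t) $$ (i, j) = U $$ (s, t) * A t $$ (i, j)" if "t < N" for t
    using assms(1)[OF that] assms(2,3) by auto
  then show ?thesis using assms by (simp add: phys_act_def)
qed

lemma phys_act_mult:
  assumes A: "\<And>t. t < N \<Longrightarrow> A t \<in> carrier_mat n n"
    and U: "U \<in> carrier_mat N N" and V: "V \<in> carrier_mat N N" and s: "s < N"
  shows "phys_act N n (U * V) A s = phys_act N n U (phys_act N n V A) s"
proof (rule eq_matI)
  fix i j assume "i < dim_row (phys_act N n U (phys_act N n V A) s)"
    "j < dim_col (phys_act N n U (phys_act N n V A) s)"
  then have ij: "i < n" "j < n" by (auto simp: phys_act_def)
  have "phys_act N n (U * V) A s $$ (i, j) = (\<Sum>t<N. \<Sum>r<N. U $$ (s, r) * V $$ (r, t) * A t $$ (i, j))"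
    by (subst phys_act_index[OF A ij]) (auto intro!: sum.cong
        simp: mult_mat_index_sum[OF U V s] sum_distrib_right simp del: index_mult_mat(1))
  also have "\<dots> = (\<Sum>r<N. U $$ (s, r) * phys_act N n V A r $$ (i, j))"
    by (subst sum.swap) (simp add: phys_act_index[OF A ij] sum_distrib_left mult.assoc)
  also have "\<dots> = phys_act N n U (phys_act N n V A) s $$ (i, j)"
    by (simp add: phys_act_index[OF _ ij])
  finally show "phys_act N n (U * V) A s $$ (i, j) = phys_act N n U (phys_act N n V A) s $$ (i, j)" .
qed (auto simp: phys_act_def)

lemma phys_act_smult_tensor:
  assumes A: "\<And>t. t < N \<Longrightarrow> A t \<in> carrier_mat n n"
  shows "phys_act N n U (\<lambda>t. c \<cdot>\<^sub>m A t) s = c \<cdot>\<^sub>m phys_act N n U A s"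
  unfolding phys_act_def using A
  by (subst smult_mat_sum) (auto simp: smult_smult_mat mult.commute)

lemma phys_act_smult_op:
  assumes A: "\<And>t. t < N \<Longrightarrow> A t \<in> carrier_mat n n" and U: "U \<in> carrier_mat N N" and s: "s < N"
  shows "phys_act N n (c \<cdot>\<^sub>m U) A s = c \<cdot>\<^sub>m phys_act N n U A s"
  unfolding phys_act_def using A U s
  by (subst smult_mat_sum) (auto simp: smult_smult_mat)

lemma phys_act_sandwich:
  assumes A: "\<And>t. t < N \<Longrightarrow> A t \<in> carrier_mat n n"
    and C: "C \<in> carrier_mat n n" and D: "D \<in> carrier_mat n n"
  shows "phys_act N n U (\<lambda>t. C * A t * D) s = C * phys_act N n U A s * D"
proof -
  have "C * (U $$ (s, t) \<cdot>\<^sub>m A t) * D = U $$ (s, t) \<cdot>\<^sub>m (C * A t * D)" if "t < N" for t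
    using A[OF that] C D mult_smult_distrib[of C n n "A t" n "U $$ (s, t)"]
      mult_smult_assoc_mat[of "C * A t" n n D n "U $$ (s, t)"] by simp
  then show ?thesis
    unfolding phys_act_def using A C D by (simp add: mult_mat_sum mat_sum_mult)
qed

lemma phys_act_one:
  assumes A: "\<And>t. t < N \<Longrightarrow> A t \<in> carrier_mat n n" and s: "s < N"
  shows "phys_act N n (1\<^sub>m N) A s = A s"
proof (rule eq_matI)
  fix i j assume "i < dim_row (A s)" "j < dim_col (A s)"
  then have ij: "i < n" "j < n" using A[OF s] by auto
  have "phys_act N n (1\<^sub>m N) A s $$ (i, j) = (\<Sum>t<N. 1\<^sub>m N $$ (s, t) * A t $$ (i, j))"
    by (rule phys_act_index[OF A ij])
  also have "\<dots> = (\<Sum>t<N. if t = s then A s $$ (i, j) else 0)"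
    by (rule sum.cong) (use s in auto)
  finally have "phys_act N n (1\<^sub>m N) A s $$ (i, j) = (\<Sum>t<N. if t = s then A s $$ (i, j) else 0)" .
  then show "phys_act N n (1\<^sub>m N) A s $$ (i, j) = A s $$ (i, j)" using s by simp
qed (use A[OF s] in \<open>auto simp: phys_act_def\<close>)

section \<open>Transfer channels\<close>

definition mixed_channel ::
    "nat \<Rightarrow> nat \<Rightarrow> (nat \<Rightarrow> complex mat) \<Rightarrow> (nat \<Rightarrow> complex mat) \<Rightarrow> complex mat \<Rightarrow> complex mat" where
  "mixed_channel N n A B Y = mat_sum n (\<lambda>s. mat_adjoint (A s) * Y * B s) {..<N}"

lemma transfer_channel_eq_mixed: "transfer_channel N n A = mixed_channel N n A A"
  by (simp add: fun_eq_iff transfer_channel_def mixed_channel_def)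

lemma mixed_channel_carrier [simp]: "mixed_channel N n A B Y \<in> carrier_mat n n"
  by (simp add: mixed_channel_def)

lemma mixed_channel_mat_sum:
  assumes A: "\<And>s. s < N \<Longrightarrow> A s \<in> carrier_mat n n" and B: "\<And>s. s < N \<Longrightarrow> B s \<in> carrier_mat n n"
    and F: "\<forall>t\<in>T. F t \<in> carrier_mat n n"
  shows "mixed_channel N n A B (mat_sum n F T) = mat_sum n (\<lambda>t. mixed_channel N n A B (F t)) T"
proof -
  have "mat_adjoint (A s) * mat_sum n F T * B s = mat_sum n (\<lambda>t. mat_adjoint (A s) * F t * B s) T"
    if "s < N" for s
    using A[OF that] B[OF that] F by (simp add: mult_mat_sum mat_sum_mult)
  then show ?thesis by (simp add: mixed_channel_def mat_sum_swap[of n _ T])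
qed

lemma mixed_channel_smult:
  assumes A: "\<And>s. s < N \<Longrightarrow> A s \<in> carrier_mat n n" and B: "\<And>s. s < N \<Longrightarrow> B s \<in> carrier_mat n n"
    and Y: "Y \<in> carrier_mat n n"
  shows "mixed_channel N n A B (c \<cdot>\<^sub>m Y) = c \<cdot>\<^sub>m mixed_channel N n A B Y"
proof -
  have "mat_adjoint (A s) * (c \<cdot>\<^sub>m Y) * B s = c \<cdot>\<^sub>m (mat_adjoint (A s) * Y * B s)" if "s < N" for s
    using A[OF that] B[OF that] Y mult_smult_distrib[of "mat_adjoint (A s)" n n Y n c]
      mult_smult_assoc_mat[of "mat_adjoint (A s) * Y" n n "B s" n c] by simp
  moreover have "mat_adjoint (A s) * Y * B s \<in> carrier_mat n n" if "s < N" for s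
    using A[OF that] B[OF that] Y by auto
  ultimately show ?thesis unfolding mixed_channel_def by (subst smult_mat_sum) auto
qed

text \<open>Kraus families related by a unitary on the physical index define the same channel, by
  orthonormality of the columns of \<open>U\<close>. So the transformed tensor shares the fixed
  points of \<open>E\<close> and of its dual.\<close>

lemma transfer_channel_phys_act:
  assumes A: "\<And>s. s < N \<Longrightarrow> A s \<in> carrier_mat n n" and U: "unitary_mat N U"
    and Y: "Y \<in> carrier_mat n n"
  shows "transfer_channel N n (phys_act N n U A) Y = transfer_channel N n A Y"
proof -
  note u = unitary_matD[OF U]
  define W where "W t r = mat_adjoint (A t) * Y * A r" for t r
  have W: "W t r \<in> carrier_mat n n" if "t < N" "r < N" for t r
    using A that Y unfolding W_def by (meson mat_adjoint_carrier mult_carrier_mat)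
  have ex: "mat_adjoint (phys_act N n U A s) * Y * phys_act N n U A s =
      mat_sum n (\<lambda>r. mat_sum n (\<lambda>t. (cnj (U $$ (s, t)) * U $$ (s, r)) \<cdot>\<^sub>m W t r) {..<N}) {..<N}"
    if "s < N" for s
  proof -
    have 1: "mat_adjoint (phys_act N n U A s) * Y =
        mat_sum n (\<lambda>t. cnj (U $$ (s, t)) \<cdot>\<^sub>m (mat_adjoint (A t) * Y)) {..<N}"
      unfolding phys_act_def using A Y
      by (simp add: mat_adjoint_mat_sum mat_sum_mult mult_smult_assoc_mat[of _ n n _ n])
    have 2: "mat_sum n (\<lambda>t. cnj (U $$ (s, t)) \<cdot>\<^sub>m (mat_adjoint (A t) * Y)) {..<N} * (U $$ (s, r) \<cdot>\<^sub>m A r)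
        = mat_sum n (\<lambda>t. (cnj (U $$ (s, t)) * U $$ (s, r)) \<cdot>\<^sub>m W t r) {..<N}" if r: "r < N" for r
    proof -
      have "(cnj (U $$ (s, t)) \<cdot>\<^sub>m (mat_adjoint (A t) * Y)) * (U $$ (s, r) \<cdot>\<^sub>m A r)
          = (cnj (U $$ (s, t)) * U $$ (s, r)) \<cdot>\<^sub>m W t r" if "t < N" for t
        unfolding W_def using A[OF that] A[OF r] Y
        by (intro smult_mult_smult[of _ n n _ n]) auto
      then show ?thesis using A r Y by (simp add: mat_sum_mult mult_carrier_mat[of _ n n _ n])
    qed
    show ?thesis
      unfolding 1 unfolding phys_act_def using A by (simp add: mult_mat_sum 2)
  qed
  have orth: "(\<Sum>s<N. cnj (U $$ (s, t)) * U $$ (s, r)) = (if t = r then 1 else 0)"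
    if "t < N" "r < N" for t r
  proof -
    have "(mat_adjoint U * U) $$ (t, r) = (\<Sum>s<N. mat_adjoint U $$ (t, s) * U $$ (s, r))"
      by (rule mult_mat_index_sum[OF u(2,1) that])
    also have "\<dots> = (\<Sum>s<N. cnj (U $$ (s, t)) * U $$ (s, r))"
      using u that by (intro sum.cong) auto
    finally show ?thesis using u(4) that by simp
  qed
  show ?thesis
  proof (rule eq_matI)
    fix i j assume "i < dim_row (transfer_channel N n A Y)" "j < dim_col (transfer_channel N n A Y)"
    then have ij: "i < n" "j < n" by (auto simp: transfer_channel_def)
    have sm: "(c \<cdot>\<^sub>m W t r) $$ (i, j) = c * W t r $$ (i, j)" if "t < N" "r < N" for c t r
      using W[OF that] ij by auto
    have "transfer_channel N n (phys_act N n U A) Y $$ (i, j) =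
        (\<Sum>s<N. \<Sum>r<N. \<Sum>t<N. cnj (U $$ (s, t)) * U $$ (s, r) * W t r $$ (i, j))"
      using ij by (simp add: transfer_channel_def ex sm cong: sum.cong_simp)
    also have "\<dots> = (\<Sum>r<N. \<Sum>s<N. \<Sum>t<N. cnj (U $$ (s, t)) * U $$ (s, r) * W t r $$ (i, j))"
      by (rule sum.swap)
    also have "\<dots> = (\<Sum>r<N. \<Sum>t<N. \<Sum>s<N. cnj (U $$ (s, t)) * U $$ (s, r) * W t r $$ (i, j))"
      by (rule sum.cong[OF refl], rule sum.swap)
    also have "\<dots> = (\<Sum>r<N. \<Sum>t<N. (\<Sum>s<N. cnj (U $$ (s, t)) * U $$ (s, r)) * W t r $$ (i, j))"
      by (simp add: sum_distrib_right)
    also have "\<dots> = (\<Sum>r<N. \<Sum>t<N. if t = r then W r r $$ (i, j) else 0)"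
      by (intro sum.cong) (auto simp: orth)
    also have "\<dots> = transfer_channel N n A Y $$ (i, j)"
      using ij by (simp add: transfer_channel_def W_def)
    finally show "transfer_channel N n (phys_act N n U A) Y $$ (i, j) = transfer_channel N n A Y $$ (i, j)" .
  qed (auto simp: transfer_channel_def)
qed

section \<open>Injective tensors\<close>

text \<open>In this locale \<open>n\<close> is the bond dimension, called \<open>\<chi>\<close> in
  the definitions; the integer \<open>n\<close> in the clock exponents first appears in
  \<open>symmetric_injective_mps_bond_unitaries\<close>.\<close>

locale injective_tensor =
  fixes N n :: nat and A :: "nat \<Rightarrow> complex mat"
  assumes injective: "left_canonical_injective N n A"
begin

abbreviation E :: "complex mat \<Rightarrow> complex mat" where "E \<equiv> transfer_channel N n A"

lemma tensor_carrier: "s < N \<Longrightarrow> A s \<in> carrier_mat n n"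
  using injective by (auto simp: left_canonical_injective_def mps_tensor_def)

lemma E_one: "E (1\<^sub>m n) = 1\<^sub>m n"
  using injective by (auto simp: left_canonical_injective_def)

lemma E_carrier [simp]: "E Y \<in> carrier_mat n n"
  by (simp add: transfer_channel_def)

lemma E_pow_carrier: "Y \<in> carrier_mat n n \<Longrightarrow> (E ^^ k) Y \<in> carrier_mat n n"
  by (cases k) auto

lemma E_smult: "Y \<in> carrier_mat n n \<Longrightarrow> E (c \<cdot>\<^sub>m Y) = c \<cdot>\<^sub>m E Y"
  using mixed_channel_smult[of N A n A] tensor_carrier by (simp add: transfer_channel_eq_mixed)

lemma E_mat_sum: "\<forall>t\<in>T. F t \<in> carrier_mat n n \<Longrightarrow> E (mat_sum n F T) = mat_sum n (\<lambda>t. E (F t)) T"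
  using mixed_channel_mat_sum[of N A n A] tensor_carrier by (simp add: transfer_channel_eq_mixed)

lemma bond_dim_pos: "n > 0"
proof (rule ccontr)
  assume "\<not> n > 0"
  moreover obtain \<rho> where "pos_def_mat n \<rho>" "mat_trace \<rho> = 1"
    using injective by (auto simp: left_canonical_injective_def)
  ultimately show False by (auto simp: pos_def_mat_def mat_trace_def)
qed

lemma one_mat_neq_zero: "(1\<^sub>m n :: complex mat) \<noteq> 0\<^sub>m n n"
  using bond_dim_pos by (metis index_one_mat(1) index_zero_mat(1) zero_neq_one)

lemma peripheral_eigenvalue:
  assumes "Y \<in> carrier_mat n n" "E Y = l \<cdot>\<^sub>m Y" "cmod l = 1" "l \<noteq> 1"
  shows "Y = 0\<^sub>m n n"
proof (rule ccontr)
  assume "Y \<noteq> 0\<^sub>m n n"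
  then have "map_eigenvalue n E l" using assms by (auto simp: map_eigenvalue_def)
  then have "cmod l < 1" using injective assms by (auto simp: left_canonical_injective_def)
  then show False using assms by simp
qed

text \<open>Left-canonicity puts \<open>1\<^sub>m n\<close> into the one-dimensional eigenspace, so
  the spanning matrix supplied by the definition is a nonzero multiple of the identity.\<close>

lemma fixed_point_scalar:
  assumes Y: "Y \<in> carrier_mat n n" and fix_Y: "E Y = Y"
  obtains c where "Y = c \<cdot>\<^sub>m 1\<^sub>m n"
proof -
  have gen: "W \<in> gen_eigenspace n E 1" if "W \<in> carrier_mat n n" "E W = W" for W
  proof -
    have "((\<lambda>W. E W - 1 \<cdot>\<^sub>m W) ^^ 1) W = 0\<^sub>m n n" using that by auto
    then show ?thesis using that(1) unfolding gen_eigenspace_def by blast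
  qed
  obtain Z where Z: "Z \<in> carrier_mat n n" "gen_eigenspace n E 1 = range (\<lambda>c. c \<cdot>\<^sub>m Z)"
    using injective by (auto simp: left_canonical_injective_def simple_map_eigenvalue_def)
  obtain c where c: "1\<^sub>m n = c \<cdot>\<^sub>m Z" using gen[OF _ E_one] Z(2) by auto
  obtain d where d: "Y = d \<cdot>\<^sub>m Z" using gen[OF Y fix_Y] Z(2) by auto
  have "c \<noteq> 0"
  proof
    assume "c = 0"
    then have "c \<cdot>\<^sub>m Z = 0\<^sub>m n n" using Z(1) by (intro eq_matI) auto
    then show False using c one_mat_neq_zero by simp
  qed
  then have "Y = (d / c) \<cdot>\<^sub>m 1\<^sub>m n" using c d by (simp add: smult_smult_mat)
  then show ?thesis by (rule that)
qed

text \<open>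
  The Fourier components of the orbit of \<open>Y\<close> under \<open>E\<close> are eigenvectors of \<open>E\<close> with
  eigenvalues on the unit circle, hence vanish unless the eigenvalue is \<open>1\<close>.
\<close>
lemma periodic_point_scalar:
  assumes Y: "Y \<in> carrier_mat n n" and L: "L > 0"
    and per: "(E ^^ L) Y = l \<cdot>\<^sub>m Y" and l: "cmod l = 1"
  obtains c where "Y = c \<cdot>\<^sub>m 1\<^sub>m n"
proof -
  \<comment> \<open>Some \<open>L\<close>-th root of \<open>l\<close>. Multiplied by the
    \<open>L\<close>-th roots of unity it yields all of them, which are the only eigenvalues
    \<open>E\<close> can have on the span of the orbit of \<open>Y\<close>.\<close>
  define \<mu> where "\<mu> = cis (Arg l / real L)"
  have muL: "\<mu> ^ L = l" using L l by (simp add: \<mu>_def DeMoivre) (metis cis_Arg complex_sgn_def l norm_zero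
        zero_neq_one sgn_div_norm inverse_1 scaleR_one)
  define m where "m r = \<mu> * root_unity_pow L (int r)" for r
  have m1: "cmod (m r) = 1" for r by (simp add: m_def \<mu>_def norm_mult)
  then have m0: "m r \<noteq> 0" for r by (metis norm_zero zero_neq_one)
  have mL: "m r ^ L = l" for r
    using L by (simp add: m_def power_mult_distrib muL root_unity_pow_power root_unity_pow_eq_1_iff)
  define T where "T j = (E ^^ j) Y" for j
  have T: "T j \<in> carrier_mat n n" for j by (simp add: T_def E_pow_carrier Y)
  define W where "W r = mat_sum n (\<lambda>j. (1 / m r) ^ j \<cdot>\<^sub>m T j) {..<L}" for r
  have W: "W r \<in> carrier_mat n n" for r by (simp add: W_def)
  have EW: "E (W r) = m r \<cdot>\<^sub>m W r" for r
  proof -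
    define f where "f j = (1 / m r) ^ j \<cdot>\<^sub>m T j" for j
    have f: "f j \<in> carrier_mat n n" for j using T by (simp add: f_def)
    have "E (f j) = m r \<cdot>\<^sub>m f (Suc j)" for j
      using m0[of r] T by (simp add: f_def E_smult smult_smult_mat T_def E_pow_carrier Y)
    then have 1: "E (W r) = m r \<cdot>\<^sub>m mat_sum n (\<lambda>j. f (Suc j)) {..<L}"
      unfolding W_def f_def[symmetric] using f by (subst E_mat_sum) (auto simp: smult_mat_sum)
    \<comment> \<open>The wrap-around term: \<open>E ^^ L\<close> contributes the factor
      \<open>l\<close>, and \<open>m r ^ L = l\<close> cancels it.\<close>
    have "f L = f 0"
      using per mL[of r] l m0 by (auto simp: f_def T_def smult_smult_mat power_one_over)
    then have "(\<Sum>j<L. f (Suc j) $$ p) = (\<Sum>j<L. f j $$ p)" for p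
      using sum.lessThan_Suc_shift[of "\<lambda>j. f j $$ p" L] sum.lessThan_Suc[of "\<lambda>j. f j $$ p" L] by simp
    then have "mat_sum n (\<lambda>j. f (Suc j)) {..<L} = mat_sum n f {..<L}" by (simp add: mat_sum_def)
    then show ?thesis using 1 by (simp add: W_def f_def)
  qed
  \<comment> \<open>Either \<open>m r = 1\<close>, or \<open>W r\<close> is zero. In both cases it
    is a fixed point, so the sum over \<open>r\<close> can be treated without knowing which
    component survives.\<close>
  have W_fix: "E (W r) = W r" for r
    unfolding EW using peripheral_eigenvalue[OF W EW m1, of r] by (cases "m r = 1") auto
  have "E (mat_sum n W {..<L}) = mat_sum n W {..<L}"
    using W W_fix by (subst E_mat_sum) auto
  moreover have "mat_sum n W {..<L} = of_nat L \<cdot>\<^sub>m Y"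
  proof (rule eq_matI)
    fix i k assume "i < dim_row (of_nat L \<cdot>\<^sub>m Y)" "k < dim_col (of_nat L \<cdot>\<^sub>m Y)"
    then have ik: "i < n" "k < n" using Y by auto
    have sm: "(c \<cdot>\<^sub>m T j) $$ (i, k) = c * T j $$ (i, k)" for c j
      using T[of j] ik by auto
    \<comment> \<open>Orthogonality of characters: for \<open>0 < j < L\<close> the sum is
      \<open>(1 / \<mu>) ^ j\<close> times a full geometric sum of a nontrivial \<open>L\<close>-th
      root of unity, so only the \<open>j = 0\<close> term \<open>T 0 = Y\<close> remains.\<close>
    have char: "(\<Sum>r<L. (1 / m r) ^ j) = (if j = 0 then of_nat L else 0)" if "j < L" for j
    proof (cases "j = 0")
      case False
      let ?x = "root_unity_pow L (- int j)"
      have "?x \<noteq> 1" using that False L by (simp add: root_unity_pow_eq_1_iff nat_dvd_not_less)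
      moreover have "?x ^ L = 1" using L by (simp add: root_unity_pow_power root_unity_pow_eq_1_iff)
      ultimately have 0: "(\<Sum>r<L. ?x ^ r) = 0" by (simp add: geometric_sum)
      have "(1 / m r) ^ j = (1 / \<mu>) ^ j * ?x ^ r" for r
      proof -
        have "1 / root_unity_pow L (int r) = root_unity_pow L (- int r)"
          by (simp add: root_unity_pow_def divide_inverse)
        then have "1 / m r = 1 / \<mu> * root_unity_pow L (- int r)"
          by (simp add: m_def divide_simps)
        then show ?thesis
          by (simp add: power_mult_distrib power_divide root_unity_pow_power mult.commute)
      qed
      then show ?thesis using 0 False by (simp add: sum_distrib_left[symmetric])
    qed simp
    have "mat_sum n W {..<L} $$ (i, k) = (\<Sum>r<L. \<Sum>j<L. (1 / m r) ^ j * T j $$ (i, k))"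
      using ik by (simp add: W_def sm)
    also have "\<dots> = (\<Sum>j<L. (\<Sum>r<L. (1 / m r) ^ j) * T j $$ (i, k))"
      by (subst sum.swap) (simp add: sum_distrib_right)
    also have "\<dots> = (\<Sum>j<L. if j = 0 then of_nat L * T 0 $$ (i, k) else 0)"
      by (intro sum.cong) (auto simp: char)
    also have "\<dots> = (of_nat L \<cdot>\<^sub>m Y) $$ (i, k)" using L ik Y by (simp add: T_def)
    finally show "mat_sum n W {..<L} $$ (i, k) = (of_nat L \<cdot>\<^sub>m Y) $$ (i, k)" .
  qed (use Y in auto)
  ultimately have "E (of_nat L \<cdot>\<^sub>m Y) = of_nat L \<cdot>\<^sub>m Y" by simp
  then obtain c where c: "of_nat L \<cdot>\<^sub>m Y = c \<cdot>\<^sub>m 1\<^sub>m n"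
    using fixed_point_scalar[of "of_nat L \<cdot>\<^sub>m Y"] Y by auto
  have "Y = (1 / of_nat L) \<cdot>\<^sub>m (of_nat L \<cdot>\<^sub>m Y)" using L by (simp add: smult_smult_mat)
  then have "Y = (1 / of_nat L * c) \<cdot>\<^sub>m 1\<^sub>m n" by (simp only: c smult_smult_mat)
  then show ?thesis by (rule that)
qed

text \<open>The phases picked up at the single steps multiply to one unimodular factor, so
  \<open>g 0\<close> is an eigenvector of \<open>E ^^ L\<close> of the kind
  \<open>periodic_point_scalar\<close> handles. This is the form in which uniqueness of bond
  matrices is used.\<close>

lemma periodic_chain_scalar:
  assumes g: "g 0 \<in> carrier_mat n n" and L: "L > 0"
    and step: "\<And>j. \<exists>c. cmod c = 1 \<and> E (g j) = c \<cdot>\<^sub>m g (Suc j)"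
    and per: "g L = l \<cdot>\<^sub>m g 0" and l: "cmod l = 1"
  obtains c where "g 0 = c \<cdot>\<^sub>m 1\<^sub>m n"
proof -
  have "g j \<in> carrier_mat n n" for j
  proof (cases j)
    case (Suc i)
    obtain c where "cmod c = 1" "E (g i) = c \<cdot>\<^sub>m g (Suc i)" using step by blast
    then have "g (Suc i) = (1 / c) \<cdot>\<^sub>m E (g i)" by (auto simp: smult_smult_mat)
    then show ?thesis using Suc by simp
  qed (use g in simp)
  then have "\<exists>c. cmod c = 1 \<and> (E ^^ j) (g 0) = c \<cdot>\<^sub>m g j" for j
  proof (induction j)
    case 0
    show ?case by (auto intro!: exI[of _ 1])
  next
    case (Suc j)
    obtain c where c: "cmod c = 1" "(E ^^ j) (g 0) = c \<cdot>\<^sub>m g j" using Suc by blast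
    obtain d where d: "cmod d = 1" "E (g j) = d \<cdot>\<^sub>m g (Suc j)" using step by blast
    have "(E ^^ Suc j) (g 0) = (c * d) \<cdot>\<^sub>m g (Suc j)" using c d Suc by (simp add: E_smult smult_smult_mat)
    then show ?case using c d by (auto simp: norm_mult intro!: exI[of _ "c * d"])
  qed
  then obtain c where c: "cmod c = 1" "(E ^^ L) (g 0) = c \<cdot>\<^sub>m g L" by blast
  show ?thesis
    by (rule periodic_point_scalar[OF g L _ _ that, of "c * l"])
      (use c l per in \<open>auto simp: smult_smult_mat norm_mult\<close>)
qed

text \<open>Exhibits the weighted trace as the form of \<open>R\<close> summed over the conjugated
  rows of \<open>Y\<close>, so positive definiteness of \<open>R\<close> makes it definite in
  \<open>Y\<close>.\<close>

lemma mat_trace_weighted_gram: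
  fixes R Y :: "complex mat"
  assumes R: "R \<in> carrier_mat n n" and Y: "Y \<in> carrier_mat n n"
  shows "mat_trace (R * (mat_adjoint Y * Y)) =
    (\<Sum>i<n. (R *\<^sub>v vec n (\<lambda>k. cnj (Y $$ (i, k)))) \<bullet>c vec n (\<lambda>k. cnj (Y $$ (i, k))))"
proof -
  have "mat_trace (R * (mat_adjoint Y * Y)) = mat_trace ((R * mat_adjoint Y) * Y)"
    using R Y by (simp add: assoc_mult_mat[of R n n _ n Y n])
  also have "\<dots> = mat_trace (Y * (R * mat_adjoint Y))"
    using R Y by (intro mat_trace_mult_commute) auto
  also have "\<dots> = (\<Sum>i<n. (Y * (R * mat_adjoint Y)) $$ (i, i))"
    using R Y by (simp add: mat_trace_def)
  also have "\<dots> = (\<Sum>i<n. (R *\<^sub>v vec n (\<lambda>k. cnj (Y $$ (i, k)))) \<bullet>c vec n (\<lambda>k. cnj (Y $$ (i, k))))"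
  proof (rule sum.cong[OF refl])
    fix i assume "i \<in> {..<n}"
    then have i: "i < n" by simp
    have "(Y * (R * mat_adjoint Y)) $$ (i, i) = (\<Sum>k<n. Y $$ (i, k) * (R * mat_adjoint Y) $$ (k, i))"
      using R Y i by (intro mult_mat_index_sum) auto
    also have "\<dots> = (\<Sum>k<n. Y $$ (i, k) * (\<Sum>j<n. R $$ (k, j) * cnj (Y $$ (i, j))))"
      using R Y i by (intro sum.cong) (auto simp: mult_mat_index_sum[of R n n "mat_adjoint Y" n] simp del: index_mult_mat(1))
    also have "\<dots> = (R *\<^sub>v vec n (\<lambda>k. cnj (Y $$ (i, k)))) \<bullet>c vec n (\<lambda>k. cnj (Y $$ (i, k)))"
      using R Y i by (simp add: scalar_prod_def atLeast0LessThan mult.commute)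
    finally show "(Y * (R * mat_adjoint Y)) $$ (i, i) =
        (R *\<^sub>v vec n (\<lambda>k. cnj (Y $$ (i, k)))) \<bullet>c vec n (\<lambda>k. cnj (Y $$ (i, k)))" .
  qed
  finally show ?thesis .
qed

text \<open>
  The norm weighted by the fixed point \<open>\<rho>\<close> of the dual channel; mixed channels contract it, and the
  defect measures the failure of \<open>Y\<close> to intertwine the two tensors.
\<close>
lemma weighted_norm_exists:
  obtains q :: "complex mat \<Rightarrow> real" where
    "\<And>Y. Y \<in> carrier_mat n n \<Longrightarrow> q Y \<ge> 0"
    "\<And>Y. Y \<in> carrier_mat n n \<Longrightarrow> q Y = 0 \<Longrightarrow> Y = 0\<^sub>m n n"
    "\<And>c Y. Y \<in> carrier_mat n n \<Longrightarrow> q (c \<cdot>\<^sub>m Y) = (cmod c)\<^sup>2 * q Y"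
    "\<And>U Y. unitary_mat N U \<Longrightarrow> Y \<in> carrier_mat n n \<Longrightarrow>
       (\<Sum>s<N. q (Y * phys_act N n U A s - A s * mixed_channel N n A (phys_act N n U A) Y)) =
       q Y - q (mixed_channel N n A (phys_act N n U A) Y)"
proof -
  obtain \<rho> where \<rho>: "pos_def_mat n \<rho>" "mat_sum n (\<lambda>s. A s * \<rho> * mat_adjoint (A s)) {..<N} = \<rho>"
    using injective by (auto simp: left_canonical_injective_def)
  have Rc: "\<rho> \<in> carrier_mat n n" using \<rho>(1) by (simp add: pos_def_mat_def)
  have pos: "Re ((\<rho> *\<^sub>v v) \<bullet>c v) > 0" if "v \<in> carrier_vec n" "v \<noteq> 0\<^sub>v n" for v
    using \<rho>(1) that by (auto simp: pos_def_mat_def)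
  have nonneg: "Re ((\<rho> *\<^sub>v v) \<bullet>c v) \<ge> 0" if "v \<in> carrier_vec n" for v
    using pos[OF that] Rc by (cases "v = 0\<^sub>v n") auto
  \<comment> \<open>This is the square of the weighted norm, whence the factor
    \<open>(cmod c)\<^sup>2\<close> under scaling.\<close>
  define q where "q Y = Re (mat_trace (\<rho> * (mat_adjoint Y * Y)))" for Y
  have q_sum: "q Y = (\<Sum>i<n. Re ((\<rho> *\<^sub>v vec n (\<lambda>k. cnj (Y $$ (i, k)))) \<bullet>c vec n (\<lambda>k. cnj (Y $$ (i, k)))))"
    if "Y \<in> carrier_mat n n" for Y
    by (simp only: q_def mat_trace_weighted_gram[OF Rc that] Re_sum)
  show ?thesis
  proof (rule that[of q])
    fix Y :: "complex mat" assume Y: "Y \<in> carrier_mat n n"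
    show "q Y \<ge> 0" unfolding q_sum[OF Y] by (intro sum_nonneg nonneg) auto
    assume "q Y = 0"
    then have z: "Re ((\<rho> *\<^sub>v vec n (\<lambda>k. cnj (Y $$ (i, k)))) \<bullet>c vec n (\<lambda>k. cnj (Y $$ (i, k)))) = 0" if "i < n" for i
      unfolding q_sum[OF Y] using that by (subst (asm) sum_nonneg_eq_0_iff) (auto intro: nonneg)
    have "Y $$ (i, k) = 0" if "i < n" "k < n" for i k
    proof -
      have "vec n (\<lambda>k. cnj (Y $$ (i, k))) = 0\<^sub>v n"
        using z[OF that(1)] pos[of "vec n (\<lambda>k. cnj (Y $$ (i, k)))"] by fastforce
      then have "vec n (\<lambda>k. cnj (Y $$ (i, k))) $ k = 0\<^sub>v n $ k" by simp
      then show ?thesis using that by simp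
    qed
    then show "Y = 0\<^sub>m n n" using Y by (intro eq_matI) auto
  next
    fix c and Y :: "complex mat" assume Y: "Y \<in> carrier_mat n n"
    have "mat_adjoint (c \<cdot>\<^sub>m Y) * (c \<cdot>\<^sub>m Y) = of_real ((cmod c)\<^sup>2) \<cdot>\<^sub>m (mat_adjoint Y * Y)"
      using Y by (simp add: smult_mult_smult[of _ n n _ n] complex_norm_square mult.commute del: of_real_power)
    then have "mat_trace (\<rho> * (mat_adjoint (c \<cdot>\<^sub>m Y) * (c \<cdot>\<^sub>m Y))) = of_real ((cmod c)\<^sup>2) * mat_trace (\<rho> * (mat_adjoint Y * Y))"
      using Y Rc by (simp add: mult_smult_distrib[of _ n n _ n] mat_trace_smult[of _ n])
    then show "q (c \<cdot>\<^sub>m Y) = (cmod c)\<^sup>2 * q Y" by (simp only: q_def Re_complex_of_real times_complex.sel Im_complex_of_real)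
  next
    fix U Y :: "complex mat" assume U: "unitary_mat N U" and Y: "Y \<in> carrier_mat n n"
    define B where "B = phys_act N n U A"
    define Z where "Z = mixed_channel N n A B Y"
    have B: "B s \<in> carrier_mat n n" for s by (simp add: B_def)
    have Z: "Z \<in> carrier_mat n n" by (simp add: Z_def)
    note A = tensor_carrier
    note assoc = assoc_mult_mat[of _ n n _ n _ n]
    \<comment> \<open>Pythagoras: by left-canonicity the column with blocks \<open>A s\<close> is an
      isometry, and \<open>Z\<close> is its adjoint applied to the column with blocks
      \<open>Y * B s\<close>. Hence \<open>D\<close> is the component of that column orthogonal to
      the range of the isometry, and its Gram matrix is the difference of the two Gram matrices. In
      \<open>DD\<close> the factor \<open>1\<^sub>m n\<close> is inserted so that the last term sums
      to \<open>E (1\<^sub>m n)\<close>.\<close>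
    define D where "D s = Y * B s - A s * Z" for s
    have D: "D s \<in> carrier_mat n n" if "s < N" for s using A[OF that] B Y Z by (simp add: D_def minus_carrier_mat)
    have adjZ: "mat_adjoint Z = mat_sum n (\<lambda>s. mat_adjoint (B s) * mat_adjoint Y * A s) {..<N}"
      unfolding Z_def mixed_channel_def using A B Y
      by (simp add: mat_adjoint_mat_sum mat_adjoint_mult[of _ n n _ n] assoc)
    have DD: "mat_adjoint (D s) * D s =
        (mat_adjoint (B s) * (mat_adjoint Y * Y) * B s - mat_adjoint Z * (mat_adjoint (A s) * Y * B s))
        - ((mat_adjoint (B s) * mat_adjoint Y * A s) * Z - mat_adjoint Z * (mat_adjoint (A s) * 1\<^sub>m n * A s) * Z)"
      if "s < N" for s
      unfolding D_def using A[OF that] B[of s] Y Z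
      by (simp add: mat_adjoint_minus[of _ n n] mat_adjoint_mult[of _ n n _ n]
          minus_mult_distrib_mat[of _ n n _ _ n] mult_minus_distrib_mat[of _ n n _ n _] minus_carrier_mat assoc)
    have "mat_sum n (\<lambda>s. mat_adjoint (D s) * D s) {..<N} =
        (transfer_channel N n B (mat_adjoint Y * Y) - mat_adjoint Z * Z)
        - (mat_adjoint Z * Z - mat_adjoint Z * E (1\<^sub>m n) * Z)"
    proof -
      have 1: "mat_sum n (\<lambda>s. mat_adjoint (B s) * mat_adjoint Y * A s * Z) {..<N} = mat_adjoint Z * Z"
        unfolding adjZ using A B Y Z by (subst mat_sum_mult) simp_all
      have 2: "mat_sum n (\<lambda>s. mat_adjoint Z * (mat_adjoint (A s) * Y * B s)) {..<N} = mat_adjoint Z * Z"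
        using A B Y Z by (subst mult_mat_sum[symmetric]) (simp_all add: Z_def mixed_channel_def)
      have 3: "mat_sum n (\<lambda>s. mat_adjoint Z * (mat_adjoint (A s) * 1\<^sub>m n * A s) * Z) {..<N} = mat_adjoint Z * E (1\<^sub>m n) * Z"
        unfolding transfer_channel_def using A Z by (simp add: mult_mat_sum mat_sum_mult)
      show ?thesis
        using A B Y Z by (simp add: DD mat_sum_minus minus_carrier_mat 1 2 3 transfer_channel_def[of N n B] del: right_mult_one_mat)
    qed
    also have "\<dots> = E (mat_adjoint Y * Y) - mat_adjoint Z * Z"
    proof -
      have 1: "transfer_channel N n B (mat_adjoint Y * Y) = E (mat_adjoint Y * Y)"
        unfolding B_def using A U Y by (intro transfer_channel_phys_act) auto
      have 2: "mat_adjoint Z * E (1\<^sub>m n) * Z = mat_adjoint Z * Z" using Z by (simp add: E_one)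
      show ?thesis unfolding 1 2 using Z by (intro eq_matI) auto
    qed
    finally have S: "mat_sum n (\<lambda>s. mat_adjoint (D s) * D s) {..<N} = E (mat_adjoint Y * Y) - mat_adjoint Z * Z" .
    have "(\<Sum>s<N. mat_trace (\<rho> * (mat_adjoint (D s) * D s))) = mat_trace (\<rho> * mat_sum n (\<lambda>s. mat_adjoint (D s) * D s) {..<N})"
      using D Rc by (simp add: mult_mat_sum mat_trace_mat_sum)
    also have "\<dots> = mat_trace (\<rho> * E (mat_adjoint Y * Y)) - mat_trace (\<rho> * (mat_adjoint Z * Z))"
      unfolding S using Rc Z by (simp add: mult_minus_distrib_mat[of _ n n _ n _] mat_trace_minus[of _ n])
    \<comment> \<open>Duality: moving \<open>A s\<close> around the trace turns \<open>E\<close>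
      into its dual, which fixes \<open>\<rho>\<close>.\<close>
    also have "mat_trace (\<rho> * E (mat_adjoint Y * Y)) = mat_trace (\<rho> * (mat_adjoint Y * Y))"
    proof -
      define G where "G = mat_adjoint Y * Y"
      have G: "G \<in> carrier_mat n n" using Y by (simp add: G_def)
      have "mat_trace (\<rho> * E G) = (\<Sum>s<N. mat_trace (\<rho> * (mat_adjoint (A s) * G * A s)))"
        unfolding transfer_channel_def using A Rc G by (simp add: mult_mat_sum mat_trace_mat_sum)
      also have "\<dots> = (\<Sum>s<N. mat_trace (A s * \<rho> * mat_adjoint (A s) * G))"
      proof (rule sum.cong[OF refl])
        fix s assume "s \<in> {..<N}"
        then have As: "A s \<in> carrier_mat n n" using A by simp
        have "mat_trace (\<rho> * (mat_adjoint (A s) * G * A s)) = mat_trace ((\<rho> * (mat_adjoint (A s) * G)) * A s)"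
          using As Rc G by (simp add: assoc)
        also have "\<dots> = mat_trace (A s * (\<rho> * (mat_adjoint (A s) * G)))"
          using As Rc G by (intro mat_trace_mult_commute) auto
        finally show "mat_trace (\<rho> * (mat_adjoint (A s) * G * A s)) = mat_trace (A s * \<rho> * mat_adjoint (A s) * G)"
          using As Rc G by (simp add: assoc)
      qed
      also have "\<dots> = mat_trace (mat_sum n (\<lambda>s. A s * \<rho> * mat_adjoint (A s)) {..<N} * G)"
        using A Rc G by (simp add: mat_sum_mult mat_trace_mat_sum)
      finally show ?thesis by (simp add: \<rho>(2) G_def)
    qed
    finally show "(\<Sum>s<N. q (Y * phys_act N n U A s - A s * mixed_channel N n A (phys_act N n U A) Y)) =
       q Y - q (mixed_channel N n A (phys_act N n U A) Y)"
      unfolding B_def[symmetric] Z_def[symmetric] D_def[symmetric] q_def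
      by (simp flip: Re_sum)
  qed
qed

text \<open>The weighted norm cannot grow along the chain, yet one period multiplies its square by
  \<open>(cmod l)\<^sup>2\<close>, which is at least 1. So it is constant and every defect vanishes.
  The Gram matrices of the intertwiners \<open>Y j\<close> are then carried along by
  \<open>E\<close> and close after a period, hence are scalar, and rescaling makes every
  \<open>Y j\<close> unitary.\<close>

lemma mixed_eigenvector_unitary:
  assumes U: "\<And>j. unitary_mat N (U j)" and per: "\<And>j. U (j + L) = U j" and L: "L > 0"
    and Y0: "Y 0 \<in> carrier_mat n n" "Y 0 \<noteq> 0\<^sub>m n n"
    and Ys: "\<And>j. Y (Suc j) = mixed_channel N n A (phys_act N n (U j) A) (Y j)"
    and YL: "Y L = l \<cdot>\<^sub>m Y 0" and l: "cmod l \<ge> 1"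
  obtains v where "\<And>j. unitary_mat n (v j)" "cmod l = 1" "\<And>j. v (j + L) = l \<cdot>\<^sub>m v j"
    "\<And>j s. s < N \<Longrightarrow> phys_act N n (U j) A s = mat_adjoint (v j) * A s * v (Suc j)"
proof -
  define B where "B j = phys_act N n (U j) A" for j
  have B: "B j s \<in> carrier_mat n n" for j s by (simp add: B_def)
  note A = tensor_carrier
  note assoc = assoc_mult_mat[of _ n n _ n _ n]
  have Y: "Y j \<in> carrier_mat n n" for j by (cases j) (auto simp: Y0 Ys)
  have Yper: "Y (j + L) = l \<cdot>\<^sub>m Y j" for j
  proof (induction j)
    case (Suc j)
    then show ?case using mixed_channel_smult[OF A B[of j], where Y = "Y j" and c = l] Y by (simp add: Ys per B_def)
  qed (simp add: YL)
  obtain q :: "complex mat \<Rightarrow> real" where q: "\<And>Y. Y \<in> carrier_mat n n \<Longrightarrow> q Y \<ge> 0"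
    "\<And>Y. Y \<in> carrier_mat n n \<Longrightarrow> q Y = 0 \<Longrightarrow> Y = 0\<^sub>m n n"
    "\<And>c Y. Y \<in> carrier_mat n n \<Longrightarrow> q (c \<cdot>\<^sub>m Y) = (cmod c)\<^sup>2 * q Y"
    "\<And>U Y. unitary_mat N U \<Longrightarrow> Y \<in> carrier_mat n n \<Longrightarrow>
       (\<Sum>s<N. q (Y * phys_act N n U A s - A s * mixed_channel N n A (phys_act N n U A) Y)) =
       q Y - q (mixed_channel N n A (phys_act N n U A) Y)"
    using weighted_norm_exists by blast
  have defect: "(\<Sum>s<N. q (Y j * B j s - A s * Y (Suc j))) = q (Y j) - q (Y (Suc j))" for j
    unfolding Ys B_def by (rule q(4)[OF U Y])
  have Dc: "Y j * B j s - A s * Y (Suc j) \<in> carrier_mat n n" if "s < N" for j s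
    using A[OF that] B Y by (simp add: minus_carrier_mat)
  have dec: "q (Y (Suc j)) \<le> q (Y j)" for j
  proof -
    have "0 \<le> (\<Sum>s<N. q (Y j * B j s - A s * Y (Suc j)))"
      by (intro sum_nonneg q(1)) (use Dc in simp)
    then show ?thesis by (simp add: defect)
  qed
  have anti: "q (Y (j + k)) \<le> q (Y j)" for j k
    by (induction k) (auto intro: order_trans[OF dec])
  have qper: "q (Y (j + L)) = (cmod l)\<^sup>2 * q (Y j)" for j
    unfolding Yper by (rule q(3)[OF Y])
  have ge: "q (Y (j + L)) \<ge> q (Y j)" for j
    unfolding qper using l q(1)[OF Y, of j] by (simp add: mult_le_cancel_right1 one_le_power)
  \<comment> \<open>Sandwich: \<open>q (Y (j + L)) \<le> q (Y (Suc j)) \<le> q (Y j) \<le> q (Y (j +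
    L))\<close>, where the first bound takes the remaining \<open>L - 1\<close> steps.\<close>
  have eq: "q (Y (Suc j)) = q (Y j)" for j
    using anti[of "Suc j" "L - 1"] ge[of j] dec[of j] L by simp
  have l1: "cmod l = 1"
  proof -
    have "q (Y 0) \<noteq> 0" using q(2)[OF Y0(1)] Y0(2) by blast
    moreover have "q (Y (0 + L)) = q (Y 0)" using anti[of 0 L] ge[of 0] by simp
    ultimately have "(cmod l)\<^sup>2 = 1" using qper[of 0] by simp
    then show ?thesis using l by (simp add: power2_eq_1_iff)
  qed
  have inter: "Y j * B j s = A s * Y (Suc j)" if s: "s < N" for j s
  proof -
    have "(\<Sum>s<N. q (Y j * B j s - A s * Y (Suc j))) = 0" by (simp add: defect eq)
    then have "q (Y j * B j s - A s * Y (Suc j)) = 0"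
      using s by (subst (asm) sum_nonneg_eq_0_iff) (auto intro!: q(1) Dc)
    then have 0: "Y j * B j s - A s * Y (Suc j) = 0\<^sub>m n n" by (rule q(2)[OF Dc[OF s]])
    show ?thesis
    proof (rule eq_matI)
      fix i k assume "i < dim_row (A s * Y (Suc j))" "k < dim_col (A s * Y (Suc j))"
      then have ik: "i < n" "k < n" using A[OF s] Y[of "Suc j"] by auto
      have "(Y j * B j s - A s * Y (Suc j)) $$ (i, k) = 0" using 0 ik by simp
      then show "(Y j * B j s) $$ (i, k) = (A s * Y (Suc j)) $$ (i, k)"
        using ik A[OF s] Y[of "Suc j"] by (simp del: index_mult_mat(1))
    qed (use A[OF s] B[of j s] Y[of j] Y[of "Suc j"] in auto)
  qed
  define G where "G j = mat_adjoint (Y j) * Y j" for j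
  have G: "G j \<in> carrier_mat n n" for j using Y by (simp add: G_def)
  \<comment> \<open>\<open>E\<close> may be computed with the tensor \<open>B j\<close>, where the
    intertwining relation replaces \<open>Y j * B j s\<close>. The sum left over is the adjoint of
    the mixed channel, namely of \<open>Y (Suc j)\<close>.\<close>
  have EG: "E (G j) = G (Suc j)" for j
  proof -
    have "E (G j) = transfer_channel N n (B j) (G j)"
      unfolding B_def using A U G by (intro transfer_channel_phys_act[symmetric]) auto
    also have "\<dots> = mat_sum n (\<lambda>s. mat_adjoint (B j s) * mat_adjoint (Y j) * A s * Y (Suc j)) {..<N}"
      unfolding transfer_channel_def
    proof (rule mat_sum_cong[OF refl], unfold simp_implies_def)
      fix s assume "s \<in> {..<N}"
      then have s: "s < N" by simp
      have "mat_adjoint (B j s) * G j * B j s = mat_adjoint (B j s) * mat_adjoint (Y j) * (Y j * B j s)"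
        using B[of j s] Y[of j] by (simp add: G_def assoc)
      also have "\<dots> = mat_adjoint (B j s) * mat_adjoint (Y j) * A s * Y (Suc j)"
        using B[of j s] Y[of j] Y[of "Suc j"] A[OF s] by (simp add: inter[OF s] assoc)
      finally show "mat_adjoint (B j s) * G j * B j s = mat_adjoint (B j s) * mat_adjoint (Y j) * A s * Y (Suc j)" .
    qed
    also have "\<dots> = mat_sum n (\<lambda>s. mat_adjoint (B j s) * mat_adjoint (Y j) * A s) {..<N} * Y (Suc j)"
      using A B Y by (simp add: mat_sum_mult)
    also have "mat_sum n (\<lambda>s. mat_adjoint (B j s) * mat_adjoint (Y j) * A s) {..<N} = mat_adjoint (Y (Suc j))"
      unfolding Ys mixed_channel_def B_def[symmetric] using A B Y
      by (simp add: mat_adjoint_mat_sum mat_adjoint_mult[of _ n n _ n] assoc)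
    finally show ?thesis by (simp add: G_def)
  qed
  have Epow: "(E ^^ j) (G 0) = G j" for j by (induction j) (auto simp: EG)
  have "G L = 1 \<cdot>\<^sub>m G 0"
    using Yper[of 0] Y l1 by (simp add: G_def smult_mult_smult[of _ n n _ n] complex_norm_square[symmetric] mult.commute[of "cnj l"])
  then obtain c where c0: "G 0 = c \<cdot>\<^sub>m 1\<^sub>m n"
    using periodic_point_scalar[OF G L, of 0 1] Epow by auto
  have c: "G j = c \<cdot>\<^sub>m 1\<^sub>m n" for j
    by (induction j) (auto simp: c0 EG[symmetric] E_smult E_one)
  have diag: "G 0 $$ (i, i) = of_real (\<Sum>k<n. (cmod (Y 0 $$ (k, i)))\<^sup>2)" if "i < n" for i
    unfolding G_def using Y0(1) that
    by (subst mult_mat_index_sum[of _ n n _ n]) (auto simp: complex_norm_square mult.commute simp del: of_real_power)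
  \<comment> \<open>All columns of \<open>Y 0\<close> have the same squared norm, the scalar
    \<open>c\<close>; it is read off from column 0, which exists because the bond dimension is
    positive. If it were zero, all of \<open>Y 0\<close> would vanish.\<close>
  define r where "r = (\<Sum>k<n. (cmod (Y 0 $$ (k, 0)))\<^sup>2)"
  have cr: "c = of_real r" using diag[OF bond_dim_pos] bond_dim_pos by (simp add: c0 r_def)
  have "r \<noteq> 0"
  proof
    assume "r = 0"
    have "Y 0 $$ (k, i) = 0" if "k < n" "i < n" for k i
    proof -
      have "complex_of_real (\<Sum>k<n. (cmod (Y 0 $$ (k, i)))\<^sup>2) = 0"
        using diag[OF that(2)] that cr \<open>r = 0\<close> by (simp add: c0)
      then have "(\<Sum>k<n. (cmod (Y 0 $$ (k, i)))\<^sup>2) = 0" by (simp only: of_real_eq_0_iff)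
      then show ?thesis using that by (subst (asm) sum_nonneg_eq_0_iff) auto
    qed
    then have "Y 0 = 0\<^sub>m n n" using Y0(1) by (intro eq_matI) auto
    then show False using Y0(2) by simp
  qed
  moreover have "r \<ge> 0" by (simp add: r_def sum_nonneg)
  ultimately have r: "r > 0" by simp
  \<comment> \<open>One normalisation serves all \<open>j\<close> because the Gram scalar is the
    same on every bond; therefore \<open>v\<close> inherits the closing factor \<open>l\<close> of
    \<open>Y\<close>.\<close>
  define t where "t = complex_of_real (1 / sqrt r)"
  have t: "cnj t * t * c = 1" "cnj t = t" "t \<noteq> 0"
    using r by (auto simp: t_def cr simp flip: of_real_mult of_real_divide)
  define v where "v j = t \<cdot>\<^sub>m Y j" for j
  have vc: "v j \<in> carrier_mat n n" for j using Y by (simp add: v_def)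
  have v1: "mat_adjoint (v j) * v j = 1\<^sub>m n" for j
    using c[of j] Y t(1) by (simp add: v_def G_def smult_mult_smult[of _ n n _ n] smult_smult_mat)
  have vu: "unitary_mat n (v j)" for j
    using mat_mult_left_right_inverse[OF _ vc v1] vc v1 by (simp add: unitary_mat_def)
  show ?thesis
  proof (rule that[of v])
    show "unitary_mat n (v j)" for j by (rule vu)
    show "cmod l = 1" by (rule l1)
    show "v (j + L) = l \<cdot>\<^sub>m v j" for j by (simp add: v_def Yper smult_smult_mat mult.commute)
    show "phys_act N n (U j) A s = mat_adjoint (v j) * A s * v (Suc j)" if s: "s < N" for j s
    proof -
      have "v j * B j s = A s * v (Suc j)"
        using inter[OF s, of j] A[OF s] B[of j s] Y
        by (simp add: v_def mult_smult_assoc_mat[of _ n n _ n] mult_smult_distrib[of _ n n _ n])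
      then have "mat_adjoint (v j) * (v j * B j s) = mat_adjoint (v j) * A s * v (Suc j)"
        using A[OF s] vc by (simp add: assoc)
      then show ?thesis using mult_adjoint_cancel(2)[OF vu B, of j j s] by (simp add: B_def)
    qed
  qed
qed

end

section \<open>Channels as matrices\<close>

definition vectorize :: "nat \<Rightarrow> complex mat \<Rightarrow> complex vec" where
  "vectorize n Y = vec (n * n) (\<lambda>p. Y $$ (p div n, p mod n))"

text \<open>The transpose of the sum over \<open>s\<close> of the Kronecker products of the
  entrywise conjugate of \<open>A s\<close> with \<open>B s\<close>, in row-major order. As a
  matrix, the mixed channel becomes accessible to \<open>eigenvalue\<close> and
  \<open>mat_trace_pow\<close>.\<close>

definition channel_mat ::
    "nat \<Rightarrow> nat \<Rightarrow> (nat \<Rightarrow> complex mat) \<Rightarrow> (nat \<Rightarrow> complex mat) \<Rightarrow> complex mat" where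
  "channel_mat N n A B = mat (n * n) (n * n)
     (\<lambda>(p, q). \<Sum>s<N. cnj (A s $$ (q div n, p div n)) * B s $$ (q mod n, p mod n))"

definition matrix_unit :: "nat \<Rightarrow> nat \<Rightarrow> complex mat" where
  "matrix_unit n p = mat n n (\<lambda>(i, j). if i = p div n \<and> j = p mod n then 1 else 0)"

lemma square_index_bounds:
  "p < n * n \<Longrightarrow> p div n < n" "p < n * n \<Longrightarrow> p mod n < n" for p n :: nat
  by (simp_all add: less_mult_imp_div_less) (cases n; simp)

lemma square_index_encode: "i < n \<Longrightarrow> j < n \<Longrightarrow> i * n + j < n * n" for i j n :: nat
proof -
  assume "i < n" "j < n"
  then have "i * n + j < Suc i * n" by simp
  also have "\<dots> \<le> n * n" using \<open>i < n\<close> by (intro mult_right_mono) auto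
  finally show ?thesis .
qed

lemma sum_square_index:
  "(\<Sum>p<n * n. f (p div n) (p mod n)) = (\<Sum>i<n. \<Sum>j<n. f i j)" for f :: "nat \<Rightarrow> nat \<Rightarrow> complex"
proof -
  have "(\<Sum>p=i*n..<i*n+n. f (p div n) (p mod n)) = (\<Sum>j<n. f i j)" for i
    using sum.shift_bounds_nat_ivl[of "\<lambda>p. f (p div n) (p mod n)" 0 "i * n" n]
    by (simp add: atLeast0LessThan add.commute)
  then show ?thesis by (simp flip: sum.nat_group[of _ n n])
qed

lemma vectorize_carrier [simp]: "vectorize n Y \<in> carrier_vec (n * n)"
  by (simp add: vectorize_def)

lemma channel_mat_carrier [simp]: "channel_mat N n A B \<in> carrier_mat (n * n) (n * n)"
  by (simp add: channel_mat_def)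

lemma vectorize_inject:
  assumes "Y \<in> carrier_mat n n" "Z \<in> carrier_mat n n" "vectorize n Y = vectorize n Z"
  shows "Y = Z"
proof (rule eq_matI)
  fix i j assume "i < dim_row Z" "j < dim_col Z"
  then have ij: "i < n" "j < n" using assms by auto
  have "vectorize n Y $ (i * n + j) = vectorize n Z $ (i * n + j)" using assms by simp
  then show "Y $$ (i, j) = Z $$ (i, j)"
    using ij square_index_encode[OF ij] by (simp add: vectorize_def)
qed (use assms in auto)

lemma vectorize_surj:
  assumes "v \<in> carrier_vec (n * n)"
  obtains Y where "Y \<in> carrier_mat n n" "vectorize n Y = v"
proof (rule that)
  let ?Y = "mat n n (\<lambda>(i, j). v $ (i * n + j))"
  show "?Y \<in> carrier_mat n n" by simp
  show "vectorize n ?Y = v"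
    using assms by (intro eq_vecI) (auto simp: vectorize_def square_index_bounds)
qed

lemma vectorize_smult: "Y \<in> carrier_mat n n \<Longrightarrow> vectorize n (c \<cdot>\<^sub>m Y) = c \<cdot>\<^sub>v vectorize n Y"
  by (rule eq_vecI) (auto simp: vectorize_def square_index_bounds)

lemma vectorize_zero: "vectorize n (0\<^sub>m n n) = 0\<^sub>v (n * n)"
  by (rule eq_vecI) (auto simp: vectorize_def square_index_bounds)

lemma sandwich_index:
  assumes "C \<in> carrier_mat n n" "Y \<in> carrier_mat n n" "D \<in> carrier_mat n n" "k < n" "l < n"
  shows "(mat_adjoint C * Y * D) $$ (k, l) = (\<Sum>i<n. \<Sum>j<n. cnj (C $$ (i, k)) * Y $$ (i, j) * D $$ (j, l))"
proof -
  have "(mat_adjoint C * Y * D) $$ (k, l) = (\<Sum>j<n. (mat_adjoint C * Y) $$ (k, j) * D $$ (j, l))"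
    using assms by (intro mult_mat_index_sum) auto
  also have "\<dots> = (\<Sum>j<n. \<Sum>i<n. cnj (C $$ (i, k)) * Y $$ (i, j) * D $$ (j, l))"
    using assms by (intro sum.cong) (auto simp: mult_mat_index_sum[of _ n n _ n] sum_distrib_right simp del: index_mult_mat(1))
  finally show ?thesis by (subst sum.swap)
qed

lemma channel_mat_mult_vec:
  assumes A: "\<And>s. s < N \<Longrightarrow> A s \<in> carrier_mat n n" and B: "\<And>s. s < N \<Longrightarrow> B s \<in> carrier_mat n n"
    and Y: "Y \<in> carrier_mat n n"
  shows "channel_mat N n A B *\<^sub>v vectorize n Y = vectorize n (mixed_channel N n A B Y)"
proof (rule eq_vecI)
  fix p assume "p < dim_vec (vectorize n (mixed_channel N n A B Y))"
  then have p: "p < n * n" by (simp add: vectorize_def)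
  let ?k = "p div n" and ?l = "p mod n"
  note kl = square_index_bounds[OF p]
  have "(channel_mat N n A B *\<^sub>v vectorize n Y) $ p =
      (\<Sum>q<n * n. (\<Sum>s<N. cnj (A s $$ (q div n, ?k)) * B s $$ (q mod n, ?l)) * Y $$ (q div n, q mod n))"
    using p by (simp add: channel_mat_def vectorize_def scalar_prod_def atLeast0LessThan)
  also have "\<dots> = (\<Sum>i<n. \<Sum>j<n. (\<Sum>s<N. cnj (A s $$ (i, ?k)) * B s $$ (j, ?l)) * Y $$ (i, j))"
    by (rule sum_square_index)
  also have "\<dots> = (\<Sum>i<n. \<Sum>j<n. \<Sum>s<N. cnj (A s $$ (i, ?k)) * Y $$ (i, j) * B s $$ (j, ?l))"
    by (simp add: sum_distrib_right sum_distrib_left mult_ac)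
  also have "\<dots> = (\<Sum>i<n. \<Sum>s<N. \<Sum>j<n. cnj (A s $$ (i, ?k)) * Y $$ (i, j) * B s $$ (j, ?l))"
    by (rule sum.cong[OF refl], rule sum.swap)
  also have "\<dots> = (\<Sum>s<N. \<Sum>i<n. \<Sum>j<n. cnj (A s $$ (i, ?k)) * Y $$ (i, j) * B s $$ (j, ?l))"
    by (rule sum.swap)
  also have "\<dots> = (\<Sum>s<N. (mat_adjoint (A s) * Y * B s) $$ (?k, ?l))"
    by (rule sum.cong[OF refl], rule sandwich_index[symmetric]) (use A B Y kl in auto)
  also have "\<dots> = vectorize n (mixed_channel N n A B Y) $ p"
    using p kl by (simp add: vectorize_def mixed_channel_def)
  finally show "(channel_mat N n A B *\<^sub>v vectorize n Y) $ p = vectorize n (mixed_channel N n A B Y) $ p" .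
qed (simp add: channel_mat_def vectorize_def)

section \<open>Chains with site-dependent tensors\<close>

lemma configs_0 [simp]: "configs N 0 = {[]}"
  by (auto simp: configs_def)

lemma configs_Suc_bij:
  "bij_betw (\<lambda>(s, t). s @ [t]) (configs N M \<times> {..<N}) (configs N (Suc M))"
proof (rule bij_betw_imageI)
  show "inj_on (\<lambda>(s, t). s @ [t]) (configs N M \<times> {..<N})" by (auto simp: inj_on_def)
  show "(\<lambda>(s, t). s @ [t]) ` (configs N M \<times> {..<N}) = configs N (Suc M)"
  proof (intro equalityI subsetI)
    fix s assume s: "s \<in> configs N (Suc M)"
    then have "s = butlast s @ [last s]" by (cases s rule: rev_cases) (auto simp: configs_def)
    moreover have "butlast s \<in> configs N M" "last s \<in> {..<N}"
      using s by (cases s rule: rev_cases; auto simp: configs_def)+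
    ultimately show "s \<in> (\<lambda>(s, t). s @ [t]) ` (configs N M \<times> {..<N})" by force
  qed (auto simp: configs_def)
qed

lemma sum_configs_Suc:
  "(\<Sum>s\<in>configs N (Suc M). f s) = (\<Sum>s\<in>configs N M. \<Sum>t<N. f (s @ [t]))"
  by (simp add: sum.reindex_bij_betw[OF configs_Suc_bij, symmetric] sum.cartesian_product case_prod_unfold)

lemma mat_sum_configs_Suc:
  "mat_sum n F (configs N (Suc M)) = mat_sum n (\<lambda>s. mat_sum n (\<lambda>t. F (s @ [t])) {..<N}) (configs N M)"
  by (rule eq_matI) (auto simp: sum_configs_Suc)

text \<open>A left fold, unlike the right fold in \<open>periodic_mps\<close>: the tensors depend on
  the position, and removing the last site in an induction leaves the positions of all other sites
  unchanged.\<close>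

definition chain_word :: "nat \<Rightarrow> (nat \<Rightarrow> nat \<Rightarrow> complex mat) \<Rightarrow> nat list \<Rightarrow> complex mat" where
  "chain_word n B s = foldl (\<lambda>P j. P * B j (s ! j)) (1\<^sub>m n) [0..<length s]"

lemma chain_word_Nil [simp]: "chain_word n B [] = 1\<^sub>m n"
  by (simp add: chain_word_def)

lemma chain_word_snoc: "chain_word n B (s @ [t]) = chain_word n B s * B (length s) t"
proof -
  have "foldl (\<lambda>P j. P * B j ((s @ [t]) ! j)) X [0..<length s] = foldl (\<lambda>P j. P * B j (s ! j)) X [0..<length s]" for X
    by (rule foldl_cong) (auto simp: nth_append)
  then show ?thesis by (simp add: chain_word_def)
qed

lemma chain_word_carrier:
  assumes "\<And>j s. s < N \<Longrightarrow> B j s \<in> carrier_mat n n" "s \<in> configs N M"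
  shows "chain_word n B s \<in> carrier_mat n n"
  using assms(2)
proof (induction s arbitrary: M rule: rev_induct)
  case (snoc t s)
  then have "s \<in> configs N (length s)" "t < N" by (auto simp: configs_def)
  then show ?case using snoc assms(1) by (simp add: chain_word_snoc)
qed simp

lemma periodic_mps_chain_word:
  assumes A: "\<And>s. s < N \<Longrightarrow> A s \<in> carrier_mat n n" and s: "s \<in> configs N M"
  shows "periodic_mps n A s = mat_trace (chain_word n (\<lambda>_. A) s)"
proof -
  \<comment> \<open>Generalised from the identity to an arbitrary seed \<open>X\<close>, since
    splitting off the last site changes the seed of the right fold to
    \<open>A t * X\<close>.\<close>
  have "foldr (\<lambda>i P. A i * P) s X = chain_word n (\<lambda>_. A) s * X" if "X \<in> carrier_mat n n" for X
    using s that
  proof (induction s arbitrary: M X rule: rev_induct)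
    case (snoc t s)
    then have st: "s \<in> configs N (length s)" "t < N" by (auto simp: configs_def)
    have "foldr (\<lambda>i P. A i * P) (s @ [t]) X = chain_word n (\<lambda>_. A) s * (A t * X)"
      using snoc.IH[OF st(1), of "A t * X"] A[OF st(2)] snoc.prems by simp
    then show ?case
      using A[OF st(2)] snoc.prems chain_word_carrier[of N "\<lambda>_. A" n, OF A st(1)]
      by (simp add: chain_word_snoc assoc_mult_mat[of _ n n _ n _ n])
  qed simp
  from this[of "1\<^sub>m n"] show ?thesis
    using chain_word_carrier[of N "\<lambda>_. A" n, OF A s] by (simp add: periodic_mps_def)
qed

text \<open>Multilinearity of the matrix product: the sum over configurations factorises site by
  site. It is stated for words before taking the trace, because the trace would block the induction
  on the number of sites.\<close>

lemma chain_word_phys_act: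
  assumes A: "\<And>s. s < N \<Longrightarrow> A s \<in> carrier_mat n n" and s: "s \<in> configs N M"
  shows "mat_sum n (\<lambda>t. (\<Prod>i<M. U i $$ (s ! i, t ! i)) \<cdot>\<^sub>m chain_word n (\<lambda>_. A) t) (configs N M) =
    chain_word n (\<lambda>j. phys_act N n (U j) A) s"
  using s
proof (induction M arbitrary: s)
  case 0
  then show ?case by (intro eq_matI) auto
next
  case (Suc M)
  obtain s' r where sr: "s = s' @ [r]" "s' \<in> configs N M" "r < N"
    using Suc.prems unfolding bij_betw_imp_surj_on[OF configs_Suc_bij, symmetric] by auto
  have len: "length s' = M" using sr by (simp add: configs_def)
  let ?W = "chain_word n (\<lambda>_. A)"
  have W: "?W t \<in> carrier_mat n n" if "t \<in> configs N M" for t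
    using chain_word_carrier[of N "\<lambda>_. A" n, OF A that] .
  let ?c = "\<lambda>t. \<Prod>i<M. U i $$ (s' ! i, t ! i)"
  have "(\<Prod>i<Suc M. U i $$ (s ! i, (t @ [k]) ! i)) \<cdot>\<^sub>m ?W (t @ [k]) = (?c t \<cdot>\<^sub>m ?W t) * (U M $$ (r, k) \<cdot>\<^sub>m A k)"
    if t: "t \<in> configs N M" and k: "k < N" for t k
  proof -
    have lt: "length t = M" using t by (simp add: configs_def)
    have "(\<Prod>i<Suc M. U i $$ (s ! i, (t @ [k]) ! i)) = ?c t * U M $$ (r, k)"
      using len lt sr by (simp add: nth_append)
    then show ?thesis using W[OF t] A[OF k] lt
      by (simp add: chain_word_snoc smult_mult_smult[of _ n n _ n])
  qed
  then have "mat_sum n (\<lambda>t. (\<Prod>i<Suc M. U i $$ (s ! i, t ! i)) \<cdot>\<^sub>m ?W t) (configs N (Suc M)) =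
      mat_sum n (\<lambda>t. mat_sum n (\<lambda>k. (?c t \<cdot>\<^sub>m ?W t) * (U M $$ (r, k) \<cdot>\<^sub>m A k)) {..<N}) (configs N M)"
    unfolding mat_sum_configs_Suc by (simp del: prod.lessThan_Suc)
  also have "\<dots> = mat_sum n (\<lambda>t. ?c t \<cdot>\<^sub>m ?W t) (configs N M) * phys_act N n (U M) A r"
    unfolding phys_act_def using A W by (simp add: mult_mat_sum mat_sum_mult) (rule mat_sum_swap)
  also have "\<dots> = chain_word n (\<lambda>j. phys_act N n (U j) A) s"
    using Suc.IH[OF sr(2)] len by (simp add: sr(1) chain_word_snoc)
  finally show ?case .
qed

lemma apply_product_op_periodic_mps:
  assumes A: "\<And>s. s < N \<Longrightarrow> A s \<in> carrier_mat n n" and s: "s \<in> configs N M"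
  shows "apply_product_op N (map U [0..<M]) (periodic_mps n A) s =
    mat_trace (chain_word n (\<lambda>j. phys_act N n (U j) A) s)"
proof -
  let ?W = "chain_word n (\<lambda>_. A)" and ?c = "\<lambda>t. \<Prod>i<M. U i $$ (s ! i, t ! i)"
  have W: "?W t \<in> carrier_mat n n" if "t \<in> configs N M" for t
    using chain_word_carrier[of N "\<lambda>_. A" n, OF A that] .
  have "apply_product_op N (map U [0..<M]) (periodic_mps n A) s = (\<Sum>t\<in>configs N M. ?c t * periodic_mps n A t)"
    by (simp add: apply_product_op_def)
  also have "\<dots> = (\<Sum>t\<in>configs N M. mat_trace (?c t \<cdot>\<^sub>m ?W t))"
    by (rule sum.cong) (use W in \<open>auto simp: mat_trace_smult[of _ n] periodic_mps_chain_word[of N, OF A]\<close>)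
  also have "\<dots> = mat_trace (mat_sum n (\<lambda>t. ?c t \<cdot>\<^sub>m ?W t) (configs N M))"
    using W by (simp add: mat_trace_mat_sum)
  finally show ?thesis by (simp only: chain_word_phys_act[OF A s])
qed

fun chain_mat ::
    "nat \<Rightarrow> nat \<Rightarrow> (nat \<Rightarrow> complex mat) \<Rightarrow> (nat \<Rightarrow> nat \<Rightarrow> complex mat) \<Rightarrow> nat \<Rightarrow> complex mat" where
  "chain_mat N n A B 0 = 1\<^sub>m (n * n)"
| "chain_mat N n A B (Suc M) = channel_mat N n A (B M) * chain_mat N n A B M"

text \<open>The intermediate matrices matter, not only the result after one period: they become the
  chain \<open>Y j\<close> of \<open>mixed_eigenvector_unitary\<close>.\<close>

fun chain_iterate ::
    "nat \<Rightarrow> nat \<Rightarrow> (nat \<Rightarrow> complex mat) \<Rightarrow> (nat \<Rightarrow> nat \<Rightarrow> complex mat) \<Rightarrow> complex mat \<Rightarrow> nat \<Rightarrow> complex mat" where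
  "chain_iterate N n A B Y 0 = Y"
| "chain_iterate N n A B Y (Suc M) = mixed_channel N n A (B M) (chain_iterate N n A B Y M)"

lemma chain_mat_carrier [simp]: "chain_mat N n A B M \<in> carrier_mat (n * n) (n * n)"
  by (induction M) (auto intro: mult_carrier_mat)

lemma chain_mat_power:
  assumes per: "\<And>j. B (j + L) = B j"
  shows "chain_mat N n A B (m * L) = chain_mat N n A B L ^\<^sub>m m"
proof (induction m)
  case (Suc m)
  have "chain_mat N n A B (k + L) = chain_mat N n A B k * chain_mat N n A B L" for k
    by (induction k) (auto simp: per assoc_mult_mat[of _ "n * n" "n * n" _ "n * n" _ "n * n"] left_mult_one_mat[of _ "n * n" "n * n"])
  from this[of "m * L"] show ?case using Suc by (simp add: add.commute)
qed (simp add: carrier_matD[OF chain_mat_carrier])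

context
  fixes N n :: nat and A :: "nat \<Rightarrow> complex mat" and B :: "nat \<Rightarrow> nat \<Rightarrow> complex mat"
  assumes A: "\<And>s. s < N \<Longrightarrow> A s \<in> carrier_mat n n"
    and B: "\<And>j s. s < N \<Longrightarrow> B j s \<in> carrier_mat n n"
begin

lemma chain_iterate_carrier: "Y \<in> carrier_mat n n \<Longrightarrow> chain_iterate N n A B Y M \<in> carrier_mat n n"
  by (cases M) auto

lemma chain_mat_mult_vec:
  assumes Y: "Y \<in> carrier_mat n n"
  shows "chain_mat N n A B M *\<^sub>v vectorize n Y = vectorize n (chain_iterate N n A B Y M)"
proof (induction M)
  case (Suc M)
  have "chain_mat N n A B (Suc M) *\<^sub>v vectorize n Y =
      channel_mat N n A (B M) *\<^sub>v (chain_mat N n A B M *\<^sub>v vectorize n Y)"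
    by (simp add: assoc_mult_mat_vec[of _ "n * n" "n * n" _ "n * n"])
  then show ?case
    using Suc channel_mat_mult_vec[OF A B[of _ M] chain_iterate_carrier[OF Y, of M]] by simp
qed simp

lemma chain_iterate_word:
  assumes Y: "Y \<in> carrier_mat n n"
  shows "chain_iterate N n A B Y M =
    mat_sum n (\<lambda>s. mat_adjoint (chain_word n (\<lambda>_. A) s) * Y * chain_word n B s) (configs N M)"
proof (induction M)
  case 0
  show ?case using Y by (intro eq_matI) auto
next
  case (Suc M)
  let ?V = "chain_word n (\<lambda>_. A)" and ?W = "chain_word n B"
  have V: "?V s \<in> carrier_mat n n" if "s \<in> configs N M" for s
    using chain_word_carrier[of N "\<lambda>_. A" n, OF A that] .
  have W: "?W s \<in> carrier_mat n n" if "s \<in> configs N M" for s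
    using chain_word_carrier[of N B n, OF B that] .
  let ?G = "\<lambda>s. mat_adjoint (?V s) * Y * ?W s"
  have "mat_adjoint (A t) * ?G s * B M t = mat_adjoint (?V (s @ [t])) * Y * ?W (s @ [t])"
    if s: "s \<in> configs N M" and t: "t < N" for s t
  proof -
    have "length s = M" using s by (simp add: configs_def)
    then show ?thesis using V[OF s] W[OF s] A[OF t] B[OF t, of M] Y
      by (simp add: chain_word_snoc mat_adjoint_mult[of _ n n _ n] assoc_mult_mat[of _ n n _ n _ n])
  qed
  then show ?case
    using Suc V W Y
    by (simp add: mat_sum_configs_Suc mixed_channel_mat_sum[of N A n "B M", OF A B] del: mat_sum_index)
      (simp add: mixed_channel_def)
qed

text \<open>For fixed words \<open>V\<close>, \<open>W\<close> the linear map sending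
  \<open>Y\<close> to \<open>mat_adjoint V * Y * W\<close> has trace
  \<open>cnj (mat_trace V) * mat_trace W\<close>; its diagonal entries are read off on matrix units.
  Summing over words turns the overlap of two periodic states into the trace of the chain
  matrix.\<close>

lemma mat_trace_chain_mat:
  "mat_trace (chain_mat N n A B M) =
    (\<Sum>s\<in>configs N M. cnj (mat_trace (chain_word n (\<lambda>_. A) s)) * mat_trace (chain_word n B s))"
proof -
  let ?V = "chain_word n (\<lambda>_. A)" and ?W = "chain_word n B"
  have V: "?V s \<in> carrier_mat n n" if "s \<in> configs N M" for s
    using chain_word_carrier[of N "\<lambda>_. A" n, OF A that] .
  have W: "?W s \<in> carrier_mat n n" if "s \<in> configs N M" for s
    using chain_word_carrier[of N B n, OF B that] .
  have mu: "matrix_unit n p \<in> carrier_mat n n" for p by (simp add: matrix_unit_def)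
  have diag: "chain_mat N n A B M $$ (p, p) =
      (\<Sum>s\<in>configs N M. cnj (?V s $$ (p div n, p div n)) * ?W s $$ (p mod n, p mod n))"
    if p: "p < n * n" for p
  proof -
    note kl = square_index_bounds[OF p]
    have e: "vectorize n (matrix_unit n p) = unit_vec (n * n) p"
    proof (rule eq_vecI)
      fix q assume "q < dim_vec (unit_vec (n * n) p :: complex vec)"
      then have q: "q < n * n" by simp
      have "q = p \<longleftrightarrow> q div n = p div n \<and> q mod n = p mod n"
        by (metis div_mult_mod_eq)
      then show "vectorize n (matrix_unit n p) $ q = unit_vec (n * n) p $ q"
        using p q by (auto simp: vectorize_def matrix_unit_def square_index_bounds)
    qed (simp add: vectorize_def)
    have "chain_mat N n A B M $$ (p, p) = (chain_mat N n A B M *\<^sub>v unit_vec (n * n) p) $ p"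
      using p by (simp add: carrier_matD[OF chain_mat_carrier])
    also have "\<dots> = chain_iterate N n A B (matrix_unit n p) M $$ (p div n, p mod n)"
      unfolding e[symmetric] chain_mat_mult_vec[OF mu] using p by (simp add: vectorize_def)
    also have "\<dots> = (\<Sum>s\<in>configs N M. (mat_adjoint (?V s) * matrix_unit n p * ?W s) $$ (p div n, p mod n))"
      using kl by (simp add: chain_iterate_word[OF mu])
    also have "\<dots> = (\<Sum>s\<in>configs N M. cnj (?V s $$ (p div n, p div n)) * ?W s $$ (p mod n, p mod n))"
    proof (rule sum.cong[OF refl])
      fix s assume s: "s \<in> configs N M"
      have "(mat_adjoint (?V s) * matrix_unit n p * ?W s) $$ (p div n, p mod n) =
          (\<Sum>i<n. \<Sum>j<n. cnj (?V s $$ (i, p div n)) * matrix_unit n p $$ (i, j) * ?W s $$ (j, p mod n))"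
        by (rule sandwich_index[OF V[OF s] mu W[OF s] kl])
      also have "\<dots> = (\<Sum>i<n. \<Sum>j<n. if j = p mod n then
          (if i = p div n then cnj (?V s $$ (p div n, p div n)) * ?W s $$ (p mod n, p mod n) else 0) else 0)"
        by (intro sum.cong) (auto simp: matrix_unit_def)
      also have "\<dots> = cnj (?V s $$ (p div n, p div n)) * ?W s $$ (p mod n, p mod n)"
        using kl by simp
      finally show "(mat_adjoint (?V s) * matrix_unit n p * ?W s) $$ (p div n, p mod n) =
          cnj (?V s $$ (p div n, p div n)) * ?W s $$ (p mod n, p mod n)" .
    qed
    finally show ?thesis .
  qed
  have "mat_trace (chain_mat N n A B M) = (\<Sum>p<n * n. \<Sum>s\<in>configs N M. cnj (?V s $$ (p div n, p div n)) * ?W s $$ (p mod n, p mod n))"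
    by (simp add: mat_trace_def diag carrier_matD[OF chain_mat_carrier])
  also have "\<dots> = (\<Sum>s\<in>configs N M. \<Sum>p<n * n. cnj (?V s $$ (p div n, p div n)) * ?W s $$ (p mod n, p mod n))"
    by (rule sum.swap)
  also have "\<dots> = (\<Sum>s\<in>configs N M. \<Sum>i<n. \<Sum>j<n. cnj (?V s $$ (i, i)) * ?W s $$ (j, j))"
    by (rule sum.cong[OF refl], rule sum_square_index)
  also have "\<dots> = (\<Sum>s\<in>configs N M. cnj (mat_trace (?V s)) * mat_trace (?W s))"
  proof (rule sum.cong[OF refl])
    fix s assume s: "s \<in> configs N M"
    show "(\<Sum>i<n. \<Sum>j<n. cnj (?V s $$ (i, i)) * ?W s $$ (j, j)) = cnj (mat_trace (?V s)) * mat_trace (?W s)"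
      using V[OF s] W[OF s] by (simp add: mat_trace_def sum_product)
  qed
  finally show ?thesis .
qed

end

section \<open>From the eigenstate condition to bond unitaries\<close>

context injective_tensor
begin

lemma eigenvalue_channel_mat:
  assumes "eigenvalue (channel_mat N n A A) x"
  shows "x = 1 \<or> cmod x < 1"
proof -
  obtain v where v: "v \<in> carrier_vec (n * n)" "v \<noteq> 0\<^sub>v (n * n)"
    "channel_mat N n A A *\<^sub>v v = x \<cdot>\<^sub>v v"
    using assms unfolding eigenvalue_def eigenvector_def carrier_matD[OF channel_mat_carrier] by auto
  obtain Y where Y: "Y \<in> carrier_mat n n" "vectorize n Y = v" using vectorize_surj[OF v(1)] .
  have "vectorize n (E Y) = vectorize n (x \<cdot>\<^sub>m Y)"
    using v(3) channel_mat_mult_vec[where A = A and B = A, OF tensor_carrier tensor_carrier Y(1)] Y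
    by (simp add: transfer_channel_eq_mixed vectorize_smult)
  then have "E Y = x \<cdot>\<^sub>m Y" using Y by (intro vectorize_inject) auto
  moreover have "Y \<noteq> 0\<^sub>m n n" using Y v vectorize_zero by auto
  ultimately have "map_eigenvalue n E x" using Y by (auto simp: map_eigenvalue_def)
  then show ?thesis using injective by (auto simp: left_canonical_injective_def)
qed

lemma eigenvalue_channel_mat_1: "eigenvalue (channel_mat N n A A) 1"
proof -
  let ?v = "vectorize n (1\<^sub>m n)"
  have "channel_mat N n A A *\<^sub>v ?v = 1 \<cdot>\<^sub>v ?v"
    using channel_mat_mult_vec[where A = A and B = A and Y = "1\<^sub>m n", OF tensor_carrier tensor_carrier] E_one
    by (simp add: transfer_channel_eq_mixed)
  moreover have "?v \<noteq> 0\<^sub>v (n * n)"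
    using vectorize_inject[of "1\<^sub>m n" n "0\<^sub>m n n"] one_mat_neq_zero by (auto simp: vectorize_zero)
  ultimately show ?thesis
    unfolding eigenvalue_def eigenvector_def carrier_matD[OF channel_mat_carrier] by (intro exI[of _ ?v]) auto
qed

text \<open>
  The overlap of the periodic MPS with its image is the trace of a power of the mixed channel of one
  period; its modulus equals the squared norm of the state, which tends to a positive limit, so the
  mixed channel cannot have spectral radius below \<open>1\<close>.
\<close>
lemma eigenstate_mixed_eigenvector:
  assumes U: "\<And>j. unitary_mat N (U j)" and per: "\<And>j. U (j + L) = U j" and L: "L > 0"
    and eig: "\<And>m. m > 0 \<Longrightarrow> is_eigenstate N (map U [0..<m * L]) (periodic_mps n A)"
  obtains l Y where "Y \<in> carrier_mat n n" "Y \<noteq> 0\<^sub>m n n" "cmod l \<ge> 1"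
    "chain_iterate N n A (\<lambda>j. phys_act N n (U j) A) Y L = l \<cdot>\<^sub>m Y"
proof -
  define B where "B j = phys_act N n (U j) A" for j
  have B: "B j s \<in> carrier_mat n n" for j s by (simp add: B_def)
  note A = tensor_carrier
  define Q where "Q = chain_mat N n A B L"
  define T where "T = channel_mat N n A A"
  have Q: "Q \<in> carrier_mat (n * n) (n * n)" and T: "T \<in> carrier_mat (n * n) (n * n)"
    by (simp_all add: Q_def T_def)
  have Q_pow: "chain_mat N n A B (m * L) = Q ^\<^sub>m m" for m
    unfolding Q_def by (rule chain_mat_power) (simp add: B_def per)
  have T_pow: "chain_mat N n A (\<lambda>_. A) M = T ^\<^sub>m M" for M
    using chain_mat_power[of "\<lambda>_. A" 1 N n A M] right_mult_one_mat[OF T] by (simp add: T_def)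
  have trace_Q: "mat_trace (chain_mat N n A B M) =
      (\<Sum>s\<in>configs N M. cnj (mat_trace (chain_word n (\<lambda>_. A) s)) * mat_trace (chain_word n B s))" for M
    by (rule mat_trace_chain_mat) (use A B in auto)
  have trace_T: "mat_trace (chain_mat N n A (\<lambda>_. A) M) =
      (\<Sum>s\<in>configs N M. cnj (mat_trace (chain_word n (\<lambda>_. A) s)) * mat_trace (chain_word n (\<lambda>_. A) s))" for M
    by (rule mat_trace_chain_mat) (use A in auto)
  \<comment> \<open>Overlap on the left, squared norm of the state on the right. The eigenphase
    depends on \<open>m\<close> in an unknown way, so only moduli can be compared.\<close>
  have norm_eq: "cmod (mat_trace (Q ^\<^sub>m m)) = cmod (mat_trace (T ^\<^sub>m (m * L)))" if m: "m > 0" for m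
  proof -
    let ?\<psi> = "periodic_mps n A" and ?C = "configs N (m * L)"
    obtain \<theta> where \<theta>: "\<And>s. s \<in> ?C \<Longrightarrow> apply_product_op N (map U [0..<m * L]) ?\<psi> s = cis \<theta> * ?\<psi> s"
      using eig[OF m] by (auto simp: is_eigenstate_def)
    have "mat_trace (Q ^\<^sub>m m) = (\<Sum>s\<in>?C. cnj (?\<psi> s) * apply_product_op N (map U [0..<m * L]) ?\<psi> s)"
      unfolding Q_pow[symmetric] trace_Q
      by (rule sum.cong) (simp_all add: periodic_mps_chain_word[OF A] apply_product_op_periodic_mps[OF A] B_def[abs_def])
    also have "\<dots> = cis \<theta> * (\<Sum>s\<in>?C. cnj (?\<psi> s) * ?\<psi> s)"
      by (simp add: \<theta> sum_distrib_left mult.left_commute)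
    also have "(\<Sum>s\<in>?C. cnj (?\<psi> s) * ?\<psi> s) = mat_trace (T ^\<^sub>m (m * L))"
      unfolding T_pow[symmetric] trace_T
      by (rule sum.cong) (simp_all add: periodic_mps_chain_word[OF A])
    finally show ?thesis by (simp add: norm_mult)
  qed
  obtain f where f: "\<And>k. mat_trace (Q ^\<^sub>m k) = (\<Sum>i<n * n. f i ^ k)"
    "\<And>x. eigenvalue Q x \<longleftrightarrow> x \<in> f ` {..<n * n}"
    using mat_trace_pow[OF Q] by blast
  obtain e where e: "\<And>k. mat_trace (T ^\<^sub>m k) = (\<Sum>i<n * n. e i ^ k)"
    "\<And>x. eigenvalue T x \<longleftrightarrow> x \<in> e ` {..<n * n}"
    using mat_trace_pow[OF T] by blast
  have "\<exists>i<n * n. cmod (f i) \<ge> 1"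
  proof (rule ccontr)
    assume "\<not> ?thesis"
    then have small: "cmod (f i) < 1" if "i < n * n" for i using that by (meson not_le)
    \<comment> \<open>The limit of the squared norm: it counts the eigenvalue 1 of the transfer
      matrix with multiplicity, all other eigenvalues having modulus below 1. The identity matrix as
      fixed point makes the count positive, which contradicts the limit 0.\<close>
    define R where "R = (\<Sum>i<n * n. if e i = 1 then 1 else 0 :: complex)"
    have "(\<lambda>m. \<Sum>i<n * n. f i ^ m) \<longlonglongrightarrow> (\<Sum>i<n * n. 0)"
      by (intro tendsto_sum LIMSEQ_power_zero small) auto
    then have "(\<lambda>m. cmod (mat_trace (Q ^\<^sub>m m))) \<longlonglongrightarrow> 0"
      by (simp add: f(1) tendsto_norm_zero)
    then have lim0: "(\<lambda>m. cmod (mat_trace (T ^\<^sub>m (m * L)))) \<longlonglongrightarrow> 0"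
      \<comment> \<open>The eigenstate condition is available for \<open>m > 0\<close> only, so the
        two sequences are compared from index 1 on.\<close>
      by (rule Lim_transform_eventually) (intro eventually_sequentiallyI[of 1] norm_eq, simp)
    have "(\<lambda>m. (e i ^ L) ^ m) \<longlonglongrightarrow> (if e i = 1 then 1 else 0)" if "i < n * n" for i
    proof (cases "e i = 1")
      case False
      have "e i = 1 \<or> cmod (e i) < 1" using e(2)[of "e i"] that eigenvalue_channel_mat by (auto simp: T_def)
      then have "cmod (e i ^ L) < 1" using False L by (simp add: norm_power power_less_one_iff)
      then show ?thesis using False by (simp add: LIMSEQ_power_zero)
    qed simp
    then have "(\<lambda>m. \<Sum>i<n * n. (e i ^ L) ^ m) \<longlonglongrightarrow> R"
      unfolding R_def by (intro tendsto_sum) auto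
    then have "(\<lambda>m. mat_trace (T ^\<^sub>m (m * L))) \<longlonglongrightarrow> R"
      by (simp add: e(1) power_mult[symmetric] mult.commute)
    then have "(\<lambda>m. cmod (mat_trace (T ^\<^sub>m (m * L)))) \<longlonglongrightarrow> cmod R" by (rule tendsto_norm)
    then have "cmod R = 0" by (rule LIMSEQ_unique[OF _ lim0])
    then have "R = 0" by simp
    moreover have "R = of_nat (card {i. i < n * n \<and> e i = 1})"
      by (simp add: R_def sum.If_cases) (metis (no_types) Collect_conj_eq lessThan_def)
    moreover have "card {i. i < n * n \<and> e i = 1} > 0"
    proof -
      obtain i where "i < n * n" "e i = 1" using e(2)[of 1] eigenvalue_channel_mat_1 by (auto simp: T_def)
      then show ?thesis by (auto simp: card_gt_0_iff)
    qed
    ultimately show False by (metis of_nat_eq_0_iff less_irrefl)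
  qed
  then obtain i where i: "i < n * n" "cmod (f i) \<ge> 1" by blast
  then obtain v where v: "v \<in> carrier_vec (n * n)" "v \<noteq> 0\<^sub>v (n * n)" "Q *\<^sub>v v = f i \<cdot>\<^sub>v v"
    using f(2)[of "f i"] Q unfolding eigenvalue_def eigenvector_def by auto
  obtain Y where Y: "Y \<in> carrier_mat n n" "vectorize n Y = v" using vectorize_surj[OF v(1)] .
  have "vectorize n (chain_iterate N n A B Y L) = vectorize n (f i \<cdot>\<^sub>m Y)"
    using v(3) chain_mat_mult_vec[where A = A and B = B and M = L, OF A B Y(1)] Y by (simp add: Q_def vectorize_smult)
  then have "chain_iterate N n A B Y L = f i \<cdot>\<^sub>m Y"
    using Y chain_iterate_carrier[where A = A and B = B, OF A B Y(1)] by (intro vectorize_inject) auto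
  moreover have "Y \<noteq> 0\<^sub>m n n" using Y v vectorize_zero by auto
  ultimately show ?thesis using that[of Y "f i"] Y i B_def by (simp add: B_def[abs_def])
qed

lemma eigenstate_bond_unitaries:
  assumes U: "\<And>j. unitary_mat N (U j)" and per: "\<And>j. U (j + L) = U j" and L: "L > 0"
    and eig: "\<And>m. m > 0 \<Longrightarrow> is_eigenstate N (map U [0..<m * L]) (periodic_mps n A)"
  obtains v l where "\<And>j. unitary_mat n (v j)" "cmod l = 1" "\<And>j. v (j + L) = l \<cdot>\<^sub>m v j"
    "\<And>j s. s < N \<Longrightarrow> phys_act N n (U j) A s = mat_adjoint (v j) * A s * v (Suc j)"
proof -
  obtain l Y where Y: "Y \<in> carrier_mat n n" "Y \<noteq> 0\<^sub>m n n" "cmod l \<ge> 1"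
    "chain_iterate N n A (\<lambda>j. phys_act N n (U j) A) Y L = l \<cdot>\<^sub>m Y"
    using eigenstate_mixed_eigenvector[OF U per L eig] by blast
  obtain v where "\<And>j. unitary_mat n (v j)" "cmod l = 1" "\<And>j. v (j + L) = l \<cdot>\<^sub>m v j"
    "\<And>j s. s < N \<Longrightarrow> phys_act N n (U j) A s = mat_adjoint (v j) * A s * v (Suc j)"
    by (rule mixed_eigenvector_unitary[where U = U, OF U per L, where Y = "chain_iterate N n A (\<lambda>j. phys_act N n (U j) A) Y" and l = l])
      (use Y in auto)
  then show ?thesis by (rule that)
qed

section \<open>Virtual symmetries\<close>

text \<open>The relation is closed under componentwise products and inverses, so bond equations can
  be multiplied, raised to integer powers and combined into commutators. The phase \<open>c\<close>
  is an explicit component because in commutators it has to cancel exactly, not merely up to a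
  phase.\<close>

definition intertwined :: "complex mat \<Rightarrow> complex \<Rightarrow> complex mat \<Rightarrow> complex mat \<Rightarrow> bool" where
  "intertwined U c v w \<longleftrightarrow> unitary_mat N U \<and> cmod c = 1 \<and> unitary_mat n v \<and> unitary_mat n w \<and>
     (\<forall>s<N. phys_act N n U A s = c \<cdot>\<^sub>m (mat_adjoint v * A s * w))"

lemma intertwined_one: "intertwined (1\<^sub>m N) 1 (1\<^sub>m n) (1\<^sub>m n)"
  using tensor_carrier by (auto simp: intertwined_def unitary_mat_one phys_act_one
      left_mult_one_mat[of _ n n] right_mult_one_mat[of _ n n])

text \<open>Physical and bond actions commute, so \<open>U\<close> acting on the equation for
  \<open>U'\<close> inserts \<open>mat_adjoint v\<close> and \<open>w\<close> next to
  \<open>A s\<close>. Bond factors therefore multiply in the same order as the physical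
  ones.\<close>

lemma intertwined_mult:
  assumes 1: "intertwined U c v w" and 2: "intertwined U' c' v' w'"
  shows "intertwined (U * U') (c * c') (v * v') (w * w')"
proof -
  note A = tensor_carrier
  have v: "v \<in> carrier_mat n n" "w \<in> carrier_mat n n" "v' \<in> carrier_mat n n" "w' \<in> carrier_mat n n"
    and U: "U \<in> carrier_mat N N" "U' \<in> carrier_mat N N"
    using 1 2 by (auto simp: intertwined_def unitary_mat_def)
  have "phys_act N n (U * U') A s = (c * c') \<cdot>\<^sub>m (mat_adjoint (v * v') * A s * (w * w'))" if s: "s < N" for s
  proof -
    have "phys_act N n (U * U') A s = phys_act N n U (\<lambda>t. c' \<cdot>\<^sub>m (mat_adjoint v' * A t * w')) s"
      using 2 by (subst phys_act_mult[OF A U s]) (auto simp: intertwined_def intro!: phys_act_cong)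
    also have "\<dots> = c' \<cdot>\<^sub>m (mat_adjoint v' * phys_act N n U A s * w')"
      using A v by (subst phys_act_smult_tensor) (simp_all add: phys_act_sandwich)
    also have "\<dots> = (c * c') \<cdot>\<^sub>m (mat_adjoint (v * v') * A s * (w * w'))"
      using 1 s A[OF s] v by (simp add: intertwined_def mult_smult_distrib[of _ n n _ n] mult_smult_assoc_mat[of _ n n _ n]
        smult_smult_mat mat_adjoint_mult[of _ n n _ n] assoc_mult_mat[of _ n n _ n _ n] mult.commute)
    finally show ?thesis .
  qed
  then show ?thesis using 1 2 by (auto simp: intertwined_def unitary_mat_mult norm_mult)
qed

lemma intertwined_adjoint:
  assumes 1: "intertwined U c v w"
  shows "intertwined (mat_adjoint U) (inverse c) (mat_adjoint v) (mat_adjoint w)"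
proof -
  note A = tensor_carrier
  have v: "unitary_mat n v" "unitary_mat n w" "unitary_mat N U" using 1 by (auto simp: intertwined_def)
  note vc = unitary_matD[OF v(1)] unitary_matD[OF v(2)] unitary_matD[OF v(3)]
  have c: "c \<noteq> 0" using 1 by (auto simp: intertwined_def)
  have "phys_act N n (mat_adjoint U) A s = inverse c \<cdot>\<^sub>m (mat_adjoint (mat_adjoint v) * A s * mat_adjoint w)" if s: "s < N" for s
  proof -
    let ?V = "mat_adjoint U"
    have "A s = phys_act N n (?V * U) A s" using vc by (simp add: phys_act_one[OF A s])
    also have "\<dots> = phys_act N n ?V (\<lambda>t. c \<cdot>\<^sub>m (mat_adjoint v * A t * w)) s"
      using 1 vc by (subst phys_act_mult[OF A _ _ s]) (auto simp: intertwined_def intro!: phys_act_cong)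
    also have "\<dots> = c \<cdot>\<^sub>m (mat_adjoint v * phys_act N n ?V A s * w)"
      using A vc by (subst phys_act_smult_tensor) (simp_all add: phys_act_sandwich)
    finally have "v * A s * mat_adjoint w = c \<cdot>\<^sub>m (v * (mat_adjoint v * phys_act N n ?V A s * w) * mat_adjoint w)"
      using vc by (simp add: mult_smult_distrib[of _ n n _ n] mult_smult_assoc_mat[of _ n n _ n])
    also have "v * (mat_adjoint v * phys_act N n ?V A s * w) * mat_adjoint w = phys_act N n ?V A s"
    proof -
      have "v * (mat_adjoint v * phys_act N n ?V A s * w) = phys_act N n ?V A s * w"
        using vc mult_adjoint_cancel(1)[OF v(1), of "phys_act N n ?V A s * w"]
        by (simp add: assoc_mult_mat[of _ n n _ n _ n])
      then show ?thesis using mult_adjoint_cancel(3)[OF v(2)] by simp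
    qed
    finally show ?thesis using c by (simp add: smult_smult_mat)
  qed
  then show ?thesis using 1 by (auto simp: intertwined_def unitary_mat_adjoint norm_inverse)
qed

lemma intertwined_powi:
  assumes 1: "intertwined U c v w"
  obtains d where "intertwined (mat_powi U k) d (mat_powi v k) (mat_powi w k)"
proof -
  have u: "unitary_mat N U" "unitary_mat n v" "unitary_mat n w" using 1 by (auto simp: intertwined_def)
  have "\<exists>d. intertwined (mat_powi U k) d (mat_powi v k) (mat_powi w k)"
  proof (induction k rule: int_induct[of _ 0])
    case base
    show ?case using intertwined_one u by auto
  next
    case (step1 i)
    then obtain d where "intertwined (mat_powi U i) d (mat_powi v i) (mat_powi w i)" by blast
    from intertwined_mult[OF this 1] show ?case using u by (auto simp: mat_powi_add)
  next
    case (step2 i)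
    then obtain d where "intertwined (mat_powi U i) d (mat_powi v i) (mat_powi w i)" by blast
    from intertwined_mult[OF this intertwined_adjoint[OF 1]] show ?case using u
      mat_powi_add[of N U i "- 1"] mat_powi_add[of n v i "- 1"] mat_powi_add[of n w i "- 1"]
      by (auto simp: mat_powi_minus)
  qed
  then show ?thesis using that by blast
qed

text \<open>A trivial physical operator turns the equation into
  \<open>v * A s = c \<cdot>\<^sub>m (A s * w)\<close>. Multiplying by the adjoint of
  \<open>A s\<close> and summing leaves \<open>w\<close> by left-canonicity. This supplies the step
  hypothesis of \<open>periodic_chain_scalar\<close>.\<close>

lemma intertwined_one_channel:
  assumes "intertwined (1\<^sub>m N) c v w"
  shows "E v = c \<cdot>\<^sub>m w"
proof -
  note A = tensor_carrier
  have u: "unitary_mat n v" "unitary_mat n w" using assms by (auto simp: intertwined_def)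
  note uc = unitary_matD[OF u(1)] unitary_matD[OF u(2)]
  have "v * A s = c \<cdot>\<^sub>m (A s * w)" if s: "s < N" for s
  proof -
    have "A s = c \<cdot>\<^sub>m (mat_adjoint v * A s * w)"
      using assms s phys_act_one[OF A s] by (auto simp: intertwined_def)
    then have "v * A s = v * (c \<cdot>\<^sub>m (mat_adjoint v * A s * w))" by simp
    also have "\<dots> = c \<cdot>\<^sub>m (v * (mat_adjoint v * (A s * w)))"
      using uc A[OF s] by (simp add: mult_smult_distrib[of _ n n _ n] assoc_mult_mat[of _ n n _ n _ n])
    also have "\<dots> = c \<cdot>\<^sub>m (A s * w)" using uc A[OF s] by (simp add: mult_adjoint_cancel(1)[OF u(1)])
    finally show ?thesis .
  qed
  then have "mat_adjoint (A s) * v * A s = c \<cdot>\<^sub>m (mat_adjoint (A s) * 1\<^sub>m n * A s * w)" if "s < N" for s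
    using that A[OF that] uc by (simp add: assoc_mult_mat[of _ n n _ n _ n] mult_smult_distrib[of _ n n _ n] right_mult_one_mat[of _ n n])
  then have "E v = mat_sum n (\<lambda>s. c \<cdot>\<^sub>m (mat_adjoint (A s) * 1\<^sub>m n * A s * w)) {..<N}"
    unfolding transfer_channel_def by simp
  also have "\<dots> = c \<cdot>\<^sub>m (E (1\<^sub>m n) * w)"
    unfolding transfer_channel_def using A uc by (simp add: mat_sum_mult smult_mat_sum)
  finally show ?thesis using uc by (simp add: E_one)
qed

lemma intertwined_smult_op:
  assumes "intertwined (d \<cdot>\<^sub>m U) c v w" "unitary_mat N U" "cmod d = 1"
  shows "intertwined U (c / d) v w"
proof -
  have "d \<noteq> 0" using assms(3) by auto
  have "phys_act N n U A s = (c / d) \<cdot>\<^sub>m (mat_adjoint v * A s * w)" if s: "s < N" for s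
  proof -
    have "d \<cdot>\<^sub>m phys_act N n U A s = c \<cdot>\<^sub>m (mat_adjoint v * A s * w)"
      using assms s phys_act_smult_op[where A = A and c = d, OF tensor_carrier unitary_matD(1)[OF assms(2)] s]
      by (simp add: intertwined_def)
    then have "(1 / d) \<cdot>\<^sub>m (d \<cdot>\<^sub>m phys_act N n U A s) = (1 / d) \<cdot>\<^sub>m (c \<cdot>\<^sub>m (mat_adjoint v * A s * w))" by simp
    then show ?thesis using \<open>d \<noteq> 0\<close> by (simp add: smult_smult_mat)
  qed
  then show ?thesis using assms by (auto simp: intertwined_def norm_divide)
qed

end

section \<open>Commutation up to a phase\<close>

lemma mat_powi_one [simp]: "mat_powi (1\<^sub>m n) k = 1\<^sub>m n"
  using mat_powi_mult[OF unitary_mat_one, of n 0 k] by (simp add: mat_powi_0[OF unitary_mat_one])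

lemma mat_powi_cong:
  assumes S: "unitary_mat n S" "mat_powi S (int N) = 1\<^sub>m n" and kl: "[k = l] (mod int N)"
  shows "mat_powi S k = mat_powi S l"
proof -
  obtain q where q: "k = l + int N * q" using kl by (metis cong_iff_lin cong_sym)
  have "mat_powi S k = mat_powi S l * mat_powi (mat_powi S (int N)) q"
    unfolding q by (simp add: mat_powi_add[OF S(1)] mat_powi_mult[OF S(1)])
  then show ?thesis
    using unitary_matD(1)[OF unitary_mat_powi[OF S(1)]] by (simp add: S(2) right_mult_one_mat[of _ n n])
qed

lemma unitary_scalar_norm:
  assumes "unitary_mat n (c \<cdot>\<^sub>m 1\<^sub>m n)" "n > 0"
  shows "cmod c = 1"
proof -
  have "(c * cnj c) \<cdot>\<^sub>m 1\<^sub>m n = (1\<^sub>m n :: complex mat)"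
    using unitary_matD(3)[OF assms(1)] by (simp add: smult_mult_smult[of _ n n _ n])
  then have "((c * cnj c) \<cdot>\<^sub>m 1\<^sub>m n :: complex mat) $$ (0, 0) = 1\<^sub>m n $$ (0, 0)" by simp
  then have "c * cnj c = 1" using assms(2) by simp
  then have "complex_of_real ((cmod c)\<^sup>2) = 1" by (simp only: complex_norm_square)
  then have "(cmod c)\<^sup>2 = 1" by (simp only: of_real_eq_1_iff)
  then show ?thesis by (simp add: power2_eq_1_iff) (smt (verit) norm_ge_zero)
qed

lemma phase_commute_swap:
  fixes x z :: "complex mat"
  assumes "z * x = c \<cdot>\<^sub>m (x * z)" "c \<noteq> 0"
  shows "x * z = inverse c \<cdot>\<^sub>m (z * x)"
  using assms by (simp add: smult_smult_mat)

lemma phase_commute_powi_right: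
  assumes x: "unitary_mat n x" and z: "unitary_mat n z" and c: "c \<noteq> 0"
    and zx: "z * x = c \<cdot>\<^sub>m (x * z)"
  shows "z * mat_powi x q = (c powi q) \<cdot>\<^sub>m (mat_powi x q * z)"
proof -
  note u = unitary_matD[OF x] unitary_matD[OF z]
  note assoc = assoc_mult_mat[of _ n n _ n _ n]
  note dist = mult_smult_distrib[of _ n n _ n] mult_smult_assoc_mat[of _ n n _ n]
  have p: "mat_powi x k \<in> carrier_mat n n" for k
    using unitary_mat_powi[OF x] by (simp add: unitary_mat_def)
  have zx': "z * mat_adjoint x = inverse c \<cdot>\<^sub>m (mat_adjoint x * z)"
  proof -
    have "mat_adjoint x * z = mat_adjoint x * (z * x) * mat_adjoint x"
      using u mult_adjoint_cancel(3)[OF x, of "mat_adjoint x * z"] by (simp add: assoc)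
    also have "\<dots> = c \<cdot>\<^sub>m (z * mat_adjoint x)"
      unfolding zx using u mult_adjoint_cancel(2)[OF x, of z] by (simp add: dist)
    finally show ?thesis using c by (simp add: smult_smult_mat)
  qed
  show ?thesis
  proof (induction q rule: int_induct[of _ 0])
    case base
    show ?case using u x by (simp add: left_mult_one_mat[of _ n n] right_mult_one_mat[of _ n n])
  next
    case (step1 i)
    have "z * mat_powi x (i + 1) = (z * mat_powi x i) * x"
      using x u p by (simp add: mat_powi_add assoc)
    also have "\<dots> = (c powi i) \<cdot>\<^sub>m (mat_powi x i * (z * x))"
      unfolding step1 using u p by (simp add: dist assoc)
    also have "\<dots> = (c powi (i + 1)) \<cdot>\<^sub>m (mat_powi x (i + 1) * z)"
      unfolding zx using u p c x by (simp add: dist assoc smult_smult_mat power_int_add mat_powi_add)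
    finally show ?case .
  next
    case (step2 i)
    have e: "mat_powi x (i - 1) = mat_powi x i * mat_adjoint x"
      using mat_powi_add[OF x, of i "- 1"] mat_powi_minus[OF x, of 1] x by simp
    have "z * mat_powi x (i - 1) = (z * mat_powi x i) * mat_adjoint x"
      using u p by (simp add: e assoc)
    also have "\<dots> = (c powi i) \<cdot>\<^sub>m (mat_powi x i * (z * mat_adjoint x))"
      unfolding step2 using u p by (simp add: dist assoc)
    also have "\<dots> = (c powi (i - 1)) \<cdot>\<^sub>m (mat_powi x (i - 1) * z)"
      unfolding zx' using u p c by (simp add: dist assoc smult_smult_mat power_int_diff divide_inverse e)
    finally show ?case .
  qed
qed

text \<open>The one-sided rule is applied twice, for \<open>x\<close> and then for \<open>z\<close>;
  the swap in between exchanges the roles of the factors and inverts the phase.\<close>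

lemma phase_commute_powi:
  assumes x: "unitary_mat n x" and z: "unitary_mat n z" and c: "c \<noteq> 0"
    and zx: "z * x = c \<cdot>\<^sub>m (x * z)"
  shows "mat_powi z p * mat_powi x q = (c powi (p * q)) \<cdot>\<^sub>m (mat_powi x q * mat_powi z p)"
proof -
  let ?d = "inverse (c powi q)"
  have d: "?d \<noteq> 0" using c by simp
  have "z * mat_powi x q = (c powi q) \<cdot>\<^sub>m (mat_powi x q * z)"
    by (rule phase_commute_powi_right[OF x z c zx])
  then have "mat_powi x q * z = ?d \<cdot>\<^sub>m (z * mat_powi x q)"
    using c by (intro phase_commute_swap) auto
  then have "mat_powi x q * mat_powi z p = (?d powi p) \<cdot>\<^sub>m (mat_powi z p * mat_powi x q)"
    by (intro phase_commute_powi_right[OF z unitary_mat_powi[OF x] d])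
  then have "mat_powi z p * mat_powi x q = inverse (?d powi p) \<cdot>\<^sub>m (mat_powi x q * mat_powi z p)"
    using d by (intro phase_commute_swap) auto
  also have "inverse (?d powi p) = c powi (p * q)"
    by (simp add: power_int_inverse power_int_mult mult.commute[of p])
  finally show ?thesis .
qed

lemma commutator_eq_iff:
  assumes x: "unitary_mat n x" and z: "unitary_mat n z"
  shows "z * x * mat_adjoint z * mat_adjoint x = c \<cdot>\<^sub>m 1\<^sub>m n \<longleftrightarrow> z * x = c \<cdot>\<^sub>m (x * z)"
proof
  note u = unitary_matD[OF x] unitary_matD[OF z]
  note assoc = assoc_mult_mat[of _ n n _ n _ n]
  note dist = mult_smult_distrib[of _ n n _ n] mult_smult_assoc_mat[of _ n n _ n]
  {
    assume "z * x * mat_adjoint z * mat_adjoint x = c \<cdot>\<^sub>m 1\<^sub>m n"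
    then have "z * x * mat_adjoint z * mat_adjoint x * x * z = (c \<cdot>\<^sub>m 1\<^sub>m n) * x * z" by simp
    moreover have "z * x * mat_adjoint z * mat_adjoint x * x * z = z * x"
      using u mult_adjoint_cancel(4)[OF x, of "z * x * mat_adjoint z"] mult_adjoint_cancel(4)[OF z, of "z * x"] by simp
    ultimately show "z * x = c \<cdot>\<^sub>m (x * z)" using u by (simp add: dist left_mult_one_mat[of _ n n])
  }
  assume "z * x = c \<cdot>\<^sub>m (x * z)"
  then show "z * x * mat_adjoint z * mat_adjoint x = c \<cdot>\<^sub>m 1\<^sub>m n"
    using u mult_adjoint_cancel(3)[OF z, of x] by (simp add: dist)
qed

section \<open>Bond unitaries of modulated symmetries: powers and commutators\<close>

context injective_tensor
begin

lemma intertwinedD: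
  assumes "intertwined U c v w"
  shows "unitary_mat N U" "cmod c = 1" "unitary_mat n v" "unitary_mat n w"
  using assms by (auto simp: intertwined_def)

lemma intertwined_phase_right:
  assumes "intertwined U c v w" "w' = d \<cdot>\<^sub>m w" "cmod d = 1"
  shows "intertwined U (c / d) v w'"
proof -
  have d: "d \<noteq> 0" using assms(3) by auto
  have "phys_act N n U A s = (c / d) \<cdot>\<^sub>m (mat_adjoint v * A s * (d \<cdot>\<^sub>m w))" if s: "s < N" for s
    using assms(1) d tensor_carrier[OF s] s unitary_matD[OF intertwinedD(3)[OF assms(1)]] unitary_matD[OF intertwinedD(4)[OF assms(1)]]
    by (simp add: intertwined_def mult_smult_distrib[of _ n n _ n] smult_smult_mat)
  then show ?thesis using assms
    by (auto simp: intertwined_def norm_divide unitary_mat_smult)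
qed

text \<open>
  Raising the bond equation at site \<open>j\<close> to the power \<open>a\<close> and comparing it with the one at site
  \<open>j + 1\<close> gives a periodic chain to which \<open>periodic_chain_scalar\<close> applies, so that
  \<open>v (j + 1)\<close> is proportional to the \<open>a\<close>-th power of \<open>v j\<close>.
\<close>
lemma modulated_symmetry_bond_unitary:
  fixes a :: int
  assumes S: "unitary_mat N S" and SN: "mat_powi S (int N) = 1\<^sub>m N"
    and aL: "[a ^ L = 1] (mod int N)" and L: "L > 0"
    and eig: "\<And>m. m > 0 \<Longrightarrow> is_eigenstate N (map (\<lambda>j. mat_powi S (a ^ j)) [0..<m * L]) (periodic_mps n A)"
  obtains v c m where "intertwined S c v (mat_powi v a)" "cmod m = 1" "mat_powi v (a ^ L) = m \<cdot>\<^sub>m v"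
proof -
  define U where "U j = mat_powi S (a ^ j)" for j
  have U: "unitary_mat N (U j)" for j by (simp add: U_def unitary_mat_powi S)
  have per: "U (j + L) = U j" for j
  proof -
    have "[a ^ (j + L) = a ^ j] (mod int N)"
      using cong_mult[OF cong_refl aL, of "a ^ j"] by (simp add: power_add)
    then show ?thesis unfolding U_def by (rule mat_powi_cong[OF S SN])
  qed
  obtain v l where v: "\<And>j. unitary_mat n (v j)" "cmod l = 1" "\<And>j. v (j + L) = l \<cdot>\<^sub>m v j"
    "\<And>j s. s < N \<Longrightarrow> phys_act N n (U j) A s = mat_adjoint (v j) * A s * v (Suc j)"
    by (rule eigenstate_bond_unitaries[where U = U, OF U per L]) (use eig in \<open>auto simp: U_def[abs_def]\<close>)
  have iv: "intertwined (U j) 1 (v j) (v (Suc j))" for j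
    using v U by (auto simp: intertwined_def)
  define g where "g j = mat_powi (v j) a * mat_adjoint (v (Suc j))" for j
  have gu: "unitary_mat n (g j)" for j
    unfolding g_def by (intro unitary_mat_mult unitary_mat_powi unitary_mat_adjoint v)
  have step: "\<exists>d. cmod d = 1 \<and> E (g j) = d \<cdot>\<^sub>m g (Suc j)" for j
  proof -
    obtain d where d: "intertwined (mat_powi (U j) a) d (mat_powi (v j) a) (mat_powi (v (Suc j)) a)"
      using intertwined_powi[OF iv] .
    have "mat_powi (U j) a = U (Suc j)"
      using mat_powi_mult[OF S, of "a ^ j" a] by (simp add: U_def mult.commute)
    then have "intertwined (U (Suc j) * mat_adjoint (U (Suc j))) (d * inverse 1) (g j) (g (Suc j))"
      using intertwined_mult[OF d intertwined_adjoint[OF iv[of "Suc j"]]] by (simp add: g_def)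
    then have "intertwined (1\<^sub>m N) d (g j) (g (Suc j))" using unitary_matD(3)[OF U] by simp
    then show ?thesis using intertwined_one_channel intertwinedD(2) by blast
  qed
  \<comment> \<open>The closing phase combines \<open>l powi a\<close> from the power with
    \<open>cnj l\<close> from the adjoint.\<close>
  have gL: "g (j + L) = (l powi a * cnj l) \<cdot>\<^sub>m g j" for j
    using v(3)[of j] v(3)[of "Suc j"] unitary_matD(1)[OF unitary_mat_powi[OF v(1)]] unitary_matD(2)[OF v(1)]
    by (simp add: g_def mat_powi_smult[OF v(1,2)] smult_mult_smult[of _ n n _ n])
  have v_pow: "\<exists>d. cmod d = 1 \<and> mat_powi (v j) a = d \<cdot>\<^sub>m v (Suc j)" for j
  proof -
    \<comment> \<open>\<open>periodic_chain_scalar\<close> speaks of index 0 only; starting the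
      chain at \<open>j\<close> transfers it to every bond.\<close>
    obtain d where d: "g j = d \<cdot>\<^sub>m 1\<^sub>m n"
    proof (rule periodic_chain_scalar[of "\<lambda>i. g (j + i)" L "l powi a * cnj l"])
      show "g (j + 0) \<in> carrier_mat n n" using gu by (simp add: unitary_mat_def)
      show "g (j + L) = (l powi a * cnj l) \<cdot>\<^sub>m g (j + 0)" by (simp add: gL)
      show "cmod (l powi a * cnj l) = 1" using v(2) by (simp add: norm_mult norm_power_int)
    qed (use step L in auto)
    have "mat_powi (v j) a = g j * v (Suc j)"
      unfolding g_def using unitary_matD(1)[OF unitary_mat_powi[OF v(1)]] by (simp add: mult_adjoint_cancel(4)[OF v(1)])
    also have "\<dots> = d \<cdot>\<^sub>m v (Suc j)"
      unfolding d using unitary_matD(1)[OF v(1)]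
      by (simp add: mult_smult_assoc_mat[of _ n n _ n] left_mult_one_mat[of _ n n])
    finally show ?thesis using unitary_scalar_norm[of n d] gu[of j] d bond_dim_pos by auto
  qed
  have v_pow0: "\<exists>d. cmod d = 1 \<and> mat_powi (v 0) (a ^ j) = d \<cdot>\<^sub>m v j" for j
  proof (induction j)
    case 0
    show ?case by (auto intro!: exI[of _ 1] simp: mat_powi_1[OF v(1)])
  next
    case (Suc j)
    obtain d where d: "cmod d = 1" "mat_powi (v 0) (a ^ j) = d \<cdot>\<^sub>m v j" using Suc by blast
    obtain d' where d': "cmod d' = 1" "mat_powi (v j) a = d' \<cdot>\<^sub>m v (Suc j)" using v_pow by blast
    have "mat_powi (v 0) (a ^ Suc j) = mat_powi (mat_powi (v 0) (a ^ j)) a"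
      using mat_powi_mult[OF v(1), of 0 "a ^ j" a] by (simp add: mult.commute)
    also have "\<dots> = (d powi a * d') \<cdot>\<^sub>m v (Suc j)"
      by (simp add: d(2) mat_powi_smult[OF v(1) d(1)] d'(2) smult_smult_mat)
    finally show ?case using d d' by (intro exI[of _ "d powi a * d'"]) (simp add: norm_mult norm_power_int)
  qed
  obtain d1 where d1: "cmod d1 = 1" "mat_powi (v 0) a = d1 \<cdot>\<^sub>m v 1" using v_pow0[of 1] by auto
  obtain dL where dL: "cmod dL = 1" "mat_powi (v 0) (a ^ L) = dL \<cdot>\<^sub>m v L" using v_pow0 by blast
  show ?thesis
  proof (rule that)
    \<comment> \<open>The whole chain collapses to the single unitary \<open>v 0\<close>: the right
      bond \<open>v 1\<close> is replaced by \<open>mat_powi (v 0) a\<close> at the price of the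
      phase \<open>d1\<close>.\<close>
    have "U 0 = S" using S by (simp add: U_def)
    then show "intertwined S (1 / d1) (v 0) (mat_powi (v 0) a)"
      using intertwined_phase_right[OF iv[of 0]] d1 by simp
    show "cmod (dL * l) = 1" using dL v(2) by (simp add: norm_mult)
    show "mat_powi (v 0) (a ^ L) = (dL * l) \<cdot>\<^sub>m v 0" using dL v(3)[of 0] by (simp add: smult_smult_mat)
  qed
qed

text \<open>The powers of \<open>v\<close> with exponents \<open>p * a ^ j\<close> all accompany the
  trivial operator, since \<open>S\<close> to the \<open>p\<close> is the identity. So they form a
  chain for \<open>periodic_chain_scalar\<close>, closed because the \<open>a ^ L\<close>-th power
  of \<open>v\<close> is a multiple of \<open>v\<close>.\<close>

lemma bond_unitary_power_scalar:
  fixes a :: int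
  assumes iS: "intertwined S c v (mat_powi v a)" and L: "L > 0"
    and vL: "mat_powi v (a ^ L) = m \<cdot>\<^sub>m v" and m: "cmod m = 1"
    and Sp: "mat_powi S p = 1\<^sub>m N"
  obtains d where "mat_powi v p = d \<cdot>\<^sub>m 1\<^sub>m n"
proof -
  note v = intertwinedD(3)[OF iS] and S = intertwinedD(1)[OF iS]
  define g where "g j = mat_powi v (p * a ^ j)" for j
  show ?thesis
  proof (rule periodic_chain_scalar[of g L "m powi p"])
    show "g 0 \<in> carrier_mat n n" using unitary_mat_powi[OF v] by (simp add: g_def unitary_mat_def)
    have "g L = mat_powi (mat_powi v (a ^ L)) p"
      using mat_powi_mult[OF v, of "a ^ L" p] by (simp add: g_def mult.commute)
    then show "g L = (m powi p) \<cdot>\<^sub>m g 0" using vL mat_powi_smult[OF v m] by (simp add: g_def)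
    show "cmod (m powi p) = 1" using m by (simp add: norm_power_int)
    show "\<exists>d. cmod d = 1 \<and> E (g j) = d \<cdot>\<^sub>m g (Suc j)" for j
    proof -
      obtain d where "intertwined (mat_powi S (p * a ^ j)) d (mat_powi v (p * a ^ j)) (mat_powi (mat_powi v a) (p * a ^ j))"
        using intertwined_powi[OF iS] .
      moreover have "mat_powi S (p * a ^ j) = 1\<^sub>m N" using mat_powi_mult[OF S] Sp by simp
      moreover have "mat_powi (mat_powi v a) (p * a ^ j) = g (Suc j)"
        using mat_powi_mult[OF v, of a "p * a ^ j"] by (simp add: g_def mult_ac)
      ultimately have "intertwined (1\<^sub>m N) d (g j) (g (Suc j))" by (simp add: g_def)
      then show ?thesis using intertwined_one_channel intertwinedD(2) by blast
    qed
    show ?thesis if "g 0 = d \<cdot>\<^sub>m 1\<^sub>m n" for d using that by (intro \<open>\<And>d. mat_powi v p = d \<cdot>\<^sub>m 1\<^sub>m n \<Longrightarrow> thesis\<close>) (simp add: g_def)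
  qed (rule L)
qed

text \<open>The commutator of the physical operators at position \<open>j\<close> is the scalar
  \<open>k powi (b ^ j * a ^ j)\<close>, which becomes the phase in a chain of bond commutators.
  Hence the first of them is a scalar \<open>z\<close>, the second is \<open>z powi (b * a)\<close>,
  and the step from position 0 to 1 relates them by \<open>k\<close>.\<close>

lemma bond_unitary_commutator:
  fixes a b :: int
  assumes iS: "intertwined S c v (mat_powi v a)" and vL: "mat_powi v (a ^ L) = m \<cdot>\<^sub>m v" and m: "cmod m = 1"
    and iT: "intertwined T d w (mat_powi w b)" and wL: "mat_powi w (b ^ L) = l \<cdot>\<^sub>m w" and l: "cmod l = 1"
    and TS: "T * S = k \<cdot>\<^sub>m (S * T)" and k: "cmod k = 1" and L: "L > 0"
  obtains z where "w * v = z \<cdot>\<^sub>m (v * w)" "cmod z = 1" "z powi (a * b - 1) = k"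
proof -
  note v = intertwinedD(3)[OF iS] and S = intertwinedD(1)[OF iS]
  note w = intertwinedD(3)[OF iT] and T = intertwinedD(1)[OF iT]
  define K where "K z x = z * x * mat_adjoint z * mat_adjoint x" for z x :: "complex mat"
  have Ku: "unitary_mat n (K z x)" if "unitary_mat n z" "unitary_mat n x" for z x
    unfolding K_def using that by (intro unitary_mat_mult unitary_mat_adjoint)
  define g where "g j = K (mat_powi w (b ^ j)) (mat_powi v (a ^ j))" for j
  have k0: "k \<noteq> 0" using k by auto
  have step: "E (g j) = (1 / k powi (b ^ j * a ^ j)) \<cdot>\<^sub>m g (Suc j)" for j
  proof -
    let ?S = "mat_powi S (a ^ j)" and ?T = "mat_powi T (b ^ j)"
    obtain c' where c': "intertwined ?S c' (mat_powi v (a ^ j)) (mat_powi (mat_powi v a) (a ^ j))"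
      using intertwined_powi[OF iS] .
    obtain d' where d': "intertwined ?T d' (mat_powi w (b ^ j)) (mat_powi (mat_powi w b) (b ^ j))"
      using intertwined_powi[OF iT] .
    have "intertwined (?T * ?S * mat_adjoint ?T * mat_adjoint ?S) (d' * c' * inverse d' * inverse c') (g j) (g (Suc j))"
      using intertwined_mult[OF intertwined_mult[OF intertwined_mult[OF d' c'] intertwined_adjoint[OF d']] intertwined_adjoint[OF c']]
        mat_powi_mult[OF v, of a "a ^ j"] mat_powi_mult[OF w, of b "b ^ j"]
      by (simp add: g_def K_def)
    \<comment> \<open>The phases of the powered bond equations are unknown, but each enters together
      with its inverse. This is why the exact value \<open>k\<close> survives in the final
      relation.\<close>
    moreover have "d' * c' * inverse d' * inverse c' = 1"
      using intertwinedD(2)[OF c'] intertwinedD(2)[OF d'] by (auto simp: field_simps)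
    moreover have "?T * ?S * mat_adjoint ?T * mat_adjoint ?S = (k powi (b ^ j * a ^ j)) \<cdot>\<^sub>m 1\<^sub>m N"
      using phase_commute_powi[OF S T k0 TS, of "b ^ j" "a ^ j"]
      by (subst commutator_eq_iff[OF unitary_mat_powi[OF S] unitary_mat_powi[OF T]])
    ultimately have "intertwined (1\<^sub>m N) (1 / k powi (b ^ j * a ^ j)) (g j) (g (Suc j))"
      using intertwined_smult_op[OF _ unitary_mat_one] k by (simp add: norm_power_int)
    then show ?thesis by (rule intertwined_one_channel)
  qed
  \<comment> \<open>Rescaling either argument by a phase leaves a commutator unchanged, so this
    chain closes exactly.\<close>
  have gL: "g L = 1 \<cdot>\<^sub>m g 0"
  proof -
    have "l * m * cnj l * cnj m = (l * cnj l) * (m * cnj m)" by simp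
    also have "\<dots> = 1" using l m by (simp only: complex_norm_square[symmetric]) simp
    finally show ?thesis
      using unitary_matD[OF v] unitary_matD[OF w] v w
      by (simp add: g_def K_def vL wL smult_mult_smult[of _ n n _ n])
  qed
  have g0: "g 0 = K w v" using v w by (simp add: g_def)
  obtain z where z: "g 0 = z \<cdot>\<^sub>m 1\<^sub>m n"
  proof (rule periodic_chain_scalar[of g L 1])
    show "g 0 \<in> carrier_mat n n" using Ku[OF w v] by (simp add: g0 unitary_mat_def)
    show "\<exists>c. cmod c = 1 \<and> E (g j) = c \<cdot>\<^sub>m g (Suc j)" for j
      using step[of j] k by (intro exI[of _ "1 / k powi (b ^ j * a ^ j)"]) (simp add: norm_divide norm_power_int)
  qed (use L gL in auto)
  have wv: "w * v = z \<cdot>\<^sub>m (v * w)"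
    using commutator_eq_iff[OF v w] z by (simp add: g0 K_def)
  have zn: "cmod z = 1" using unitary_scalar_norm[of n z] Ku[OF w v] z bond_dim_pos by (simp add: g0)
  then have z0: "z \<noteq> 0" by auto
  have "g 1 = (z powi (b * a)) \<cdot>\<^sub>m 1\<^sub>m n"
    unfolding g_def K_def power_one_right
    by (rule iffD2[OF commutator_eq_iff[OF unitary_mat_powi[OF v] unitary_mat_powi[OF w]] phase_commute_powi[OF v w z0 wv]])
  moreover have "E (g 0) = z \<cdot>\<^sub>m 1\<^sub>m n" by (simp add: z E_smult E_one)
  ultimately have "z \<cdot>\<^sub>m 1\<^sub>m n = (1 / k * z powi (b * a)) \<cdot>\<^sub>m (1\<^sub>m n :: complex mat)"
    using step[of 0] by (simp add: smult_smult_mat)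
  then have "z = 1 / k * z powi (b * a)"
    by (rule smult_mat_cancel[OF one_carrier_mat one_mat_neq_zero])
  then have "z powi (a * b) = k * z" using k0 by (simp add: field_simps)
  then have "z powi (a * b - 1) = k" using z0 by (simp add: power_int_diff)
  then show ?thesis using that wv zn by blast
qed

end

section \<open>Shift, clock and modulated product operators\<close>

lemma shift_mat_power:
  assumes "N > 0"
  shows "shift_mat N ^\<^sub>m k = mat N N (\<lambda>(i, j). if i = (j + k) mod N then 1 else 0)"
proof (induction k)
  case 0
  show ?case by (intro eq_matI) (auto simp: shift_mat_def)
next
  case (Suc k)
  have S: "shift_mat N \<in> carrier_mat N N" by (simp add: shift_mat_def)
  show ?case
  proof (rule eq_matI)
    fix i j
    assume "i < dim_row (mat N N (\<lambda>(i, j). if i = (j + Suc k) mod N then 1 else 0 :: complex))"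
      "j < dim_col (mat N N (\<lambda>(i, j). if i = (j + Suc k) mod N then 1 else 0 :: complex))"
    then have ij: "i < N" "j < N" by auto
    have "(shift_mat N ^\<^sub>m Suc k) $$ (i, j) = (\<Sum>l<N. (shift_mat N ^\<^sub>m k) $$ (i, l) * shift_mat N $$ (l, j))"
      using mult_mat_index_sum[OF pow_carrier_mat[OF S] S ij, of k] by simp
    also have "\<dots> = (\<Sum>l<N. if l = (j + 1) mod N then (if i = ((j + 1) mod N + k) mod N then 1 else 0) else 0)"
      unfolding Suc.IH using ij by (intro sum.cong) (auto simp: shift_mat_def)
    also have "\<dots> = (if i = ((j + 1) mod N + k) mod N then 1 else 0)" using assms by simp
    also have "((j + 1) mod N + k) mod N = (j + Suc k) mod N" by (simp add: mod_simps)
    finally show "(shift_mat N ^\<^sub>m Suc k) $$ (i, j) =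
        mat N N (\<lambda>(i, j). if i = (j + Suc k) mod N then 1 else 0) $$ (i, j)"
      using ij by simp
  qed (use S in auto)
qed

lemma unitary_shift_mat:
  assumes "N > 0"
  shows "unitary_mat N (shift_mat N)"
proof -
  have S: "shift_mat N \<in> carrier_mat N N" by (simp add: shift_mat_def)
  have "mat_adjoint (shift_mat N) * shift_mat N = 1\<^sub>m N"
  proof (rule eq_matI)
    fix i j assume "i < dim_row (1\<^sub>m N :: complex mat)" "j < dim_col (1\<^sub>m N :: complex mat)"
    then have ij: "i < N" "j < N" by auto
    have "(mat_adjoint (shift_mat N) * shift_mat N) $$ (i, j) =
        (\<Sum>l<N. mat_adjoint (shift_mat N) $$ (i, l) * shift_mat N $$ (l, j))"
      using S ij by (intro mult_mat_index_sum) auto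
    also have "\<dots> = (\<Sum>l<N. if l = (j + 1) mod N then (if (j + 1) mod N = (i + 1) mod N then 1 else 0) else 0)"
      using ij S by (intro sum.cong) (auto simp: shift_mat_def)
    also have "\<dots> = (if (j + 1) mod N = (i + 1) mod N then 1 else 0)" using assms by simp
    also have "(j + 1) mod N = (i + 1) mod N \<longleftrightarrow> i = j"
    proof -
      have "(j + 1) mod N = (if j + 1 = N then 0 else j + 1)" "(i + 1) mod N = (if i + 1 = N then 0 else i + 1)"
        using ij by auto
      then show ?thesis by auto
    qed
    finally show "(mat_adjoint (shift_mat N) * shift_mat N) $$ (i, j) = 1\<^sub>m N $$ (i, j)" using ij by simp
  qed (use S in auto)
  then show ?thesis
    using mat_mult_left_right_inverse[of "mat_adjoint (shift_mat N)" N "shift_mat N"] S by (simp add: unitary_mat_def)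
qed

lemma mat_powi_of_nat: "mat_powi S (int k) = S ^\<^sub>m k"
  by (simp add: mat_powi_def)

lemma shift_mat_order: "N > 0 \<Longrightarrow> mat_powi (shift_mat N) (int N) = 1\<^sub>m N"
  unfolding mat_powi_of_nat by (subst shift_mat_power) (auto intro!: eq_matI)

lemma mult_diag_mat:
  "mat N N (\<lambda>(i, j). if i = j then f i else 0) * mat N N (\<lambda>(i, j). if i = j then g i else 0) =
   mat N N (\<lambda>(i, j). if i = j then f i * g i else 0 :: complex)"
proof (rule eq_matI)
  fix i j assume "i < dim_row (mat N N (\<lambda>(i, j). if i = j then f i * g i else 0 :: complex))"
    "j < dim_col (mat N N (\<lambda>(i, j). if i = j then f i * g i else 0 :: complex))"
  then have ij: "i < N" "j < N" by auto
  let ?F = "mat N N (\<lambda>(i, j). if i = j then f i else 0)" and ?G = "mat N N (\<lambda>(i, j). if i = j then g i else 0)"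
  have "(?F * ?G) $$ (i, j) = (\<Sum>l<N. ?F $$ (i, l) * ?G $$ (l, j))"
    using ij by (intro mult_mat_index_sum) auto
  also have "\<dots> = (\<Sum>l<N. if l = i then (if i = j then f i * g i else 0) else 0)"
    using ij by (intro sum.cong) auto
  finally show "(?F * ?G) $$ (i, j) = mat N N (\<lambda>(i, j). if i = j then f i * g i else 0) $$ (i, j)"
    using ij by simp
qed auto

lemma clock_mat_power:
  "clock_mat N ^\<^sub>m k = mat N N (\<lambda>(i, j). if i = j then root_unity_pow N (int i) ^ k else 0)"
proof (induction k)
  case 0
  show ?case by (intro eq_matI) (auto simp: clock_mat_def)
next
  case (Suc k)
  show ?case
    unfolding pow_mat.simps(2) Suc.IH unfolding clock_mat_def mult_diag_mat by (simp only: power_Suc2)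
qed

lemma unitary_clock_mat: "unitary_mat N (clock_mat N)"
proof -
  have adj: "mat_adjoint (clock_mat N) = mat N N (\<lambda>(i, j). if i = j then cnj (root_unity_pow N (int i)) else 0)"
    by (rule eq_matI) (auto simp: clock_mat_def)
  have "x * cnj x = 1" if "cmod x = 1" for x
    using that complex_norm_square[of x] by simp
  then have "root_unity_pow N k * cnj (root_unity_pow N k) = 1" for k by simp
  then show ?thesis
    unfolding unitary_mat_def adj unfolding clock_mat_def
    by (auto simp: mult_diag_mat mult.commute intro!: eq_matI)
qed

lemma clock_mat_order:
  assumes "N > 0"
  shows "mat_powi (clock_mat N) (int N) = 1\<^sub>m N"
  unfolding mat_powi_of_nat clock_mat_power using assms
  by (auto intro!: eq_matI simp: root_unity_pow_power root_unity_pow_eq_1_iff)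

lemma concat_replicate_periodic:
  assumes "\<And>j. f (j + L) = f j"
  shows "concat (replicate m (map f [0..<L])) = map f [0..<m * L]"
proof (induction m)
  case (Suc m)
  have "[0..<Suc m * L] = [0..<L] @ [0 + L..<m * L + L]"
    using upt_add_eq_append[of 0 L "m * L"] by (simp add: add.commute)
  also have "[0 + L..<m * L + L] = map (\<lambda>i. i + L) [0..<m * L]"
    by (simp add: map_add_upt)
  finally have "map f [0..<Suc m * L] = map f [0..<L] @ map f [0..<m * L]"
    by (simp add: assms o_def)
  then show ?case using Suc by simp
qed simp

text \<open>Because \<open>a ^ L\<close> is 1 modulo the order of \<open>S\<close>, the exponents
  may keep growing beyond the first period, and one formula covers all \<open>m * L\<close> sites.
  The site label also changes from starting at 1 to starting at 0.\<close>

lemma product_op_power_modulated: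
  fixes a :: int
  assumes S: "unitary_mat N S" "mat_powi S (int N) = 1\<^sub>m N" and aL: "[a ^ L = 1] (mod int N)"
  shows "product_op_power m (map (\<lambda>j. mat_powi S (a ^ (j - 1))) [1..<L + 1]) =
    map (\<lambda>j. mat_powi S (a ^ j)) [0..<m * L]"
proof -
  have "mat_powi S (a ^ (j + L)) = mat_powi S (a ^ j)" for j
    using cong_mult[OF cong_refl aL, of "a ^ j"] by (intro mat_powi_cong[OF S]) (simp add: power_add)
  moreover have "map (\<lambda>j. mat_powi S (a ^ (j - 1))) [1..<L + 1] = map (\<lambda>j. mat_powi S (a ^ j)) [0..<L]"
    by (rule nth_equalityI) (auto simp del: upt_Suc)
  ultimately show ?thesis by (simp add: product_op_power_def concat_replicate_periodic)
qed

lemma (in injective_tensor) modulated_symmetry_eq_up_to_phase: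
  fixes a :: int
  assumes iS: "intertwined S c v (mat_powi v a)" and j: "j \<ge> 1"
  shows "eq_up_to_phase N (phys_act N n (mat_powi S (a ^ (j - 1))) A)
    (\<lambda>s. mat_powi (mat_adjoint v) (a ^ (j - 1)) * A s * mat_powi v (a ^ j))"
proof -
  obtain d where d: "intertwined (mat_powi S (a ^ (j - 1))) d (mat_powi v (a ^ (j - 1))) (mat_powi (mat_powi v a) (a ^ (j - 1)))"
    using intertwined_powi[OF iS] .
  have "a ^ j = a * a ^ (j - 1)" using j by (cases j) auto
  then have "mat_powi (mat_powi v a) (a ^ (j - 1)) = mat_powi v (a ^ j)"
    using mat_powi_mult[OF intertwinedD(3)[OF iS], of a "a ^ (j - 1)"] by simp
  then show ?thesis
    using d by (auto simp: eq_up_to_phase_def intertwined_def mat_powi_adjoint[OF intertwinedD(3)[OF iS]])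
qed

lemma symmetric_injective_mps_bond_unitaries:
  fixes N L :: nat and a b n :: int
  assumes N: "2 \<le> N" and L: "1 \<le> L"
    and aL: "[a ^ L = 1] (mod int N)" and bL: "[b ^ L = 1] (mod int N)"
    and sym: "symmetric_injective_mps N a b n L \<chi> A"
  obtains v w k where "unitary_mat \<chi> v" "unitary_mat \<chi> w"
    "\<And>j. j \<ge> 1 \<Longrightarrow> eq_up_to_phase N (phys_act N \<chi> (mat_powi (shift_mat N) (a ^ (j - 1))) A)
       (\<lambda>s. mat_powi (mat_adjoint v) (a ^ (j - 1)) * A s * mat_powi v (a ^ j))"
    "\<And>j. j \<ge> 1 \<Longrightarrow> eq_up_to_phase N (phys_act N \<chi> (mat_powi (clock_mat N) (n * b ^ (j - 1))) A)
       (\<lambda>s. mat_powi (mat_adjoint w) (b ^ (j - 1)) * A s * mat_powi w (b ^ j))"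
    "k \<in> {0..<int N}" "w * v * mat_inv w * mat_inv v = root_unity_pow N k \<cdot>\<^sub>m 1\<^sub>m \<chi>"
    "[k * (a * b - 1) = n] (mod int N)"
proof -
  interpret injective_tensor N \<chi> A
    using sym by unfold_locales (simp add: symmetric_injective_mps_def)
  have N0: "N > 0" and L0: "L > 0" using N L by auto
  define S where "S = shift_mat N"
  \<comment> \<open>Absorbing \<open>n\<close> into the operator gives both symmetries the same
    shape, powers \<open>a ^ j\<close> or \<open>b ^ j\<close> of a unitary whose
    \<open>N\<close>-th power is 1.\<close>
  define T where "T = mat_powi (clock_mat N) n"
  have S: "unitary_mat N S" "mat_powi S (int N) = 1\<^sub>m N"
    unfolding S_def using N0 by (auto intro: unitary_shift_mat shift_mat_order)
  have Z: "unitary_mat N (clock_mat N)" by (rule unitary_clock_mat)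
  have T: "unitary_mat N T" "mat_powi T (int N) = 1\<^sub>m N"
    unfolding T_def using Z N0 mat_powi_mult[OF Z, of "int N" n] mat_powi_mult[OF Z, of n "int N"]
    by (auto intro: unitary_mat_powi simp: clock_mat_order mult.commute)
  have Tpow: "mat_powi T k = mat_powi (clock_mat N) (n * k)" for k
    by (simp add: T_def mat_powi_mult[OF Z])
  have eigx: "is_eigenstate N (map (\<lambda>j. mat_powi S (a ^ j)) [0..<m * L]) (periodic_mps \<chi> A)" if "m > 0" for m
  proof -
    have "is_eigenstate N (product_op_power m (U_x N a L)) (periodic_mps \<chi> A)"
      using sym that by (simp add: symmetric_injective_mps_def)
    then show ?thesis unfolding U_x_def S_def[symmetric] product_op_power_modulated[OF S aL] .
  qed
  have eigz: "is_eigenstate N (map (\<lambda>j. mat_powi T (b ^ j)) [0..<m * L]) (periodic_mps \<chi> A)" if "m > 0" for m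
  proof -
    have "is_eigenstate N (product_op_power m (U_z N n b L)) (periodic_mps \<chi> A)"
      using sym that by (simp add: symmetric_injective_mps_def)
    then show ?thesis unfolding U_z_def Tpow[symmetric] product_op_power_modulated[OF T bL] .
  qed
  obtain v c m where v: "intertwined S c v (mat_powi v a)" "cmod m = 1" "mat_powi v (a ^ L) = m \<cdot>\<^sub>m v"
    using modulated_symmetry_bond_unitary[OF S aL L0 eigx] .
  obtain w d l where w: "intertwined T d w (mat_powi w b)" "cmod l = 1" "mat_powi w (b ^ L) = l \<cdot>\<^sub>m w"
    using modulated_symmetry_bond_unitary[OF T bL L0 eigz] .
  note vu = intertwinedD(3)[OF v(1)] and wu = intertwinedD(3)[OF w(1)]
  let ?\<omega> = "root_unity_pow N"
  have zs: "clock_mat N * S = ?\<omega> 1 \<cdot>\<^sub>m (S * clock_mat N)"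
    unfolding S_def by (rule clock_shift_commute)
  have w0: "?\<omega> 1 \<noteq> 0" by (simp add: root_unity_pow_def)
  have TS: "T * S = ?\<omega> n \<cdot>\<^sub>m (S * T)"
    using phase_commute_powi[OF S(1) Z w0 zs, of n 1] mat_powi_1[OF S(1)] by (simp add: T_def root_unity_pow_powi)
  obtain z where z: "w * v = z \<cdot>\<^sub>m (v * w)" "cmod z = 1" "z powi (a * b - 1) = ?\<omega> n"
    using bond_unitary_commutator[OF v(1) v(3,2) w(1) w(3,2) TS norm_root_unity_pow L0] .
  have z0: "z \<noteq> 0" using z(2) by auto
  obtain e where e: "mat_powi v (int N) = e \<cdot>\<^sub>m 1\<^sub>m \<chi>"
    using bond_unitary_power_scalar[OF v(1) L0 v(3,2) S(2)] .
  have "cmod e = 1" using unitary_scalar_norm[of \<chi> e] unitary_mat_powi[OF vu, of "int N"] e bond_dim_pos by simp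
  then have e0: "e \<noteq> 0" by auto
  \<comment> \<open>The \<open>N\<close>-th power of \<open>v\<close> is a scalar and so commutes
    with \<open>w\<close>, while moving \<open>w\<close> past it costs \<open>z ^ N\<close>.\<close>
  have "z ^ N = 1"
  proof -
    note wc = unitary_matD(1)[OF wu]
    have "w * mat_powi v (int N) = (z powi int N) \<cdot>\<^sub>m (mat_powi v (int N) * w)"
      by (rule phase_commute_powi_right[OF vu wu z0 z(1)])
    then have "e \<cdot>\<^sub>m w = (z ^ N * e) \<cdot>\<^sub>m w"
      using wc by (simp add: e mult_smult_distrib[of _ \<chi> \<chi> _ \<chi>] mult_smult_assoc_mat[of _ \<chi> \<chi> _ \<chi>] smult_smult_mat)
    then have "mat_adjoint w * (e \<cdot>\<^sub>m w) = mat_adjoint w * ((z ^ N * e) \<cdot>\<^sub>m w)" by simp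
    then have "e \<cdot>\<^sub>m 1\<^sub>m \<chi> = (z ^ N * e) \<cdot>\<^sub>m (1\<^sub>m \<chi> :: complex mat)"
      using unitary_matD[OF wu] by (simp add: mult_smult_distrib[of _ \<chi> \<chi> _ \<chi>])
    then have "e = z ^ N * e" by (rule smult_mat_cancel[OF one_carrier_mat one_mat_neq_zero])
    then show ?thesis using e0 by simp
  qed
  then obtain k where k: "k \<in> {0..<int N}" "z = ?\<omega> k"
    using root_of_unity_is_root_unity_pow[OF N0] by blast
  show ?thesis
  proof (rule that[of v w k])
    show "unitary_mat \<chi> v" "unitary_mat \<chi> w" "k \<in> {0..<int N}" by (fact vu wu k(1))+
    show "eq_up_to_phase N (phys_act N \<chi> (mat_powi (shift_mat N) (a ^ (j - 1))) A)
       (\<lambda>s. mat_powi (mat_adjoint v) (a ^ (j - 1)) * A s * mat_powi v (a ^ j))" if "j \<ge> 1" for j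
      using modulated_symmetry_eq_up_to_phase[OF v(1) that] by (simp add: S_def)
    show "eq_up_to_phase N (phys_act N \<chi> (mat_powi (clock_mat N) (n * b ^ (j - 1))) A)
       (\<lambda>s. mat_powi (mat_adjoint w) (b ^ (j - 1)) * A s * mat_powi w (b ^ j))" if "j \<ge> 1" for j
      using modulated_symmetry_eq_up_to_phase[OF w(1) that] by (simp add: Tpow)
    show "w * v * mat_inv w * mat_inv v = ?\<omega> k \<cdot>\<^sub>m 1\<^sub>m \<chi>"
      using commutator_eq_iff[OF vu wu] z(1) k(2) by (simp add: mat_inv_unitary[OF vu] mat_inv_unitary[OF wu])
    have "?\<omega> (k * (a * b - 1)) = ?\<omega> n" using z(3) by (simp add: k(2) root_unity_pow_powi)
    then show "[k * (a * b - 1) = n] (mod int N)" by (simp add: root_unity_pow_eq_iff[OF N0])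
  qed
qed

section \<open>Linear congruences\<close>

lemma linear_cong_dvd:
  fixes k q n N :: int
  assumes "[k * q = n] (mod N)"
  shows "gcd q N dvd n"
  using assms by (metis cong_dvd_iff cong_dvd_modulus dvd_mult gcd_dvd1 gcd_dvd2)

text \<open>Dividing the congruence by \<open>c\<close> makes the coefficient invertible modulo
  \<open>N div c\<close>, so \<open>k\<close> is determined to that modulus; its lifts to modulus
  \<open>N\<close> differ by multiples of \<open>N div c\<close>, and the multiplier matters only
  modulo \<open>c\<close>.\<close>

lemma linear_cong_solution:
  fixes k q n N c :: int
  assumes N: "N > 0" and c: "c = gcd q N" and k: "[k * q = n] (mod N)" and cn: "c dvd n"
  shows "\<exists>t\<in>{0..<c}. [k = n div c * modular_inverse (N div c) (q div c) + t * (N div c)] (mod N)"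
proof -
  have c0: "c > 0" using N c by simp
  define M p r where "M = N div c" and "p = q div c" and "r = n div c"
  have eqs: "N = c * M" "q = c * p" "n = c * r"
    using c cn by (simp_all add: M_def p_def r_def)
  have cop: "coprime p M"
    unfolding M_def p_def c using N by (intro div_gcd_coprime) auto
  have "[c * (k * p) = c * r] (mod (c * M))" using k by (simp add: eqs mult_ac)
  then have "[k * p = r] (mod M)"
    using c0 by (simp add: cong_iff_dvd_diff flip: right_diff_distrib)
  then have "[k * p * modular_inverse M p = r * modular_inverse M p] (mod M)" by (intro cong_mult cong_refl)
  moreover have "[k * p * modular_inverse M p = k] (mod M)"
    using cong_mult[OF cong_refl cong_modular_inverse1[OF cop], of k] by (simp add: mult.assoc)
  ultimately have "[k = r * modular_inverse M p] (mod M)" by (meson cong_sym cong_trans)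
  then obtain t where t: "k = r * modular_inverse M p + M * t" by (metis cong_iff_lin cong_sym)
  have "[k = r * modular_inverse M p + (t mod c) * M] (mod N)"
  proof -
    have "k - (r * modular_inverse M p + (t mod c) * M) = M * (t - t mod c)" by (simp add: t algebra_simps)
    also have "t - t mod c = c * (t div c)" by (simp add: minus_mod_eq_mult_div)
    finally show ?thesis by (simp add: cong_iff_dvd_diff eqs(1))
  qed
  then show ?thesis using c0 unfolding M_def p_def r_def
    by (intro bexI[of _ "t mod c"]) auto
qed

lemma linear_cong_unique:
  fixes q n N :: int
  assumes N: "N > 0" and cop: "gcd q N = 1"
  shows "\<exists>!k. k \<in> {0..<N} \<and> [k * q = n] (mod N)"
proof -
  have cop': "coprime q N" using cop by (simp add: coprime_iff_gcd_eq_1)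
  define k0 where "k0 = (n * modular_inverse N q) mod N"
  have "[k0 * q = n * modular_inverse N q * q] (mod N)"
    unfolding k0_def by (intro cong_mult cong_refl) (simp add: cong_def)
  also have "[n * modular_inverse N q * q = n * 1] (mod N)"
    using cong_mult[OF cong_refl cong_modular_inverse2[OF cop'], of n] by (simp add: mult.assoc)
  finally have 1: "k0 \<in> {0..<N} \<and> [k0 * q = n] (mod N)" using N by (simp add: k0_def)
  moreover have "k = k0" if "k \<in> {0..<N} \<and> [k * q = n] (mod N)" for k
  proof -
    have "[k * q = k0 * q] (mod N)" using that 1 by (meson cong_sym cong_trans)
    then have "[k = k0] (mod N)" using cop' by (simp add: cong_mult_rcancel)
    then show ?thesis using that 1 by (simp add: cong_def)
  qed
  ultimately show ?thesis by blast
qed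

lemma linear_cong_zero_iff:
  fixes k q n N :: int
  assumes cop: "gcd q N = 1" and k: "k \<in> {0..<N}" "[k * q = n] (mod N)"
  shows "k = 0 \<longleftrightarrow> [n = 0] (mod N)"
proof -
  have "[n = 0] (mod N) \<longleftrightarrow> [k * q = 0] (mod N)" using k(2) by (meson cong_sym cong_trans)
  also have "\<dots> \<longleftrightarrow> N dvd k"
    using cop by (simp add: cong_0_iff coprime_dvd_mult_left_iff coprime_iff_gcd_eq_1 gcd.commute)
  also have "\<dots> \<longleftrightarrow> k = 0" using k(1) by (auto simp: zdvd_not_zless intro: ccontr)
  finally show ?thesis by simp
qed

theorem mainTheorem5:
  fixes N L :: nat and a b n c :: int
  assumes N: "2 \<le> N"
    and a: "coprime a (int N)" and b: "coprime b (int N)"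
    and L: "1 \<le> L"
    and aL: "[a ^ L = 1] (mod int N)" and bL: "[b ^ L = 1] (mod int N)"
    and c: "c = gcd (a * b - 1) (int N)"
  shows
    "(\<forall>\<chi> A. symmetric_injective_mps N a b n L \<chi> A \<longrightarrow>
        (\<exists>v\<^sub>x v\<^sub>z. unitary_mat \<chi> v\<^sub>x \<and> unitary_mat \<chi> v\<^sub>z \<and>
          (\<forall>j\<ge>1. eq_up_to_phase N
              (phys_act N \<chi> (mat_powi (shift_mat N) (a ^ (j - 1))) A)
              (\<lambda>s. mat_powi (mat_adjoint v\<^sub>x) (a ^ (j - 1)) * A s * mat_powi v\<^sub>x (a ^ j))) \<and>
          (\<forall>j\<ge>1. eq_up_to_phase N
              (phys_act N \<chi> (mat_powi (clock_mat N) (n * b ^ (j - 1))) A)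
              (\<lambda>s. mat_powi (mat_adjoint v\<^sub>z) (b ^ (j - 1)) * A s * mat_powi v\<^sub>z (b ^ j))) \<and>
          (\<exists>k\<in>{0..<int N}.
              v\<^sub>z * v\<^sub>x * mat_inv v\<^sub>z * mat_inv v\<^sub>x = root_unity_pow N k \<cdot>\<^sub>m 1\<^sub>m \<chi> \<and>
              [k * (a * b - 1) = n] (mod int N) \<and>
              (c dvd n \<longrightarrow>
                (\<exists>\<tau>\<in>{0..<c}.
                  [k = n div c * modular_inverse (int N div c) ((a * b - 1) div c)
                        + \<tau> * (int N div c)] (mod int N)))))) \<and>
     (\<not> c dvd n \<longrightarrow> \<not> (\<exists>\<chi> A. symmetric_injective_mps N a b n L \<chi> A)) \<and>
     (c = 1 \<longrightarrow> (\<exists>!k. k \<in> {0..<int N} \<and> [k * (a * b - 1) = n] (mod int N)) \<and>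
        (\<forall>k\<in>{0..<int N}. [k * (a * b - 1) = n] (mod int N) \<longrightarrow>
            (k \<noteq> 0 \<longleftrightarrow> \<not> [n = 0] (mod int N))))"
proof (intro conjI allI impI)
  have N0: "int N > 0" using N by simp
  fix \<chi> A assume sym: "symmetric_injective_mps N a b n L \<chi> A"
  obtain v w k where vw: "unitary_mat \<chi> v" "unitary_mat \<chi> w"
    "\<And>j. j \<ge> 1 \<Longrightarrow> eq_up_to_phase N (phys_act N \<chi> (mat_powi (shift_mat N) (a ^ (j - 1))) A)
       (\<lambda>s. mat_powi (mat_adjoint v) (a ^ (j - 1)) * A s * mat_powi v (a ^ j))"
    "\<And>j. j \<ge> 1 \<Longrightarrow> eq_up_to_phase N (phys_act N \<chi> (mat_powi (clock_mat N) (n * b ^ (j - 1))) A)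
       (\<lambda>s. mat_powi (mat_adjoint w) (b ^ (j - 1)) * A s * mat_powi w (b ^ j))"
    "k \<in> {0..<int N}" "w * v * mat_inv w * mat_inv v = root_unity_pow N k \<cdot>\<^sub>m 1\<^sub>m \<chi>"
    and k: "[k * (a * b - 1) = n] (mod int N)"
    by (rule symmetric_injective_mps_bond_unitaries[OF N L aL bL sym]) (rule that)
  have sol: "c dvd n \<longrightarrow> (\<exists>\<tau>\<in>{0..<c}.
      [k = n div c * modular_inverse (int N div c) ((a * b - 1) div c) + \<tau> * (int N div c)] (mod int N))"
    using linear_cong_solution[OF N0 c k] by blast
  show "\<exists>v\<^sub>x v\<^sub>z. unitary_mat \<chi> v\<^sub>x \<and> unitary_mat \<chi> v\<^sub>z \<and>
          (\<forall>j\<ge>1. eq_up_to_phase N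
              (phys_act N \<chi> (mat_powi (shift_mat N) (a ^ (j - 1))) A)
              (\<lambda>s. mat_powi (mat_adjoint v\<^sub>x) (a ^ (j - 1)) * A s * mat_powi v\<^sub>x (a ^ j))) \<and>
          (\<forall>j\<ge>1. eq_up_to_phase N
              (phys_act N \<chi> (mat_powi (clock_mat N) (n * b ^ (j - 1))) A)
              (\<lambda>s. mat_powi (mat_adjoint v\<^sub>z) (b ^ (j - 1)) * A s * mat_powi v\<^sub>z (b ^ j))) \<and>
          (\<exists>k\<in>{0..<int N}.
              v\<^sub>z * v\<^sub>x * mat_inv v\<^sub>z * mat_inv v\<^sub>x = root_unity_pow N k \<cdot>\<^sub>m 1\<^sub>m \<chi> \<and>
              [k * (a * b - 1) = n] (mod int N) \<and>
              (c dvd n \<longrightarrow>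
                (\<exists>\<tau>\<in>{0..<c}.
                  [k = n div c * modular_inverse (int N div c) ((a * b - 1) div c)
                        + \<tau> * (int N div c)] (mod int N))))"
    by (intro exI[of _ v] exI[of _ w] conjI allI impI)
      (assumption | rule vw(1-4) | rule bexI[OF _ vw(5)] | rule conjI vw(6) k sol)+
next
  assume "\<not> c dvd n"
  moreover have "c dvd n" if sym: "symmetric_injective_mps N a b n L \<chi> A" for \<chi> A
  proof -
    obtain k where "[k * (a * b - 1) = n] (mod int N)"
      using symmetric_injective_mps_bond_unitaries[OF N L aL bL sym] by blast
    then show ?thesis unfolding c by (rule linear_cong_dvd)
  qed
  ultimately show "\<not> (\<exists>\<chi> A. symmetric_injective_mps N a b n L \<chi> A)" by blast
next
  assume "c = 1"
  then show "\<exists>!k. k \<in> {0..<int N} \<and> [k * (a * b - 1) = n] (mod int N)"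
    using N c by (intro linear_cong_unique) auto
next
  assume c1: "c = 1"
  show "\<forall>k\<in>{0..<int N}. [k * (a * b - 1) = n] (mod int N) \<longrightarrow> (k \<noteq> 0 \<longleftrightarrow> \<not> [n = 0] (mod int N))"
    using c1 c linear_cong_zero_iff[of "a * b - 1" "int N"] by auto
qed

end
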